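(* Let $\Gamma$ be a regular ciliated ribbon graph with vertex set $V$ and edge set $E$. The formula $$X\lhd(\delta\otimes z)_v=\mathrm{Hol}_{p_v}(S(z_{(2)})\otimes1)\cdot\mathrm{Hol}_{p_{f(v)}}(1\otimes S(\delta_{(1)}))\cdot X\cdot\mathrm{Hol}_{p_{f(v)}}(1\otimes\delta_{(2)})\cdot\mathrm{Hol}_{p_v}(z_{(1)}\otimes1),$$ for $X\in\mathcal H(H)^{\otimes E}$, $v\in V$, $\delta\in H^*$, $z\in H$ (equivalently $X\lhd d_v=\tau_v(S(d_{(2)}))\cdot X\cdot\tau_v(d_{(1)})$ for $d\in D(H)$), defines a right $D(H)^{\otimes V}$-module structure on $\mathcal H(H)^{\otimes E}$ which makes the opposite algebra $\mathcal H(H)^{op\otimes E}$ a right $D(H)^{\otimes V}$-module algebra, i.e. $(X\cdot_{op}Y)\lhd d=(X\lhd d_{(1)})\cdot_{op}(Y\lhd d_{(2)})$ and $1\lhd d=\epsilon(d)1$.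
   Context: $\mathbb F$ is a field of characteristic zero and $H$ is a finite-dimensional semisimple Hopf algebra over $\mathbb F$ with dual $H^*$; $S$ denotes the antipodes of $H$ and $H^*$ ($S^2=\mathrm{id}$), $\epsilon$ the counits, Sweedler notation without summation sign; $\{x_i\}$ is a basis of $H$, $\{\alpha^i\}$ the dual basis. The Drinfeld double $D(H)$ is the Hopf algebra on $H^*\otimes H$ with multiplication $(\alpha\otimes h)(\alpha'\otimes h')=\langle\alpha'_{(3)},h_{(1)}\rangle\langle S^{-1}(\alpha'_{(1)}),h_{(3)}\rangle\,\alpha\alpha'_{(2)}\otimes h_{(2)}h'$, unit $1\otimes1$, comultiplication $\Delta(\alpha\otimes h)=(\alpha_{(2)}\otimes h_{(1)})\otimes(\alpha_{(1)}\otimes h_{(2)})$, counit $\epsilon(\alpha)\epsilon(h)$, antipode $S(\alpha\otimes h)=\langle\alpha_{(1)},h_{(3)}\rangle\langle S^{-1}(\alpha_{(3)}),h_{(1)}\rangle S(\alpha_{(2)})\otimes S(h_{(2)})$. For a vertex $v$ and $d\in D(H)$, $(d)_v\in D(H)^{\otimes V}$ is $d$ in the factor $v$ and $1$ elsewhere. $D(H)^*$ is the Hopf algebra on $H\otimes H^*$ with multiplication $(y\otimes\gamma)(z\otimes\delta)=zy\otimes\gamma\delta$, unit $1\otimes1$, counit $\epsilon(y)\epsilon(\gamma)$, comultiplication $\Delta_D(y\otimes\gamma)=\sum_{i,j}(y_{(1)}\otimes\alpha^i\gamma_{(1)}\alpha^j)\otimes(S(x_j)y_{(2)}x_i\otimes\gamma_{(2)})$,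 antipode $S_D(y\otimes\gamma)=\sum_{i,j}x_iS^{-1}(y)x_j\otimes S(\alpha^j)S(\gamma)\alpha^i$. The Heisenberg double $\mathcal H(H)$ is the algebra on $H\otimes H^*$ with unit $1\otimes1$ and multiplication $(h\otimes\alpha)\cdot(h'\otimes\alpha')=\langle\alpha_{(1)},h'_{(2)}\rangle\,hh'_{(1)}\otimes\alpha_{(2)}\alpha'$; $\mathcal H(H)^{op\otimes E}$ is $\mathcal H(H)^{\otimes E}$ with opposite multiplication $X\cdot_{op}Y=Y\cdot X$. For a finite set $X$ and an algebra $A$, $A^{\otimes X}$ is the tensor product of copies of $A$ indexed by $X$; $(a)_x$ denotes the pure tensor with $a$ in the factor $x$ and $1$ elsewhere. Graphs: a ribbon graph is a finite directed graph with a cyclic ordering of the edge ends at each vertex; $e^{-1}$ is the reversed edge. A ciliated vertex carries a linear ordering of its incident edge ends inducing the cyclic one (indicated by a cilium placed before the edge end of lowest order). Paths are written as words read right to left ($e_1^{\epsilon_1}\circ\cdots\circ e_n^{\epsilon_n}$ traverses $e_n^{\epsilon_n}$ first). A ciliated face is a closed path turning maximally right at each vertex passed, including the start (the outgoing edge end comes directly after the incoming one in the cyclic ordering), and traversing each edge at most once in each direction. $\Gamma$ is a regular ciliated ribbon graph if all vertices are ciliated, there are no loops or multiple edges, each face traverses each edge at most once and each face contains exactly one cilium. For a vertex $v$ of such $\Gamma$, $f(v)=e_1^{\epsilon_1}\circ\cdots\circ e_n^{\epsilon_n}$ denotes the unique ciliated face starting and ending at $v$ and passing the cilium of $v$, i.e.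 $e_n$ is the edge end of lowest and $e_1$ the edge end of highest order at $v$. Thickening: $\Gamma_D$ has, for each edge $e$ of $\Gamma$, the four edges $r(e),l(e),r(\bar e),l(\bar e)$: $r(e),l(e)$ run parallel to $e$ on its right resp. left, $r(\bar e)$ crosses $e$ near its target end from right to left, $l(\bar e)$ crosses $e$ near its starting end from right to left; vertices of $\Gamma_D$ are the corners of $\Gamma$. For reversed edges $r(e^{-1})=l(e)^{-1}$, $l(e^{-1})=r(e)^{-1}$, $r(\overline{e^{-1}})=l(\bar e)^{-1}$, $l(\overline{e^{-1}})=r(\bar e)^{-1}$. Holonomy: with the convolution product $\phi\bullet\psi=m'\circ(\phi\otimes\psi)\circ\Delta_D$ on $\mathrm{Hom}_{\mathbb F}(H\otimes H^*,(H\otimes H^* )^{\otimes E})$, $m'$ the multiplication of the tensor product algebra $D(H)^{*\otimes E}$, $\mathrm{Hol}$ is the functor on the path groupoid of $\Gamma_D$ with $\mathrm{Hol}_{p\circ q}=\mathrm{Hol}_p\bullet\mathrm{Hol}_q$ determined by $\mathrm{Hol}_{r(e)}(y\otimes\gamma)=\epsilon(y)(1\otimes\gamma)_e$, $\mathrm{Hol}_{r(\bar e)}(y\otimes\gamma)=\epsilon(\gamma)(y\otimes1)_e$, $\mathrm{Hol}_{l(e)}(y\otimes\gamma)=\epsilon(y)\sum_{i,j}(x_iS(x_j)\otimes\alpha^j\gamma\alpha^i)_e$, $\mathrm{Hol}_{l(\bar e)}(y\otimes\gamma)=\epsilon(\gamma)\sum_{i,j}(x_iyS(x_j)\otimes\alpha^j\alpha^i)_e$,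 $\mathrm{Hol}_{x^{-1}}=\mathrm{Hol}_x\circ S_D$. Products $\cdot$ are taken in $\mathcal H(H)^{\otimes E}$. Vertex and face loops: if $v$ has incident edges $e_1,\dots,e_n$ numbered by the ordering at $v$ and $e_k^{\epsilon_k}$ is incoming at $v$, the vertex loop is $p_v=r(\overline{e_1^{\epsilon_1}})\circ\cdots\circ r(\overline{e_n^{\epsilon_n}})$. For a ciliated face $f=e_1^{\epsilon_1}\circ\cdots\circ e_n^{\epsilon_n}$ the face loop is $p_f=r(e_1^{\epsilon_1})\circ\cdots\circ r(e_n^{\epsilon_n})$. $\tau_v:D(H)\to\mathcal H(H)^{\otimes E}$ is $\tau_v(\delta\otimes z)=\mathrm{Hol}_{p_{f(v)}}(1\otimes\delta)\cdot\mathrm{Hol}_{p_v}(z\otimes1)$. *)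

theory Defs
  imports Main
begin

(* ===================================================================== *)
(* Linear algebra via bases.                                             *)
(* A vector in a space with basis indexed by a finite type 'b is its     *)
(* coefficient function 'b => 'k.  Tensor products of spaces with bases  *)
(* indexed by 'b1,'b2 have basis 'b1 * 'b2; tensor powers indexed by a   *)
(* finite set X (a finite type 'x) have basis 'x => 'b.                  *)
(* ===================================================================== *)

definition bas :: "'b \<Rightarrow> 'b \<Rightarrow> 'k::zero_neq_one" where
  "bas a = (\<lambda>b. if b = a then 1 else 0)"

text \<open>linear map given by its matrix (image of each basis vector)\<close>
definition lin :: "('a::finite \<Rightarrow> 'b \<Rightarrow> 'k::comm_ring_1) \<Rightarrow> ('a \<Rightarrow> 'k) \<Rightarrow> ('b \<Rightarrow> 'k)" where
  "lin A x = (\<lambda>b. \<Sum>a\<in>UNIV. x a * A a b)"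

text \<open>bilinear map (e.g. a multiplication) given by structure constants\<close>
definition bil :: "('a::finite \<Rightarrow> 'b::finite \<Rightarrow> 'c \<Rightarrow> 'k::comm_ring_1)
     \<Rightarrow> ('a \<Rightarrow> 'k) \<Rightarrow> ('b \<Rightarrow> 'k) \<Rightarrow> ('c \<Rightarrow> 'k)" where
  "bil M x y = (\<lambda>c. \<Sum>a\<in>UNIV. \<Sum>b\<in>UNIV. x a * y b * M a b c)"

text \<open>structure constants of tensor powers A^{\<otimes>X} (factorwise)\<close>
definition tpow3 :: "('b \<Rightarrow> 'b \<Rightarrow> 'b \<Rightarrow> 'k::comm_ring_1)
     \<Rightarrow> ('x::finite \<Rightarrow> 'b) \<Rightarrow> ('x \<Rightarrow> 'b) \<Rightarrow> ('x \<Rightarrow> 'b) \<Rightarrow> 'k" where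
  "tpow3 M F G K = (\<Prod>x\<in>UNIV. M (F x) (G x) (K x))"

definition tpow1 :: "('b \<Rightarrow> 'k::comm_ring_1) \<Rightarrow> ('x::finite \<Rightarrow> 'b) \<Rightarrow> 'k" where
  "tpow1 u F = (\<Prod>x\<in>UNIV. u (F x))"

text \<open>(a)_x : the element a in the tensor factor x and the unit u elsewhere\<close>
definition emb :: "('b \<Rightarrow> 'k::comm_ring_1) \<Rightarrow> 'x::finite \<Rightarrow> ('b \<Rightarrow> 'k) \<Rightarrow> (('x \<Rightarrow> 'b) \<Rightarrow> 'k)" where
  "emb u x a = (\<lambda>F. a (F x) * (\<Prod>y\<in>UNIV - {x}. u (F y)))"

(* ===================================================================== *)
(* Hopf algebra H by structure constants w.r.t. a basis {x_i}:           *)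
(*   x_a x_b = sum_c hmul a b c x_c,  1 = sum_c hunit c x_c,              *)
(*   Delta x_a = sum_{b,c} hcomul a b c x_b (x) x_c,  eps x_a = hcounit a,*)
(*   S x_a = sum_b hanti a b x_b.                                         *)
(* ===================================================================== *)

record ('i, 'k) hopf =
  hmul :: "'i \<Rightarrow> 'i \<Rightarrow> 'i \<Rightarrow> 'k"
  hunit :: "'i \<Rightarrow> 'k"
  hcomul :: "'i \<Rightarrow> 'i \<Rightarrow> 'i \<Rightarrow> 'k"
  hcounit :: "'i \<Rightarrow> 'k"
  hanti :: "'i \<Rightarrow> 'i \<Rightarrow> 'k"

definition hopf_algebra :: "('i::finite, 'k::field) hopf \<Rightarrow> bool" where
  "hopf_algebra H \<longleftrightarrow>
     \<comment> \<open>associativity\<close>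
     (\<forall>a b c e. (\<Sum>d\<in>UNIV. hmul H a b d * hmul H d c e) = (\<Sum>d\<in>UNIV. hmul H b c d * hmul H a d e)) \<and>
     \<comment> \<open>unit\<close>
     (\<forall>a b. (\<Sum>c\<in>UNIV. hunit H c * hmul H c a b) = bas a b) \<and>
     (\<forall>a b. (\<Sum>c\<in>UNIV. hunit H c * hmul H a c b) = bas a b) \<and>
     \<comment> \<open>coassociativity\<close>
     (\<forall>a b1 b2 c. (\<Sum>d\<in>UNIV. hcomul H a d c * hcomul H d b1 b2) = (\<Sum>d\<in>UNIV. hcomul H a b1 d * hcomul H d b2 c)) \<and>
     \<comment> \<open>counit\<close>
     (\<forall>a c. (\<Sum>b\<in>UNIV. hcounit H b * hcomul H a b c) = bas a c) \<and>
     (\<forall>a b. (\<Sum>c\<in>UNIV. hcounit H c * hcomul H a b c) = bas a b) \<and>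
     \<comment> \<open>Delta is an algebra map\<close>
     (\<forall>a b c d. (\<Sum>e\<in>UNIV. hmul H a b e * hcomul H e c d) =
        (\<Sum>a1\<in>UNIV. \<Sum>a2\<in>UNIV. \<Sum>b1\<in>UNIV. \<Sum>b2\<in>UNIV.
            hcomul H a a1 a2 * hcomul H b b1 b2 * hmul H a1 b1 c * hmul H a2 b2 d)) \<and>
     (\<forall>c d. (\<Sum>e\<in>UNIV. hunit H e * hcomul H e c d) = hunit H c * hunit H d) \<and>
     \<comment> \<open>eps is an algebra map\<close>
     (\<forall>a b. (\<Sum>e\<in>UNIV. hmul H a b e * hcounit H e) = hcounit H a * hcounit H b) \<and>
     (\<Sum>e\<in>UNIV. hunit H e * hcounit H e) = 1 \<and>
     \<comment> \<open>antipode: S(h_(1)) h_(2) = eps(h) 1 = h_(1) S(h_(2))\<close>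
     (\<forall>a e. (\<Sum>b\<in>UNIV. \<Sum>c\<in>UNIV. \<Sum>d\<in>UNIV. hcomul H a b c * hanti H b d * hmul H d c e) = hcounit H a * hunit H e) \<and>
     (\<forall>a e. (\<Sum>b\<in>UNIV. \<Sum>c\<in>UNIV. \<Sum>d\<in>UNIV. hcomul H a b c * hanti H c d * hmul H b d e) = hcounit H a * hunit H e)"

text \<open>left ideals of the algebra H (as subspaces of coefficient vectors)\<close>
definition left_ideal :: "('i::finite, 'k::field) hopf \<Rightarrow> ('i \<Rightarrow> 'k) set \<Rightarrow> bool" where
  "left_ideal H I \<longleftrightarrow> (\<lambda>_. 0) \<in> I \<and>
     (\<forall>x\<in>I. \<forall>y\<in>I. (\<lambda>i. x i + y i) \<in> I) \<and>
     (\<forall>c. \<forall>x\<in>I. (\<lambda>i. c * x i) \<in> I) \<and>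
     (\<forall>h. \<forall>x\<in>I. bil (hmul H) h x \<in> I)"

text \<open>H semisimple: the regular left module is semisimple, i.e. every left ideal
  has a complementary left ideal\<close>
definition semisimple :: "('i::finite, 'k::field) hopf \<Rightarrow> bool" where
  "semisimple H \<longleftrightarrow> (\<forall>I. left_ideal H I \<longrightarrow>
     (\<exists>J. left_ideal H J \<and> I \<inter> J = {\<lambda>_. 0} \<and> (\<forall>x. \<exists>y\<in>I. \<exists>z\<in>J. x = (\<lambda>i. y i + z i))))"

text \<open>S^2 = id (holds for semisimple H in characteristic zero); thus S^{-1} = S\<close>
definition antipode_involutive :: "('i::finite, 'k::field) hopf \<Rightarrow> bool" where
  "antipode_involutive H \<longleftrightarrow> (\<forall>a c. (\<Sum>b\<in>UNIV. hanti H a b * hanti H b c) = bas a c)"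

(* ===================================================================== *)
(* The dual H^* w.r.t. the dual basis {alpha^i}:                          *)
(*  alpha^a alpha^b = sum_c hcomul c a b alpha^c, 1 = eps = sum hcounit,  *)
(*  Delta alpha^c = sum hmul a b c alpha^a (x) alpha^b,                   *)
(*  eps(alpha^c) = hunit c, S(alpha^a) = sum_b hanti b a alpha^b,         *)
(*  <alpha^a, x_b> = [a = b].                                             *)
(* ===================================================================== *)

(* ===================================================================== *)
(* Drinfeld double D(H) on H^*(x)H, basis (a,b) = alpha^a (x) x_b.        *)
(* (alpha(x)h)(alpha'(x)h') = <alpha'_(3),h_(1)><S^{-1}(alpha'_(1)),h_(3)> *)
(*                              alpha alpha'_(2) (x) h_(2) h'              *)
(* with alpha = alpha^a, h = x_b, alpha' = alpha^a', h' = x_b':           *)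
(*  alpha'_(1),(2),(3) = alpha^p, alpha^r, alpha^s (coefficient           *)
(*  hmul p q a' * hmul r s q), h_(1),(2),(3) = x_s, x_w, x_y (coefficient  *)
(*  hcomul b s u * hcomul u w y; <alpha^s,x_t> forces t = s),             *)
(*  <S(alpha^p),x_y> = hanti y p, alpha^a alpha^r = sum_c hcomul c a r,   *)
(*  x_w x_b' = sum_g hmul w b' g.                                         *)
(* ===================================================================== *)

definition Dmul :: "('i::finite, 'k::comm_ring_1) hopf \<Rightarrow> 'i \<times> 'i \<Rightarrow> 'i \<times> 'i \<Rightarrow> 'i \<times> 'i \<Rightarrow> 'k" where
  "Dmul H = (\<lambda>(a,b) (a',b') (c,g).
     \<Sum>p\<in>UNIV. \<Sum>q\<in>UNIV. \<Sum>r\<in>UNIV. \<Sum>s\<in>UNIV. \<Sum>u\<in>UNIV. \<Sum>w\<in>UNIV. \<Sum>y\<in>UNIV.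
       hmul H p q a' * hmul H r s q * hcomul H b s u * hcomul H u w y * hanti H y p
       * hcomul H c a r * hmul H w b' g)"

text \<open>unit 1 (x) 1 = eps (x) 1\<close>
definition Dunit :: "('i, 'k::comm_ring_1) hopf \<Rightarrow> 'i \<times> 'i \<Rightarrow> 'k" where
  "Dunit H = (\<lambda>(a,b). hcounit H a * hunit H b)"

text \<open>Delta(alpha (x) h) = (alpha_(2) (x) h_(1)) (x) (alpha_(1) (x) h_(2))\<close>
definition Dcomul :: "('i, 'k::comm_ring_1) hopf \<Rightarrow> 'i \<times> 'i \<Rightarrow> 'i \<times> 'i \<Rightarrow> 'i \<times> 'i \<Rightarrow> 'k" where
  "Dcomul H = (\<lambda>(a,b) (c1,c2) (d1,d2). hmul H d1 c1 a * hcomul H b c2 d2)"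

text \<open>counit eps(alpha) eps(h)\<close>
definition Dcounit :: "('i, 'k::comm_ring_1) hopf \<Rightarrow> 'i \<times> 'i \<Rightarrow> 'k" where
  "Dcounit H = (\<lambda>(a,b). hunit H a * hcounit H b)"

(* ===================================================================== *)
(* D(H)^* on H(x)H^*, basis (a,b) = x_a (x) alpha^b.                      *)
(* ===================================================================== *)

text \<open>(y (x) gamma)(z (x) delta) = z y (x) gamma delta\<close>
definition DDmul :: "('i, 'k::comm_ring_1) hopf \<Rightarrow> 'i \<times> 'i \<Rightarrow> 'i \<times> 'i \<Rightarrow> 'i \<times> 'i \<Rightarrow> 'k" where
  "DDmul H = (\<lambda>(a,b) (a',b') (c,d). hmul H a' a c * hcomul H d b b')"

text \<open>unit 1 (x) 1 = 1 (x) eps; this is also the unit of the Heisenberg double\<close>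
definition DDunit :: "('i, 'k::comm_ring_1) hopf \<Rightarrow> 'i \<times> 'i \<Rightarrow> 'k" where
  "DDunit H = (\<lambda>(a,b). hunit H a * hcounit H b)"

text \<open>Delta_D(y (x) gamma) = sum_{i,j} (y_(1) (x) alpha^i gamma_(1) alpha^j) (x)
   (S(x_j) y_(2) x_i (x) gamma_(2))\<close>
definition DDcomul :: "('i::finite, 'k::comm_ring_1) hopf \<Rightarrow> 'i \<times> 'i \<Rightarrow> 'i \<times> 'i \<Rightarrow> 'i \<times> 'i \<Rightarrow> 'k" where
  "DDcomul H = (\<lambda>(a,b) (c1,d1) (c2,d2).
     \<Sum>i\<in>UNIV. \<Sum>j\<in>UNIV. \<Sum>a2\<in>UNIV. \<Sum>b1\<in>UNIV. \<Sum>c\<in>UNIV. \<Sum>e\<in>UNIV. \<Sum>f\<in>UNIV.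
       hcomul H a c1 a2 * hmul H b1 d2 b
       * hcomul H c i b1 * hcomul H d1 c j
       * hanti H j e * hmul H e a2 f * hmul H f i c2)"

definition DDcounit :: "('i, 'k::comm_ring_1) hopf \<Rightarrow> 'i \<times> 'i \<Rightarrow> 'k" where
  "DDcounit H = (\<lambda>(a,b). hcounit H a * hunit H b)"

text \<open>S_D(y (x) gamma) = sum_{i,j} x_i S^{-1}(y) x_j (x) S(alpha^j) S(gamma) alpha^i
  (S^{-1} = S since S^2 = id)\<close>
definition DDanti :: "('i::finite, 'k::comm_ring_1) hopf \<Rightarrow> 'i \<times> 'i \<Rightarrow> 'i \<times> 'i \<Rightarrow> 'k" where
  "DDanti H = (\<lambda>(a,b) (g,d).
     \<Sum>i\<in>UNIV. \<Sum>j\<in>UNIV. \<Sum>e\<in>UNIV. \<Sum>f\<in>UNIV. \<Sum>p\<in>UNIV. \<Sum>q\<in>UNIV. \<Sum>r\<in>UNIV.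
       hanti H a e * hmul H i e f * hmul H f j g
       * hanti H p j * hanti H q b * hcomul H r p q * hcomul H d r i)"

(* ===================================================================== *)
(* Heisenberg double H(H) on H(x)H^*, basis (a,b) = x_a (x) alpha^b:      *)
(* (h(x)alpha)(h'(x)alpha') = <alpha_(1),h'_(2)> h h'_(1) (x) alpha_(2) alpha' *)
(* ===================================================================== *)

definition HHmul :: "('i::finite, 'k::comm_ring_1) hopf \<Rightarrow> 'i \<times> 'i \<Rightarrow> 'i \<times> 'i \<Rightarrow> 'i \<times> 'i \<Rightarrow> 'k" where
  "HHmul H = (\<lambda>(a,b) (a',b') (g,d).
     \<Sum>b1\<in>UNIV. \<Sum>b2\<in>UNIV. \<Sum>c1\<in>UNIV.
       hmul H b1 b2 b * hcomul H a' c1 b1 * hmul H a c1 g * hcomul H d b2 b')"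

(* ===================================================================== *)
(* Tensor powers over the edge type 'e and vertex type 'v.               *)
(* ===================================================================== *)

text \<open>multiplication of H(H)^{\<otimes>E}\<close>
definition HHmulE :: "('i::finite, 'k::comm_ring_1) hopf
    \<Rightarrow> (('e::finite \<Rightarrow> 'i \<times> 'i) \<Rightarrow> 'k) \<Rightarrow> (('e \<Rightarrow> 'i \<times> 'i) \<Rightarrow> 'k) \<Rightarrow> (('e \<Rightarrow> 'i \<times> 'i) \<Rightarrow> 'k)" where
  "HHmulE H X Y = bil (tpow3 (HHmul H)) X Y"

text \<open>opposite multiplication of H(H)^{op\<otimes>E}: X \<cdot>op Y = Y \<cdot> X\<close>
definition HHopE :: "('i::finite, 'k::comm_ring_1) hopf
    \<Rightarrow> (('e::finite \<Rightarrow> 'i \<times> 'i) \<Rightarrow> 'k) \<Rightarrow> (('e \<Rightarrow> 'i \<times> 'i) \<Rightarrow> 'k) \<Rightarrow> (('e \<Rightarrow> 'i \<times> 'i) \<Rightarrow> 'k)" where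
  "HHopE H X Y = HHmulE H Y X"

definition unitE :: "('i::finite, 'k::comm_ring_1) hopf \<Rightarrow> (('e::finite \<Rightarrow> 'i \<times> 'i) \<Rightarrow> 'k)" where
  "unitE H = tpow1 (DDunit H)"

text \<open>multiplication m' of D(H)^{*\<otimes>E}\<close>
definition DDmulE :: "('i::finite, 'k::comm_ring_1) hopf
    \<Rightarrow> (('e::finite \<Rightarrow> 'i \<times> 'i) \<Rightarrow> 'k) \<Rightarrow> (('e \<Rightarrow> 'i \<times> 'i) \<Rightarrow> 'k) \<Rightarrow> (('e \<Rightarrow> 'i \<times> 'i) \<Rightarrow> 'k)" where
  "DDmulE H X Y = bil (tpow3 (DDmul H)) X Y"

text \<open>Hopf structure of D(H)^{\<otimes>V}\<close>
definition DmulV :: "('i::finite, 'k::comm_ring_1) hopf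
    \<Rightarrow> (('v::finite \<Rightarrow> 'i \<times> 'i) \<Rightarrow> 'k) \<Rightarrow> (('v \<Rightarrow> 'i \<times> 'i) \<Rightarrow> 'k) \<Rightarrow> (('v \<Rightarrow> 'i \<times> 'i) \<Rightarrow> 'k)" where
  "DmulV H X Y = bil (tpow3 (Dmul H)) X Y"

definition unitV :: "('i::finite, 'k::comm_ring_1) hopf \<Rightarrow> (('v::finite \<Rightarrow> 'i \<times> 'i) \<Rightarrow> 'k)" where
  "unitV H = tpow1 (Dunit H)"

text \<open>coefficient of b_G (x) b_K in Delta(d), d \<in> D(H)^{\<otimes>V}\<close>
definition DcomulV :: "('i::finite, 'k::comm_ring_1) hopf
    \<Rightarrow> (('v::finite \<Rightarrow> 'i \<times> 'i) \<Rightarrow> 'k) \<Rightarrow> ('v \<Rightarrow> 'i \<times> 'i) \<Rightarrow> ('v \<Rightarrow> 'i \<times> 'i) \<Rightarrow> 'k" where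
  "DcomulV H d G K = (\<Sum>F\<in>UNIV. d F * tpow3 (Dcomul H) F G K)"

definition DcounitV :: "('i::finite, 'k::comm_ring_1) hopf \<Rightarrow> (('v::finite \<Rightarrow> 'i \<times> 'i) \<Rightarrow> 'k) \<Rightarrow> 'k" where
  "DcounitV H d = (\<Sum>F\<in>UNIV. d F * tpow1 (Dcounit H) F)"

(* ===================================================================== *)
(* Holonomy.  A linear map D(H)^* \<rightarrow> (H(x)H^* )^{\<otimes>E} is given by its  *)
(* matrix  'i\<times>'i \<Rightarrow> ('e \<Rightarrow> 'i\<times>'i) \<Rightarrow> 'k.                               *)
(* ===================================================================== *)

type_synonym ('i, 'e, 'k) holmap = "'i \<times> 'i \<Rightarrow> ('e \<Rightarrow> 'i \<times> 'i) \<Rightarrow> 'k"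

text \<open>convolution phi \<bullet> psi = m' \<circ> (phi (x) psi) \<circ> Delta_D\<close>
definition conv :: "('i::finite, 'k::comm_ring_1) hopf \<Rightarrow> ('i, 'e::finite, 'k) holmap
    \<Rightarrow> ('i, 'e, 'k) holmap \<Rightarrow> ('i, 'e, 'k) holmap" where
  "conv H \<phi> \<psi> = (\<lambda>b F. \<Sum>b1\<in>UNIV. \<Sum>b2\<in>UNIV. DDcomul H b b1 b2 * DDmulE H (\<phi> b1) (\<psi> b2) F)"

text \<open>unit of convolution (holonomy of the trivial path)\<close>
definition conv_unit :: "('i::finite, 'k::comm_ring_1) hopf \<Rightarrow> ('i, 'e::finite, 'k) holmap" where
  "conv_unit H = (\<lambda>b F. DDcounit H b * unitE H F)"

text \<open>Hol_x \<circ> S_D\<close>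
definition hol_inv :: "('i::finite, 'k::comm_ring_1) hopf \<Rightarrow> ('i, 'e::finite, 'k) holmap \<Rightarrow> ('i, 'e, 'k) holmap" where
  "hol_inv H \<phi> = (\<lambda>b F. \<Sum>b'\<in>UNIV. DDanti H b b' * \<phi> b' F)"

text \<open>Hol_{r(e)}(y (x) gamma) = eps(y) (1 (x) gamma)_e\<close>
definition hol_r :: "('i::finite, 'k::comm_ring_1) hopf \<Rightarrow> 'e::finite \<Rightarrow> ('i, 'e, 'k) holmap" where
  "hol_r H e = (\<lambda>(a,b). emb (DDunit H) e (\<lambda>(c,d). hcounit H a * (hunit H c * bas b d)))"

text \<open>Hol_{r(bar e)}(y (x) gamma) = eps(gamma) (y (x) 1)_e\<close>
definition hol_rbar :: "('i::finite, 'k::comm_ring_1) hopf \<Rightarrow> 'e::finite \<Rightarrow> ('i, 'e, 'k) holmap" where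
  "hol_rbar H e = (\<lambda>(a,b). emb (DDunit H) e (\<lambda>(c,d). hunit H b * (bas a c * hcounit H d)))"

text \<open>Hol_{l(e)}(y (x) gamma) = eps(y) sum_{i,j} (x_i S(x_j) (x) alpha^j gamma alpha^i)_e\<close>
definition hol_l :: "('i::finite, 'k::comm_ring_1) hopf \<Rightarrow> 'e::finite \<Rightarrow> ('i, 'e, 'k) holmap" where
  "hol_l H e = (\<lambda>(a,b). emb (DDunit H) e (\<lambda>(c,d). hcounit H a *
      (\<Sum>i\<in>UNIV. \<Sum>j\<in>UNIV. \<Sum>p\<in>UNIV. \<Sum>q\<in>UNIV.
         hanti H j p * hmul H i p c * hcomul H q j b * hcomul H d q i)))"

text \<open>Hol_{l(bar e)}(y (x) gamma) = eps(gamma) sum_{i,j} (x_i y S(x_j) (x) alpha^j alpha^i)_e\<close>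
definition hol_lbar :: "('i::finite, 'k::comm_ring_1) hopf \<Rightarrow> 'e::finite \<Rightarrow> ('i, 'e, 'k) holmap" where
  "hol_lbar H e = (\<lambda>(a,b). emb (DDunit H) e (\<lambda>(c,d). hunit H b *
      (\<Sum>i\<in>UNIV. \<Sum>j\<in>UNIV. \<Sum>p\<in>UNIV. \<Sum>f\<in>UNIV.
         hmul H i a f * hanti H j p * hmul H f p c * hcomul H d j i)))"

text \<open>Hol_{r(e^\<epsilon>)}: r(e^{-1}) = l(e)^{-1}\<close>
definition hol_face_letter :: "('i::finite, 'k::comm_ring_1) hopf \<Rightarrow> 'e::finite \<times> bool \<Rightarrow> ('i, 'e, 'k) holmap" where
  "hol_face_letter H = (\<lambda>(e, pos). if pos then hol_r H e else hol_inv H (hol_l H e))"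

text \<open>Hol_{r(bar(e^\<epsilon>))}: r(bar(e^{-1})) = l(bar e)^{-1}\<close>
definition hol_vertex_letter :: "('i::finite, 'k::comm_ring_1) hopf \<Rightarrow> 'e::finite \<times> bool \<Rightarrow> ('i, 'e, 'k) holmap" where
  "hol_vertex_letter H = (\<lambda>(e, pos). if pos then hol_rbar H e else hol_inv H (hol_lbar H e))"

text \<open>holonomy of a word h_1 \<circ> ... \<circ> h_n (h_n traversed first):
  Hol_{h_1} \<bullet> ... \<bullet> Hol_{h_n}\<close>
fun hol_word :: "('i::finite, 'k::comm_ring_1) hopf \<Rightarrow> ('i, 'e::finite, 'k) holmap list \<Rightarrow> ('i, 'e, 'k) holmap" where
  "hol_word H [] = conv_unit H"
| "hol_word H [h] = h"
| "hol_word H (h # t) = conv H h (hol_word H t)"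

(* ===================================================================== *)
(* Ciliated ribbon graphs.  src, tgt : 'e \<Rightarrow> 'v; ord v is the list of   *)
(* the edge ends at v in the linear order given by the cilium (the graph *)
(* has no loops, so edge ends at v correspond to incident edges).         *)
(* Darts (e, True) = e, (e, False) = e^{-1}.                              *)
(* ===================================================================== *)

definition ciliated_ribbon_graph :: "('e \<Rightarrow> 'v) \<Rightarrow> ('e \<Rightarrow> 'v) \<Rightarrow> ('v \<Rightarrow> 'e list) \<Rightarrow> bool" where
  "ciliated_ribbon_graph src tgt ord \<longleftrightarrow>
     (\<forall>v. distinct (ord v) \<and> set (ord v) = {e. src e = v \<or> tgt e = v})"

definition dhead :: "('e \<Rightarrow> 'v) \<Rightarrow> ('e \<Rightarrow> 'v) \<Rightarrow> 'e \<times> bool \<Rightarrow> 'v" where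
  "dhead src tgt = (\<lambda>(e, pos). if pos then tgt e else src e)"

definition flip_dart :: "'e \<times> bool \<Rightarrow> 'e \<times> bool" where
  "flip_dart = (\<lambda>(e, pos). (e, \<not> pos))"

text \<open>successor of x in the cyclic ordering induced by the list xs\<close>
definition cyc_succ :: "'a list \<Rightarrow> 'a \<Rightarrow> 'a" where
  "cyc_succ xs x = xs ! (Suc (THE k. k < length xs \<and> xs ! k = x) mod length xs)"

text \<open>maximal right turn: the outgoing edge end is the successor of the
  incoming one in the cyclic ordering at the vertex reached\<close>
definition next_dart :: "('e \<Rightarrow> 'v) \<Rightarrow> ('e \<Rightarrow> 'v) \<Rightarrow> ('v \<Rightarrow> 'e list) \<Rightarrow> 'e \<times> bool \<Rightarrow> 'e \<times> bool" where
  "next_dart src tgt ord d =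
     (let w = dhead src tgt d; e' = cyc_succ (ord w) (fst d) in (e', src e' = w))"

text \<open>passing from dart d to the next one passes the cilium at the vertex reached
  iff d arrives along the edge end of highest order\<close>
definition passes_cilium :: "('e \<Rightarrow> 'v) \<Rightarrow> ('e \<Rightarrow> 'v) \<Rightarrow> ('v \<Rightarrow> 'e list) \<Rightarrow> 'e \<times> bool \<Rightarrow> bool" where
  "passes_cilium src tgt ord d \<longleftrightarrow> fst d = last (ord (dhead src tgt d))"

definition face_orbit :: "('e \<Rightarrow> 'v) \<Rightarrow> ('e \<Rightarrow> 'v) \<Rightarrow> ('v \<Rightarrow> 'e list) \<Rightarrow> 'e \<times> bool \<Rightarrow> ('e \<times> bool) set" where
  "face_orbit src tgt ord d = range (\<lambda>k. (next_dart src tgt ord ^^ k) d)"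

definition regular_ciliated_ribbon_graph :: "('e \<Rightarrow> 'v) \<Rightarrow> ('e \<Rightarrow> 'v) \<Rightarrow> ('v \<Rightarrow> 'e list) \<Rightarrow> bool" where
  "regular_ciliated_ribbon_graph src tgt ord \<longleftrightarrow>
     ciliated_ribbon_graph src tgt ord \<and>
     \<comment> \<open>no loops\<close>
     (\<forall>e. src e \<noteq> tgt e) \<and>
     \<comment> \<open>no multiple edges\<close>
     (\<forall>e e'. e \<noteq> e' \<longrightarrow> {src e, tgt e} \<noteq> {src e', tgt e'}) \<and>
     \<comment> \<open>each face traverses each edge at most once\<close>
     (\<forall>d. flip_dart d \<notin> face_orbit src tgt ord d) \<and>
     \<comment> \<open>each face contains exactly one cilium\<close>
     (\<forall>d. card {d' \<in> face_orbit src tgt ord d. passes_cilium src tgt ord d'} = 1)"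

text \<open>f(v) as the list of darts in order of traversal: the first dart leaves v
  along the lowest edge end at v, the last arrives along the highest one.
  (Empty for an isolated vertex.)\<close>
definition face_at :: "('e \<Rightarrow> 'v) \<Rightarrow> ('e \<Rightarrow> 'v) \<Rightarrow> ('v \<Rightarrow> 'e list) \<Rightarrow> 'v \<Rightarrow> ('e \<times> bool) list" where
  "face_at src tgt ord v =
     (if ord v = [] then [] else
      (let d0 = (hd (ord v), src (hd (ord v)) = v);
           n = (LEAST k. 0 < k \<and> (next_dart src tgt ord ^^ k) d0 = d0)
       in map (\<lambda>k. (next_dart src tgt ord ^^ k) d0) [0..<n]))"

text \<open>Hol_{p_v}, p_v = r(bar(e_1^\<epsilon>1)) \<circ> ... \<circ> r(bar(e_n^\<epsilon>n)), e_k in the order at v,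
  e_k^\<epsilon>k incoming at v\<close>
definition hol_vertex :: "('i::finite, 'k::comm_ring_1) hopf \<Rightarrow> ('e::finite \<Rightarrow> 'v) \<Rightarrow> ('e \<Rightarrow> 'v)
    \<Rightarrow> ('v \<Rightarrow> 'e list) \<Rightarrow> 'v \<Rightarrow> ('i, 'e, 'k) holmap" where
  "hol_vertex H src tgt ord v =
     hol_word H (map (\<lambda>e. hol_vertex_letter H (e, tgt e = v)) (ord v))"

text \<open>Hol_{p_{f(v)}}, f(v) = e_1^\<epsilon>1 \<circ> ... \<circ> e_n^\<epsilon>n (e_n^\<epsilon>n traversed first),
  p_f = r(e_1^\<epsilon>1) \<circ> ... \<circ> r(e_n^\<epsilon>n)\<close>
definition hol_face :: "('i::finite, 'k::comm_ring_1) hopf \<Rightarrow> ('e::finite \<Rightarrow> 'v) \<Rightarrow> ('e \<Rightarrow> 'v)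
    \<Rightarrow> ('v \<Rightarrow> 'e list) \<Rightarrow> 'v \<Rightarrow> ('i, 'e, 'k) holmap" where
  "hol_face H src tgt ord v =
     hol_word H (rev (map (hol_face_letter H) (face_at src tgt ord v)))"

(* ===================================================================== *)
(* The action formula on generators (delta (x) z)_v, delta = alpha^a,     *)
(* z = x_b (extended linearly):                                          *)
(*  X <| (delta(x)z)_v = Hol_{p_v}(S(z_(2))(x)1) . Hol_{p_f(v)}(1(x)S(delta_(1)))*)
(*                     . X . Hol_{p_f(v)}(1(x)delta_(2)) . Hol_{p_v}(z_(1)(x)1)*)
(*  with delta_(1)(x)delta_(2) = sum hmul p q a alpha^p (x) alpha^q,       *)
(*  z_(1)(x)z_(2) = sum hcomul b s t x_s (x) x_t.                          *)
(* ===================================================================== *)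

definition vertex_action :: "('i::finite, 'k::comm_ring_1) hopf \<Rightarrow> ('e::finite \<Rightarrow> 'v) \<Rightarrow> ('e \<Rightarrow> 'v)
    \<Rightarrow> ('v \<Rightarrow> 'e list) \<Rightarrow> 'v \<Rightarrow> ('i \<Rightarrow> 'k) \<Rightarrow> ('i \<Rightarrow> 'k)
    \<Rightarrow> (('e \<Rightarrow> 'i \<times> 'i) \<Rightarrow> 'k) \<Rightarrow> (('e \<Rightarrow> 'i \<times> 'i) \<Rightarrow> 'k)" where
  "vertex_action H src tgt ord v \<delta> z X =
     (let HP = (\<lambda>x. lin (hol_vertex H src tgt ord v) x);
          HF = (\<lambda>x. lin (hol_face H src tgt ord v) x);
          m = HHmulE H
      in (\<lambda>F. \<Sum>a\<in>UNIV. \<Sum>b\<in>UNIV. \<Sum>p\<in>UNIV. \<Sum>q\<in>UNIV. \<Sum>s\<in>UNIV. \<Sum>t\<in>UNIV.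
            \<delta> a * z b * hmul H p q a * hcomul H b s t *
            m (HP (\<lambda>(c,d). hanti H t c * hcounit H d))
             (m (HF (\<lambda>(c,d). hunit H c * hanti H d p))
              (m X
               (m (HF (\<lambda>(c,d). hunit H c * bas q d))
                  (HP (\<lambda>(c,d). bas s c * hcounit H d))))) F))"

end

(* Each tensor factor H(H) is the matrix algebra End(H): h acts by left multiplication and alpha by
   k |-> k_(1) <alpha, k_(2)>.  Conjugation by the antipode exchanges the operators of e and of its
   reverse, so on one edge there are only two kinds of exchange relation between a vertex operator f
   and a face operator g.  Write F, G for the families f, g seen as elements of the convolution
   algebra Hom(H (x) H^*, A), and W for the canonical element.  If the face arrives at the vertex
   along the edge then G F = F W G; if it departs along the edge then F G = G W F.

   Vertex and face holonomies are words in these letters.  Where a face passes a vertex away from the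
   cilium, an arriving letter is followed by the departing letter of the next edge, and the two
   occurrences of W cancel; hence the holonomies of v and of f(w) commute for v, w distinct.  At the
   cilium of v the order is reversed and what remains is F W G = G W F, which is the straightening
   relation of the Drinfeld double.  The same relation holds for the conjugation operators
   X |-> X <| d, so these form a right module over D(H) for each vertex, the actions at different
   vertices commute, and their product is the required action. *)

theory Submission
  imports Defs "HOL-Library.FuncSet"
begin

text \<open>Two multiplications meet in the statement: holonomies are convolved with the product of
  D(H)^*, while the action multiplies them in the Heisenberg double. They can be reconciled because
  neither a vertex loop nor a face loop of a regular graph uses an edge twice: each letter of a word
  acts in a factor where the rest of the word carries the unit, and there both products agree
  (\<open>wfam_indep\<close>). Elements of the tensor power of H(H) are handled through their right
  multiplications, so the module axioms become identities in a matrix ring. Conjugation by z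
  combines right multiplication by z_(1) with left multiplication by S(z_(2)). Left multiplications
  reverse products; composing with S reverses the coproducts as well, which restores F W G = G W F,
  and two commuting solutions of this relation convolve to a third (\<open>antip_straighten\<close>,
  \<open>straighten_prod\<close>). S^2 = id enters mainly through the skew antipode law S(h_(2))
  h_(1) = eps(h) 1. It gives the relation for a departing face, the inverse of H(H) -> End(H), and
  the compatibility of conjugation with products.\<close>

abbreviation (input) sum_over_type :: "('a \<Rightarrow> 'b::comm_monoid_add) \<Rightarrow> 'b"
    (binder "\<Sum>" 10) where
  "sum_over_type f \<equiv> sum f UNIV"

lemmas sum_distribs = sum_distrib_left sum_distrib_right

lemma sum_nested: "(\<Sum>x y. f x y) = (\<Sum>p. case p of (x, y) \<Rightarrow> f x y)"
  by (simp add: sum.cartesian_product)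

lemma sum_permute:
  assumes "\<And>x y. j x = j y \<Longrightarrow> x = y" "\<And>y. \<exists>x. y = j x" "\<And>x. f x = g (j x)"
  shows "(\<Sum>x. f x) = (\<Sum>y. g y)"
proof -
  have "bij j" using assms(1,2) by (auto simp: bij_def inj_def surj_def)
  from sum.reindex_bij_betw[OF this, of g] show ?thesis by (simp add: assms(3))
qed

section \<open>Square matrices over a finite index type\<close>

text \<open>A type of its own, so that \<open>*\<close> can denote composition; as a
  \<open>ring_1\<close> it lets relations between operators be rewritten without indices.\<close>

typedef ('n, 'k) sqm = "UNIV :: ('n \<Rightarrow> 'n \<Rightarrow> 'k) set"
  morphisms ent Mat ..

setup_lifting type_definition_sqm

instantiation sqm :: (finite, comm_ring_1) ring_1
begin

lift_definition zero_sqm :: "('a, 'b) sqm" is "\<lambda>_ _. 0" .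
lift_definition one_sqm :: "('a, 'b) sqm" is "\<lambda>i j. if i = j then 1 else 0" .
lift_definition plus_sqm :: "('a, 'b) sqm \<Rightarrow> ('a, 'b) sqm \<Rightarrow> ('a, 'b) sqm" is "\<lambda>A B i j. A i j + B i j" .
lift_definition minus_sqm :: "('a, 'b) sqm \<Rightarrow> ('a, 'b) sqm \<Rightarrow> ('a, 'b) sqm" is "\<lambda>A B i j. A i j - B i j" .
lift_definition uminus_sqm :: "('a, 'b) sqm \<Rightarrow> ('a, 'b) sqm" is "\<lambda>A i j. - A i j" .
lift_definition times_sqm :: "('a, 'b) sqm \<Rightarrow> ('a, 'b) sqm \<Rightarrow> ('a, 'b) sqm"
  is "\<lambda>A B i j. \<Sum>l. A i l * B l j" .

instance
proof
  fix A B C :: "('a, 'b) sqm"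
  show "A * B * C = A * (B * C)"
  proof (transfer, intro ext)
    fix A B C :: "'a \<Rightarrow> 'a \<Rightarrow> 'b" and i j
    show "(\<Sum>l. (\<Sum>m. A i m * B m l) * C l j) = (\<Sum>l. A i l * (\<Sum>m. B l m * C m j))"
      by (simp add: sum_distribs mult.assoc) (rule sum.swap)
  qed
  show "A + B + C = A + (B + C)" "A + B = B + A" "0 + A = A" "- A + A = 0" "A - B = A + - B"
    by (transfer, simp add: ac_simps)+
  show "1 * A = A" by (transfer) (simp add: if_distrib[of "\<lambda>x. x * _"] cong: if_cong)
  show "A * 1 = A" by (transfer) (simp add: if_distrib[of "\<lambda>x. _ * x"] cong: if_cong)
  show "(A + B) * C = A * C + B * C" "A * (B + C) = A * B + A * C"
    by (transfer, simp add: algebra_simps sum.distrib)+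
  show "(0 :: ('a, 'b) sqm) \<noteq> 1"
    by transfer (metis zero_neq_one)
qed

end

lift_definition scl :: "'k::comm_ring_1 \<Rightarrow> ('n::finite, 'k) sqm \<Rightarrow> ('n, 'k) sqm" is "\<lambda>c A i j. c * A i j" .

lemma ent_inject': "(\<And>i j. ent A i j = ent B i j) \<Longrightarrow> A = B"
  by (metis ent_inject ext)

lemma ent_plus: "ent (A + B) i j = ent A i j + ent B i j" by transfer simp
lemma ent_zero: "ent 0 i j = 0" by transfer simp
lemma ent_one: "ent 1 i j = (if i = j then 1 else 0)" by transfer simp
lemma ent_times: "ent (A * B) i j = (\<Sum>l. ent A i l * ent B l j)" by transfer simp
lemma ent_scl: "ent (scl c A) i j = c * ent A i j" by transfer simp
lemma ent_Mat: "ent (Mat f) i j = f i j" by (simp add: Mat_inverse)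
lemma ent_sum: "ent (sum f S) i j = (\<Sum>x\<in>S. ent (f x) i j)"
  by (induction S rule: infinite_finite_induct) (auto simp: ent_plus ent_zero)

lemmas ent_simps = ent_plus ent_zero ent_one ent_times ent_scl ent_Mat ent_sum

lemma scl_simps [simp]: "scl 1 A = A" "scl 0 A = 0" "scl c 0 = 0" "scl c (scl d A) = scl (c * d) A"
  by (rule ent_inject'; simp add: ent_simps ac_simps)+

lemma mult_scl [simp]: "A * scl c B = scl c (A * B)" "scl c A * B = scl c (A * B)"
  by (rule ent_inject'; simp add: ent_simps sum_distrib_left ac_simps)+

lemma scl_sum: "scl c (sum f S) = (\<Sum>x\<in>S. scl c (f x))"
  by (rule ent_inject') (simp add: ent_simps sum_distrib_left)

lemma sum_scl: "scl (sum g S) A = (\<Sum>x\<in>S. scl (g x) A)"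
  by (rule ent_inject') (simp add: ent_simps sum_distrib_right)

lemma scl_bas [simp]:
  fixes f :: "'b::finite \<Rightarrow> ('n::finite, 'k::comm_ring_1) sqm"
  shows "(\<Sum>x. scl (bas a x) (f x)) = f a" "(\<Sum>x. scl (bas x a) (f x)) = f a"
proof -
  have "(\<Sum>x. scl (bas a x) (f x)) = (\<Sum>x. if x = a then f x else 0)"
    by (rule sum.cong) (auto simp: bas_def)
  then show "(\<Sum>x. scl (bas a x) (f x)) = f a" by simp
  have "(\<Sum>x. scl (bas x a) (f x)) = (\<Sum>x. if x = a then f x else 0)"
    by (rule sum.cong) (auto simp: bas_def)
  then show "(\<Sum>x. scl (bas x a) (f x)) = f a" by simp
qed

lemma sum_bas [simp]:
  fixes f :: "'b::finite \<Rightarrow> 'k::comm_ring_1"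
  shows "(\<Sum>x. bas a x * f x) = f a" "(\<Sum>x. bas x a * f x) = f a"
    "(\<Sum>x. f x * bas a x) = f a" "(\<Sum>x. f x * bas x a) = f a"
proof -
  have "(\<Sum>x. bas a x * f x) = (\<Sum>x. if x = a then f x else 0)"
    "(\<Sum>x. bas x a * f x) = (\<Sum>x. if x = a then f x else 0)"
    by (rule sum.cong; auto simp: bas_def)+
  then show "(\<Sum>x. bas a x * f x) = f a" "(\<Sum>x. bas x a * f x) = f a"
    "(\<Sum>x. f x * bas a x) = f a" "(\<Sum>x. f x * bas x a) = f a"
    by (simp_all add: mult.commute)
qed

section \<open>Convolution\<close>

text \<open>The product of Hom(C, A), where C has Delta c = sum \<open>D c a b\<close> a (x) b and A
  is a matrix algebra; a linear map is given by its values on the basis of C.\<close>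

definition cnv :: "('c::finite \<Rightarrow> 'c \<Rightarrow> 'c \<Rightarrow> 'k::comm_ring_1) \<Rightarrow> ('c \<Rightarrow> ('n::finite, 'k) sqm) \<Rightarrow> ('c \<Rightarrow> ('n, 'k) sqm)
    \<Rightarrow> 'c \<Rightarrow> ('n, 'k) sqm" where
  "cnv D f g c = (\<Sum>a b. scl (D c a b) (f a * g b))"

definition coalgebra :: "('c::finite \<Rightarrow> 'c \<Rightarrow> 'c \<Rightarrow> 'k::comm_ring_1) \<Rightarrow> ('c \<Rightarrow> 'k) \<Rightarrow> bool" where
  "coalgebra D e \<longleftrightarrow>
     (\<forall>a b1 b2 c. (\<Sum>d. D a d c * D d b1 b2) = (\<Sum>d. D a b1 d * D d b2 c)) \<and>
     (\<forall>a c. (\<Sum>b. e b * D a b c) = bas a c) \<and>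
     (\<forall>a b. (\<Sum>c. e c * D a b c) = bas a b)"

lemma cnv_assoc:
  assumes "coalgebra D e"
  shows "cnv D (cnv D f g) h = cnv D f (cnv D g h)"
proof
  fix c
  have "cnv D (cnv D f g) h c =
      (\<Sum>d b a1 a2. scl (D c d b * D d a1 a2) (f a1 * g a2 * h b))"
    by (simp add: cnv_def sum_distrib_right scl_sum)
  also have "\<dots> = (\<Sum>a1 a2 b d. scl (D c d b * D d a1 a2) (f a1 * g a2 * h b))"
    unfolding sum_nested
    by (rule sum_permute[of "\<lambda>(d,b,a1,a2). (a1,a2,b,d)"]) auto
  also have "\<dots> = (\<Sum>a1 a2 b d. scl (D c a1 d * D d a2 b) (f a1 * g a2 * h b))"
    using assms by (simp only: sum_scl[symmetric] coalgebra_def)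
  also have "\<dots> = (\<Sum>a1 d a2 b. scl (D c a1 d * D d a2 b) (f a1 * g a2 * h b))"
    unfolding sum_nested
    by (rule sum_permute[of "\<lambda>(a1,a2,b,d). (a1,d,a2,b)"]) auto
  also have "\<dots> = cnv D f (cnv D g h) c"
    by (simp add: cnv_def sum_distrib_left scl_sum mult.assoc)
  finally show "cnv D (cnv D f g) h c = cnv D f (cnv D g h) c" .
qed

lemma cnv_monoid:
  assumes "coalgebra D e"
  shows "monoid (cnv D) (\<lambda>c. scl (e c) 1)"
proof
  fix f g h
  show "cnv D (cnv D f g) h = cnv D f (cnv D g h)" by (rule cnv_assoc[OF assms])
  show "cnv D (\<lambda>c. scl (e c) 1) f = f"
  proof
    fix c
    have "cnv D (\<lambda>c. scl (e c) 1) f c = (\<Sum>b. scl (\<Sum>a. e a * D c a b) (f b))"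
      unfolding cnv_def by (subst sum.swap) (simp add: sum_scl ac_simps)
    then show "cnv D (\<lambda>c. scl (e c) 1) f c = f c" using assms by (simp add: coalgebra_def)
  qed
  show "cnv D f (\<lambda>c. scl (e c) 1) = f"
  proof
    fix c
    have "cnv D f (\<lambda>c. scl (e c) 1) c = (\<Sum>a. scl (\<Sum>b. e b * D c a b) (f a))"
      unfolding cnv_def by (simp add: sum_scl ac_simps)
    then show "cnv D f (\<lambda>c. scl (e c) 1) c = f c" using assms by (simp add: coalgebra_def)
  qed
qed

lemma sum_pair: "(\<Sum>x\<in>(UNIV :: ('a::finite \<times> 'b::finite) set). f x) = (\<Sum>a b. f (a, b))"
  by (simp add: sum_nested)

lemma bas_commute: "bas a b = bas b a"
  by (simp add: bas_def)

section \<open>Tensor products of coalgebras and the canonical element\<close>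

definition ctens :: "('a \<Rightarrow> 'a \<Rightarrow> 'a \<Rightarrow> 'k::comm_ring_1) \<Rightarrow> ('b \<Rightarrow> 'b \<Rightarrow> 'b \<Rightarrow> 'k)
    \<Rightarrow> 'a \<times> 'b \<Rightarrow> 'a \<times> 'b \<Rightarrow> 'a \<times> 'b \<Rightarrow> 'k" where
  "ctens D D' = (\<lambda>(a,b) (a1,b1) (a2,b2). D a a1 a2 * D' b b1 b2)"

lemma ctens_simp [simp]: "ctens D D' (a, b) (a1, b1) (a2, b2) = D a a1 a2 * D' b b1 b2"
  by (simp add: ctens_def)

lemma coalgebra_ctens:
  fixes D :: "'a::finite \<Rightarrow> 'a \<Rightarrow> 'a \<Rightarrow> 'k::comm_ring_1" and D' :: "'b::finite \<Rightarrow> 'b \<Rightarrow> 'b \<Rightarrow> 'k"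
  assumes "coalgebra D e" "coalgebra D' e'"
  shows "coalgebra (ctens D D') (\<lambda>(a, b). e a * e' b)"
  unfolding coalgebra_def
proof (intro conjI allI)
  fix a b1 b2 c :: "'a \<times> 'b"
  show "(\<Sum>d. ctens D D' a d c * ctens D D' d b1 b2) = (\<Sum>d. ctens D D' a b1 d * ctens D D' d b2 c)"
  proof (cases a; cases b1; cases b2; cases c)
    fix a' a'' b1' b1'' b2' b2'' c' c''
    assume [simp]: "a = (a', a'')" "b1 = (b1', b1'')" "b2 = (b2', b2'')" "c = (c', c'')"
    have "(\<Sum>d. ctens D D' a d c * ctens D D' d b1 b2) = (\<Sum>d. D a' d c' * D d b1' b2') * (\<Sum>d. D' a'' d c'' * D' d b1'' b2'')"
      by (simp add: sum_pair sum_product mult.assoc mult.left_commute)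
    also have "\<dots> = (\<Sum>d. D a' b1' d * D d b2' c') * (\<Sum>d. D' a'' b1'' d * D' d b2'' c'')"
      using assms by (simp add: coalgebra_def)
    also have "\<dots> = (\<Sum>d. ctens D D' a b1 d * ctens D D' d b2 c)"
      by (simp add: sum_pair sum_product mult.assoc mult.left_commute)
    finally show ?thesis .
  qed
  show "(\<Sum>b. (case b of (a, b) \<Rightarrow> e a * e' b) * ctens D D' a b c) = bas a c"
  proof (cases a; cases c)
    fix a' a'' c' c'' assume [simp]: "a = (a', a'')" "c = (c', c'')"
    have "(\<Sum>b. (case b of (a, b) \<Rightarrow> e a * e' b) * ctens D D' a b c) = (\<Sum>b. e b * D a' b c') * (\<Sum>b. e' b * D' a'' b c'')"
      by (simp add: sum_pair sum_product mult.assoc mult.left_commute)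
    then show ?thesis using assms by (simp add: coalgebra_def) (simp add: bas_def)
  qed
  show "(\<Sum>b. (case b of (a, b) \<Rightarrow> e a * e' b) * ctens D D' a c b) = bas a c"
  proof (cases a; cases c)
    fix a' a'' c' c'' assume [simp]: "a = (a', a'')" "c = (c', c'')"
    have "(\<Sum>b. (case b of (a, b) \<Rightarrow> e a * e' b) * ctens D D' a c b) = (\<Sum>b. e b * D a' c' b) * (\<Sum>b. e' b * D' a'' c'' b)"
      by (simp add: sum_pair sum_product mult.assoc mult.left_commute)
    then show ?thesis using assms by (simp add: coalgebra_def) (simp add: bas_def)
  qed
qed

text \<open>With its mirror image \<open>liftr\<close> it places families indexed by H and families
  indexed by the dual in one convolution monoid, where exchange relations become index-free
  equations between words.\<close>

definition liftl :: "('b \<Rightarrow> 'k) \<Rightarrow> ('a \<Rightarrow> ('n::finite, 'k::comm_ring_1) sqm) \<Rightarrow> 'a \<times> 'b \<Rightarrow> ('n, 'k) sqm" where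
  "liftl e' f = (\<lambda>(y, g). scl (e' g) (f y))"

definition liftr :: "('a \<Rightarrow> 'k) \<Rightarrow> ('b \<Rightarrow> ('n::finite, 'k::comm_ring_1) sqm) \<Rightarrow> 'a \<times> 'b \<Rightarrow> ('n, 'k) sqm" where
  "liftr e f = (\<lambda>(y, g). scl (e y) (f g))"

text \<open>The evaluation pairing times 1, which is the canonical element of Hom(H (x) H^*, A).
  Both factors have the index type \<open>'a\<close> because dual bases are used.\<close>

definition Wfam :: "'a \<times> 'a \<Rightarrow> ('n::finite, 'k::comm_ring_1) sqm" where
  "Wfam = (\<lambda>(y, g). scl (bas y g) 1)"

lemma cnv_liftl_any:
  fixes D :: "'a::finite \<Rightarrow> 'a \<Rightarrow> 'a \<Rightarrow> 'k::comm_ring_1" and D' :: "'b::finite \<Rightarrow> 'b \<Rightarrow> 'b \<Rightarrow> 'k"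
  assumes "coalgebra D' e'"
  shows "cnv (ctens D D') (liftl e' f) K (y, g) = (\<Sum>y1 y2. scl (D y y1 y2) (f y1 * K (y2, g)))"
proof -
  have "cnv (ctens D D') (liftl e' f) K (y, g) =
    (\<Sum>y1 y2 g2 g1. scl (D y y1 y2 * (e' g1 * D' g g1 g2)) (f y1 * K (y2, g2)))"
    unfolding cnv_def sum_pair
    by (simp add: liftl_def, simp only: sum_nested,
      rule sum_permute[of "\<lambda>(y1,g1,y2,g2). (y1,y2,g2,g1)"])
       (auto simp: ac_simps)
  also have "\<dots> = (\<Sum>y1 y2 g2. scl (bas g g2) (scl (D y y1 y2) (f y1 * K (y2, g2))))"
    using assms by (simp add: sum_scl[symmetric] sum_distrib_left[symmetric] coalgebra_def mult.commute)
  finally show ?thesis by (simp only: scl_bas)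
qed

text \<open>The flip of the two factors respects convolution; by \<open>lift_swap\<close> it
  exchanges \<open>liftl\<close> with \<open>liftr\<close> and fixes \<open>Wfam\<close>, so each
  formula below is computed on one side only.\<close>

lemma cnv_swap:
  fixes D :: "'a::finite \<Rightarrow> 'a \<Rightarrow> 'a \<Rightarrow> 'k::comm_ring_1" and D' :: "'b::finite \<Rightarrow> 'b \<Rightarrow> 'b \<Rightarrow> 'k"
  shows "cnv (ctens D D') f h (y, g) = cnv (ctens D' D) (\<lambda>(a, b). f (b, a)) (\<lambda>(a, b). h (b, a)) (g, y)"
  unfolding cnv_def sum_pair
  by (simp, simp only: sum_nested, rule sum_permute[of "\<lambda>(a,b,c,d). (b,a,d,c)"])
    (auto simp: ac_simps)

lemma lift_swap:
  "(\<lambda>(a, b). liftr e f (b, a)) = liftl e f" "(\<lambda>(a, b). liftl e f (b, a)) = liftr e f"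
  "(\<lambda>(a, b). Wfam (b, a)) = Wfam"
  by (auto simp: liftl_def liftr_def Wfam_def bas_commute fun_eq_iff)

lemma cnv_liftr_any:
  fixes D :: "'a::finite \<Rightarrow> 'a \<Rightarrow> 'a \<Rightarrow> 'k::comm_ring_1" and D' :: "'b::finite \<Rightarrow> 'b \<Rightarrow> 'b \<Rightarrow> 'k"
  assumes "coalgebra D e"
  shows "cnv (ctens D D') (liftr e f) K (y, g) = (\<Sum>g1 g2. scl (D' g g1 g2) (f g1 * K (y, g2)))"
  by (subst cnv_swap) (simp add: lift_swap cnv_liftl_any[OF assms])

text \<open>Pairing y with the first leg of gamma merely selects a structure constant, since both
  run through dual bases.\<close>

lemma cnv_W_liftr:
  fixes D D' :: "'a::finite \<Rightarrow> 'a \<Rightarrow> 'a \<Rightarrow> 'k::comm_ring_1"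
  assumes co: "coalgebra D e"
  shows "cnv (ctens D D') Wfam (liftr e f) (y, g) = (\<Sum>g2. scl (D' g y g2) (f g2))"
proof -
  have "cnv (ctens D D') Wfam (liftr e f) (y, g) =
    (\<Sum>y1 g2 y2 g1. scl (bas y1 g1) (scl (D y y1 y2 * D' g g1 g2 * e y2) (f g2)))"
    unfolding cnv_def sum_pair
    by (simp add: liftr_def Wfam_def, simp only: sum_nested,
      rule sum_permute[of "\<lambda>(y1,g1,y2,g2). (y1,g2,y2,g1)"])
       (auto simp: ac_simps)
  also have "\<dots> = (\<Sum>y1 g2 y2. scl (e y2 * D y y1 y2) (scl (D' g y1 g2) (f g2)))"
    by (simp only: scl_bas) (simp add: ac_simps)
  also have "\<dots> = (\<Sum>y1. scl (bas y y1) (\<Sum>g2. scl (D' g y1 g2) (f g2)))"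
    using co by (simp only: sum_scl[symmetric] coalgebra_def scl_sum)
  finally show ?thesis by (simp only: scl_bas)
qed

lemma cnv_W_liftl:
  fixes D D' :: "'a::finite \<Rightarrow> 'a \<Rightarrow> 'a \<Rightarrow> 'k::comm_ring_1"
  assumes "coalgebra D' e'"
  shows "cnv (ctens D D') Wfam (liftl e' f) (y, g) = (\<Sum>y2. scl (D y g y2) (f y2))"
  by (subst cnv_swap) (simp only: lift_swap cnv_W_liftr[OF assms])

lemma coalgebra_scl_counit:
  assumes "coalgebra D e"
  shows "(\<Sum>a b. scl (D c a b * e b) (f a)) = f c"
    "(\<Sum>a b. scl (D c a b * e a) (f b)) = f c"
proof -
  have "(\<Sum>a b. scl (D c a b * e b) (f a)) = (\<Sum>a. scl (bas c a) (f a))"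
    using assms by (simp add: sum_scl[symmetric] coalgebra_def mult.commute)
  then show "(\<Sum>a b. scl (D c a b * e b) (f a)) = f c" by simp
  have "(\<Sum>a b. scl (D c a b * e a) (f b)) = (\<Sum>b. scl (bas c b) (f b))"
    using assms by (subst sum.swap) (simp add: sum_scl[symmetric] coalgebra_def mult.commute)
  then show "(\<Sum>a b. scl (D c a b * e a) (f b)) = f c" by simp
qed

context
  fixes D :: "'a::finite \<Rightarrow> 'a \<Rightarrow> 'a \<Rightarrow> 'k::comm_ring_1" and D' :: "'b::finite \<Rightarrow> 'b \<Rightarrow> 'b \<Rightarrow> 'k" and e e'
  assumes co: "coalgebra D e" "coalgebra D' e'"
begin

lemma cnv_liftl_liftl: "cnv (ctens D D') (liftl e' f) (liftl e' f') = liftl e' (cnv D f f')"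
  by (rule ext, clarify) (simp add: cnv_liftl_any[OF co(2)], simp add: liftl_def cnv_def scl_sum ac_simps)

lemma cnv_liftr_liftr: "cnv (ctens D D') (liftr e f) (liftr e f') = liftr e (cnv D' f f')"
  by (rule ext, clarify) (simp add: cnv_liftr_any[OF co(1)], simp add: liftr_def cnv_def scl_sum ac_simps)

lemma cnv_liftl_liftr: "cnv (ctens D D') (liftl e' f) (liftr e f') (y, g) = f y * f' g"
  by (simp add: cnv_liftl_any[OF co(2)])
    (simp add: liftr_def coalgebra_scl_counit[OF co(1), of _ "\<lambda>a. f a * f' g"])

lemma cnv_liftr_liftl: "cnv (ctens D D') (liftr e f) (liftl e' f') (y, g) = f g * f' y"
  by (simp add: cnv_liftr_any[OF co(1)])
    (simp add: liftl_def coalgebra_scl_counit[OF co(2), of _ "\<lambda>a. f a * f' y"])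

end

context
  fixes D D' :: "'a::finite \<Rightarrow> 'a \<Rightarrow> 'a \<Rightarrow> 'k::comm_ring_1" and e e'
  assumes co: "coalgebra D e" "coalgebra D' e'"
begin

lemma cnv_liftl_W_liftr: "cnv (ctens D D') (liftl e' f) (cnv (ctens D D') Wfam (liftr e f')) (y, g)
    = (\<Sum>a x b. scl (D y a x * D' g x b) (f a * f' b))"
  by (simp add: cnv_liftl_any[OF co(2)] cnv_W_liftr[OF co(1)] sum_distrib_left scl_sum)

lemma cnv_liftr_W_liftl: "cnv (ctens D D') (liftr e f) (cnv (ctens D D') Wfam (liftl e' f')) (y, g)
    = (\<Sum>a x b. scl (D' g a x * D y x b) (f a * f' b))"
  by (simp add: cnv_liftr_any[OF co(1)] cnv_W_liftl[OF co(2)] sum_distrib_left scl_sum)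

end

section \<open>Algebra maps into matrices and their convolution\<close>

definition alg_fam :: "('c::finite \<Rightarrow> 'c \<Rightarrow> 'c \<Rightarrow> 'k::comm_ring_1) \<Rightarrow> ('c \<Rightarrow> 'k) \<Rightarrow> ('c \<Rightarrow> ('n::finite, 'k) sqm) \<Rightarrow> bool" where
  "alg_fam M u p \<longleftrightarrow> (\<forall>a b. p a * p b = (\<Sum>c. scl (M a b c) (p c))) \<and> (\<Sum>c. scl (u c) (p c)) = 1"

definition antip :: "('i::finite, 'k::comm_ring_1) hopf \<Rightarrow> ('i \<Rightarrow> ('n::finite, 'k) sqm) \<Rightarrow> 'i \<Rightarrow> ('n, 'k) sqm" where
  "antip H p a = (\<Sum>b. scl (hanti H a b) (p b))"

definition alg_hom :: "('i::finite, 'k::comm_ring_1) hopf \<Rightarrow> ('i \<Rightarrow> ('n::finite, 'k) sqm) \<Rightarrow> bool" where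
  "alg_hom H p \<longleftrightarrow> alg_fam (hmul H) (hunit H) p"

lemma hopf_coalgebra: "hopf_algebra H \<Longrightarrow> coalgebra (hcomul H) (hcounit H)"
  by (simp add: hopf_algebra_def coalgebra_def)

lemma alg_hom_mult: "alg_hom H p \<Longrightarrow> p a * p b = (\<Sum>c. scl (hmul H a b c) (p c))"
  by (simp add: alg_hom_def alg_fam_def)

lemma alg_hom_unit: "alg_hom H p \<Longrightarrow> (\<Sum>c. scl (hunit H c) (p c)) = 1"
  by (simp add: alg_hom_def alg_fam_def)

text \<open>Commuting images make a (x) b -> p(a) q(b) an algebra map on H (x) H, and Delta is an
  algebra map.\<close>

lemma cnv_alg_hom:
  fixes H :: "('i::finite, 'k::field) hopf"
  assumes H: "hopf_algebra H" and p: "alg_hom H p" and q: "alg_hom H q"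
    and comm: "\<And>a b. p a * q b = q b * p a"
  shows "alg_hom H (cnv (hcomul H) p q)"
  unfolding alg_hom_def alg_fam_def
proof (intro conjI allI)
  fix a b
  have *: "p a1 * (q a2 * (p b1 * q b2)) = (\<Sum>c d. scl (hmul H a1 b1 c * hmul H a2 b2 d) (p c * q d))" for a1 a2 b1 b2
  proof -
    have "p a1 * (q a2 * (p b1 * q b2)) = (p a1 * p b1) * (q a2 * q b2)"
      by (metis comm mult.assoc)
    then show ?thesis
      by (simp add: alg_hom_mult[OF p] alg_hom_mult[OF q] sum_distribs scl_sum ac_simps)
         (rule sum.swap)
  qed
  have "cnv (hcomul H) p q a * cnv (hcomul H) p q b =
     (\<Sum>a1 a2 b1 b2 c d. scl (hcomul H a a1 a2 * hcomul H b b1 b2 * hmul H a1 b1 c * hmul H a2 b2 d) (p c * q d))"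
    by (simp add: cnv_def sum_distribs scl_sum mult.assoc *, simp only: sum_nested,
      rule sum_permute[of "\<lambda>(b1,b2,a1,a2,c,d). (a1,a2,b1,b2,c,d)"])
       (auto simp: ac_simps)
  also have "\<dots> = (\<Sum>c d a1 a2 b1 b2. scl (hcomul H a a1 a2 * hcomul H b b1 b2 * hmul H a1 b1 c * hmul H a2 b2 d) (p c * q d))"
    unfolding sum_nested
    by (rule sum_permute[of "\<lambda>(a1,a2,b1,b2,c,d). (c,d,a1,a2,b1,b2)"]) auto
  also have "\<dots> = (\<Sum>c d e. scl (hmul H a b e * hcomul H e c d) (p c * q d))"
    using H by (simp only: sum_scl[symmetric] hopf_algebra_def)
  also have "\<dots> = (\<Sum>e c d. scl (hmul H a b e * hcomul H e c d) (p c * q d))"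
    unfolding sum_nested
    by (rule sum_permute[of "\<lambda>(c,d,e). (e,c,d)"]) auto
  also have "\<dots> = (\<Sum>c. scl (hmul H a b c) (cnv (hcomul H) p q c))"
    by (simp add: cnv_def scl_sum)
  finally show "cnv (hcomul H) p q a * cnv (hcomul H) p q b = (\<Sum>c. scl (hmul H a b c) (cnv (hcomul H) p q c))" .
next
  have "(\<Sum>c. scl (hunit H c) (cnv (hcomul H) p q c)) =
     (\<Sum>e c d. scl (hunit H e * hcomul H e c d) (p c * q d))"
    by (simp add: cnv_def scl_sum)
  also have "\<dots> = (\<Sum>c d e. scl (hunit H e * hcomul H e c d) (p c * q d))"
    unfolding sum_nested
    by (rule sum_permute[of "\<lambda>(e,c,d). (c,d,e)"]) auto
  also have "\<dots> = (\<Sum>c d. scl (hunit H c * hunit H d) (p c * q d))"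
    using H by (simp only: sum_scl[symmetric] hopf_algebra_def)
  also have "\<dots> = (\<Sum>c. scl (hunit H c) (p c)) * (\<Sum>d. scl (hunit H d) (q d))"
    by (simp add: sum_distribs) (subst sum.swap, simp add: scl_sum mult.commute)
  finally show "(\<Sum>c. scl (hunit H c) (cnv (hcomul H) p q c)) = 1"
    by (simp add: alg_hom_unit[OF p] alg_hom_unit[OF q])
qed

lemma antip_sum:
  fixes H :: "('i::finite, 'k::field) hopf"
  assumes p: "alg_hom H p"
  shows "(\<Sum>b c. scl (D b c) (antip H p b * p c)) = (\<Sum>e. scl (\<Sum>b c d. D b c * hanti H b d * hmul H d c e) (p e))"
    "(\<Sum>b c. scl (D b c) (p b * antip H p c)) = (\<Sum>e. scl (\<Sum>b c d. D b c * hanti H c d * hmul H b d e) (p e))"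
  by (simp_all add: antip_def sum_distribs scl_sum sum_scl alg_hom_mult[OF p], (simp only: sum_nested,
      rule sum_permute[of "\<lambda>(b,c,d,e). (e,b,c,d)"], auto simp: ac_simps)+)

lemma alg_hom_scaled_unit: "alg_hom H p \<Longrightarrow> (\<Sum>e. scl (k * hunit H e) (p e)) = scl k 1"
  by (simp add: scl_sum flip: alg_hom_unit)

text \<open>Applying p to the antipode axioms shows that p composed with S is the convolution
  inverse of p.\<close>

lemma antip_cnv:
  fixes H :: "('i::finite, 'k::field) hopf"
  assumes H: "hopf_algebra H" and p: "alg_hom H p"
  shows "cnv (hcomul H) (antip H p) p = (\<lambda>a. scl (hcounit H a) 1)"
    "cnv (hcomul H) p (antip H p) = (\<lambda>a. scl (hcounit H a) 1)"
  using H by (simp_all add: fun_eq_iff cnv_def antip_sum[OF p] hopf_algebra_def alg_hom_scaled_unit[OF p])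

section \<open>Antipode and dual\<close>

text \<open>H and its dual share one index type, so every identity proved for H yields its dual by
  instantiation.\<close>

definition dual :: "('i, 'k) hopf \<Rightarrow> ('i, 'k) hopf" where
  "dual H = \<lparr>hmul = (\<lambda>a b c. hcomul H c a b), hunit = hcounit H,
     hcomul = (\<lambda>c a b. hmul H a b c), hcounit = hunit H, hanti = (\<lambda>a b. hanti H b a)\<rparr>"

lemma dual_simps [simp]:
  "hmul (dual H) a b c = hcomul H c a b" "hunit (dual H) = hcounit H"
  "hcomul (dual H) c a b = hmul H a b c" "hcounit (dual H) = hunit H"
  "hanti (dual H) a b = hanti H b a"
  by (simp_all add: dual_def)

lemma hopf_assoc:
  "hopf_algebra H \<Longrightarrow> (\<Sum>d. hmul H a b d * hmul H d c e) = (\<Sum>d. hmul H b c d * hmul H a d e)"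
  by (simp add: hopf_algebra_def)

lemma hopf_unit:
  assumes "hopf_algebra H"
  shows "(\<Sum>c. hunit H c * hmul H c a b) = bas a b" "(\<Sum>c. hunit H c * hmul H a c b) = bas a b"
  using assms by (simp_all add: hopf_algebra_def)

lemma hopf_coassoc:
  "hopf_algebra H \<Longrightarrow> (\<Sum>d. hcomul H a d c * hcomul H d b1 b2) = (\<Sum>d. hcomul H a b1 d * hcomul H d b2 c)"
  by (simp add: hopf_algebra_def)

lemma hopf_counit:
  assumes "hopf_algebra H"
  shows "(\<Sum>b. hcounit H b * hcomul H a b c) = bas a c" "(\<Sum>c. hcounit H c * hcomul H a b c) = bas a b"
  using assms by (simp_all add: hopf_algebra_def)

lemma hopf_comul_mult:
  "hopf_algebra H \<Longrightarrow> (\<Sum>e. hmul H a b e * hcomul H e c d) =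
        (\<Sum>a1 a2 b1 b2. hcomul H a a1 a2 * hcomul H b b1 b2 * hmul H a1 b1 c * hmul H a2 b2 d)"
  by (simp add: hopf_algebra_def)

lemma hopf_comul_unit:
  "hopf_algebra H \<Longrightarrow> (\<Sum>e. hunit H e * hcomul H e c d) = hunit H c * hunit H d"
  by (simp add: hopf_algebra_def)

lemma hopf_counit_mult:
  "hopf_algebra H \<Longrightarrow> (\<Sum>e. hmul H a b e * hcounit H e) = hcounit H a * hcounit H b"
  by (simp add: hopf_algebra_def)

lemma hopf_counit_unit: "hopf_algebra H \<Longrightarrow> (\<Sum>e. hunit H e * hcounit H e) = 1"
  by (simp add: hopf_algebra_def)

lemma hopf_antipode:
  assumes "hopf_algebra H"
  shows "(\<Sum>b c d. hcomul H a b c * hanti H b d * hmul H d c e) = hcounit H a * hunit H e"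
    "(\<Sum>b c d. hcomul H a b c * hanti H c d * hmul H b d e) = hcounit H a * hunit H e"
  using assms unfolding hopf_algebra_def by blast+

lemma dual_hopf:
  fixes H :: "('i::finite, 'k::field) hopf"
  assumes H: "hopf_algebra H"
  shows "hopf_algebra (dual H)"
  unfolding hopf_algebra_def dual_simps
proof (intro conjI allI)
  fix a b c d e b1 b2
  show "(\<Sum>d. hcomul H d a b * hcomul H e d c) = (\<Sum>d. hcomul H d b c * hcomul H e a d)"
    using hopf_coassoc[OF H, of e c a b] by (simp add: mult.commute)
  show "(\<Sum>c. hcounit H c * hcomul H b c a) = bas a b" "(\<Sum>c. hcounit H c * hcomul H b a c) = bas a b"
    by (simp_all add: hopf_counit[OF H] bas_commute)
  show "(\<Sum>d. hmul H d c a * hmul H b1 b2 d) = (\<Sum>d. hmul H b1 d a * hmul H b2 c d)"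
    using hopf_assoc[OF H, of b1 b2 c a] by (simp add: mult.commute)
  show "(\<Sum>b. hunit H b * hmul H b c a) = bas a c" "(\<Sum>c. hunit H c * hmul H b c a) = bas a b"
    by (simp_all add: hopf_unit[OF H] bas_commute)
  have "(\<Sum>e. hcomul H e a b * hmul H c d e) =
        (\<Sum>a1 a2 b1 b2. hcomul H c a1 a2 * hcomul H d b1 b2 * hmul H a1 b1 a * hmul H a2 b2 b)"
    using hopf_comul_mult[OF H, of c d a b] by (simp add: mult.commute)
  also have "\<dots> = (\<Sum>a1 a2 b1 b2. hmul H a1 a2 a * hmul H b1 b2 b * hcomul H c a1 b1 * hcomul H d a2 b2)"
    unfolding sum_nested
    by (rule sum_permute[of "\<lambda>(a1,a2,b1,b2). (a1,b1,a2,b2)"])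
       (auto simp: ac_simps)
  finally show "(\<Sum>e. hcomul H e a b * hmul H c d e) = \<dots>" .
  show "(\<Sum>e. hcounit H e * hmul H c d e) = hcounit H c * hcounit H d"
    using hopf_counit_mult[OF H] by (simp add: mult.commute)
  show "(\<Sum>e. hcomul H e a b * hunit H e) = hunit H a * hunit H b"
    using hopf_comul_unit[OF H] by (simp add: mult.commute)
  show "(\<Sum>e. hcounit H e * hunit H e) = 1"
    using hopf_counit_unit[OF H] by (simp add: mult.commute)
  have "(\<Sum>b c d. hmul H b c a * hanti H d b * hcomul H e d c)
      = (\<Sum>b c d. hcomul H e b c * hanti H b d * hmul H d c a)"
    unfolding sum_nested
    by (rule sum_permute[of "\<lambda>(b,c,d). (d,c,b)"]) (auto simp: ac_simps)
  then show "(\<Sum>b c d. hmul H b c a * hanti H d b * hcomul H e d c) = hunit H a * hcounit H e"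
    by (simp only: hopf_antipode[OF H] mult.commute[of "hunit H a"])
  have "(\<Sum>b c d. hmul H b c a * hanti H d c * hcomul H e b d)
      = (\<Sum>b c d. hcomul H e b c * hanti H c d * hmul H b d a)"
    unfolding sum_nested
    by (rule sum_permute[of "\<lambda>(b,c,d). (b,d,c)"]) (auto simp: ac_simps)
  then show "(\<Sum>b c d. hmul H b c a * hanti H d c * hcomul H e b d) = hunit H a * hcounit H e"
    by (simp only: hopf_antipode[OF H] mult.commute[of "hunit H a"])
qed

text \<open>In this group of matrices columns are images: \<open>ent T m k\<close> is the
  coefficient of x_m in T(x_k). Thus \<open>lact H c\<close> is k -> k_(1) <alpha^c, k_(2)>,
  \<open>ract H c\<close> is k -> <alpha^c, k_(1)> k_(2), \<open>smat H\<close> is the antipode and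
  \<open>outer u v\<close> the rank one map k -> <v, k> u.\<close>

definition lreg :: "('i::finite, 'k::comm_ring_1) hopf \<Rightarrow> 'i \<Rightarrow> ('i, 'k) sqm" where
  "lreg H a = Mat (\<lambda>m k. hmul H a k m)"
definition rreg :: "('i::finite, 'k::comm_ring_1) hopf \<Rightarrow> 'i \<Rightarrow> ('i, 'k) sqm" where
  "rreg H a = Mat (\<lambda>m k. hmul H k a m)"
definition lact :: "('i::finite, 'k::comm_ring_1) hopf \<Rightarrow> 'i \<Rightarrow> ('i, 'k) sqm" where
  "lact H c = Mat (\<lambda>m k. hcomul H k m c)"
definition ract :: "('i::finite, 'k::comm_ring_1) hopf \<Rightarrow> 'i \<Rightarrow> ('i, 'k) sqm" where
  "ract H c = Mat (\<lambda>m k. hcomul H k c m)"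
definition smat :: "('i::finite, 'k::comm_ring_1) hopf \<Rightarrow> ('i, 'k) sqm" where
  "smat H = Mat (\<lambda>m k. hanti H k m)"
definition outer :: "('i::finite \<Rightarrow> 'k::comm_ring_1) \<Rightarrow> ('i \<Rightarrow> 'k) \<Rightarrow> ('i, 'k) sqm" where
  "outer u v = Mat (\<lambda>m k. u m * v k)"

lemma lreg_hom: "hopf_algebra H \<Longrightarrow> alg_hom H (lreg (H :: ('i::finite, 'k::field) hopf))"
  unfolding alg_hom_def alg_fam_def
proof (intro conjI allI)
  assume H: "hopf_algebra H"
  fix a b
  show "lreg H a * lreg H b = (\<Sum>c. scl (hmul H a b c) (lreg H c))"
  proof (rule ent_inject')
    fix i j show "ent (lreg H a * lreg H b) i j = ent (\<Sum>c. scl (hmul H a b c) (lreg H c)) i j"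
      using hopf_assoc[OF H, of a b j i] by (simp add: ent_simps lreg_def mult.commute)
  qed
  show "(\<Sum>c. scl (hunit H c) (lreg H c)) = 1"
    by (rule ent_inject') (auto simp: ent_simps lreg_def hopf_unit[OF H] bas_def)
qed

lemma lact_hom: "hopf_algebra H \<Longrightarrow> alg_hom (dual H) (lact (H :: ('i::finite, 'k::field) hopf))"
  unfolding alg_hom_def alg_fam_def
proof (intro conjI allI)
  assume H: "hopf_algebra H"
  fix a b
  show "lact H a * lact H b = (\<Sum>c. scl (hmul (dual H) a b c) (lact H c))"
  proof (rule ent_inject')
    fix i j show "ent (lact H a * lact H b) i j = ent (\<Sum>c. scl (hmul (dual H) a b c) (lact H c)) i j"
      using hopf_coassoc[OF H, of j b i a] by (simp add: ent_simps lact_def mult.commute)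
  qed
  show "(\<Sum>c. scl (hunit (dual H) c) (lact H c)) = 1"
    by (rule ent_inject') (auto simp: ent_simps lact_def hopf_counit[OF H] bas_def)
qed

text \<open>Applying both operators to 1 recovers the coefficients. Equations in H may therefore be
  checked in the matrix ring.\<close>

lemma lreg_inject:
  fixes H :: "('i::finite, 'k::field) hopf"
  assumes H: "hopf_algebra H" and eq: "(\<Sum>c. scl (x c) (lreg H c)) = (\<Sum>c. scl (y c) (lreg H c))"
  shows "x m = y m"
proof -
  have "(\<Sum>k. ent (\<Sum>c. scl (x c) (lreg H c)) m k * hunit H k) = x m" for x
  proof -
    have "(\<Sum>k. ent (\<Sum>c. scl (x c) (lreg H c)) m k * hunit H k) = (\<Sum>c k. x c * (hunit H k * hmul H c k m))"
      by (subst sum.swap) (simp add: ent_simps lreg_def sum_distrib_left ac_simps)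
    then show ?thesis by (simp add: sum_distrib_left[symmetric] hopf_unit[OF H])
  qed
  then show ?thesis using eq by metis
qed

text \<open>Uniqueness of convolution inverses on H (x) H: S(ab), called \<open>\<kappa>\<close>, is
  a left inverse and S(b) S(a), called \<open>\<nu>\<close>, a right inverse of the multiplication
  \<open>\<mu>\<close>.\<close>

lemma hanti_mult:
  fixes H :: "('i::finite, 'k::field) hopf"
  assumes H: "hopf_algebra H"
  shows "(\<Sum>c. hmul H a b c * hanti H c e) = (\<Sum>p q. hanti H b p * hanti H a q * hmul H p q e)"
proof -
  define D where "D = ctens (hcomul H) (hcomul H)"
  define eps where "eps = (\<lambda>(a,b). hcounit H a * hcounit H b)"
  define L S where "L = lreg H" and "S = antip H (lreg H)"
  define \<mu> \<nu> \<kappa> where "\<mu> = (\<lambda>(a,b). L a * L b)" and "\<nu> = (\<lambda>(a,b). S b * S a)"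
    and "\<kappa> = (\<lambda>(a,b). \<Sum>c. scl (hmul H a b c) (S c))"
  have L: "alg_hom H L" unfolding L_def by (rule lreg_hom[OF H])
  have SL: "(\<Sum>a1 a2. scl (hcomul H a a1 a2) (S a1 * L a2)) = scl (hcounit H a) 1" for a
    using fun_cong[OF antip_cnv(1)[OF H L], of a] by (simp add: cnv_def S_def L_def)
  have LS: "(\<Sum>a1 a2. scl (hcomul H a a1 a2) (L a1 * S a2)) = scl (hcounit H a) 1" for a
    using fun_cong[OF antip_cnv(2)[OF H L], of a] by (simp add: cnv_def S_def L_def)
  have co: "coalgebra D eps"
    unfolding D_def eps_def by (intro coalgebra_ctens hopf_coalgebra H)
  interpret monoid "cnv D" "\<lambda>c. scl (eps c) (1 :: ('i, 'k) sqm)" by (rule cnv_monoid[OF co])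
  have kl: "cnv D \<kappa> \<mu> = (\<lambda>c. scl (eps c) 1)"
  proof (rule ext, clarify)
    fix a b
    have "cnv D \<kappa> \<mu> (a, b) = (\<Sum>a1 a2 b1 b2 d c. scl (hcomul H a a1 a2 * hcomul H b b1 b2 * hmul H a1 b1 c * hmul H a2 b2 d) (S c * L d))"
      unfolding cnv_def \<mu>_def \<kappa>_def sum_pair
      by (simp add: D_def sum_distribs scl_sum alg_hom_mult[OF L], simp only: sum_nested,
      rule sum_permute[of "\<lambda>(a1,b1,a2,b2,d,c). (a1,a2,b1,b2,d,c)"])
       (auto simp: ac_simps)
    also have "\<dots> = (\<Sum>c d a1 a2 b1 b2. scl (hcomul H a a1 a2 * hcomul H b b1 b2 * hmul H a1 b1 c * hmul H a2 b2 d) (S c * L d))"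
      unfolding sum_nested
      by (rule sum_permute[of "\<lambda>(a1,a2,b1,b2,d,c). (c,d,a1,a2,b1,b2)"]) auto
    also have "\<dots> = (\<Sum>c d e. scl (hmul H a b e * hcomul H e c d) (S c * L d))"
      by (simp only: sum_scl[symmetric] hopf_comul_mult[OF H])
    also have "\<dots> = (\<Sum>e. scl (hmul H a b e) (\<Sum>c d. scl (hcomul H e c d) (S c * L d)))"
      by (simp add: scl_sum, simp only: sum_nested,
         rule sum_permute[of "\<lambda>(c,d,e). (e,c,d)"]) auto
    also have "\<dots> = scl (\<Sum>e. hmul H a b e * hcounit H e) 1"
      by (simp add: SL sum_scl)
    finally show "cnv D \<kappa> \<mu> (a, b) = scl (eps (a, b)) 1"
      by (simp add: hopf_counit_mult[OF H] eps_def)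
  qed
  have lr: "cnv D \<mu> \<nu> = (\<lambda>c. scl (eps c) 1)"
  proof (rule ext, clarify)
    fix a b
    have "cnv D \<mu> \<nu> (a, b) = (\<Sum>a1 a2. scl (hcomul H a a1 a2)
         (L a1 * (\<Sum>b1 b2. scl (hcomul H b b1 b2) (L b1 * S b2)) * S a2))"
      unfolding cnv_def \<mu>_def \<nu>_def sum_pair
      by (simp add: D_def sum_distribs scl_sum, simp only: sum_nested,
      rule sum_permute[of "\<lambda>(a1,b1,a2,b2). (a1,a2,b1,b2)"])
       (auto simp: ac_simps)
    also have "\<dots> = scl (hcounit H b) (\<Sum>a1 a2. scl (hcomul H a a1 a2) (L a1 * S a2))"
      unfolding LS[of b] by (simp add: scl_sum ac_simps)
    also have "\<dots> = scl (eps (a, b)) 1" unfolding LS by (simp add: eps_def mult.commute)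
    finally show "cnv D \<mu> \<nu> (a, b) = scl (eps (a, b)) 1" .
  qed
  have "\<kappa> = cnv D \<kappa> (cnv D \<mu> \<nu>)" by (simp add: lr)
  also have "\<dots> = \<nu>" by (simp add: assoc[symmetric] kl)
  finally have "\<kappa> (a, b) = \<nu> (a, b)" by simp
  then have "(\<Sum>e. scl (\<Sum>c. hmul H a b c * hanti H c e) (L e)) =
      (\<Sum>e. scl (\<Sum>p q. hanti H b p * hanti H a q * hmul H p q e) (L e))"
  proof -
    assume *: "\<kappa> (a, b) = \<nu> (a, b)"
    have "\<kappa> (a, b) = (\<Sum>e. scl (\<Sum>c. hmul H a b c * hanti H c e) (L e))"
      by (simp add: \<kappa>_def S_def antip_def sum_scl scl_sum L_def) (rule sum.swap)
    moreover have "\<nu> (a, b) = (\<Sum>e. scl (\<Sum>p q. hanti H b p * hanti H a q * hmul H p q e) (L e))"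
      by (simp add: \<nu>_def S_def antip_def sum_scl scl_sum sum_distribs L_def[symmetric] alg_hom_mult[OF L],
        simp only: sum_nested,
      rule sum_permute[of "\<lambda>(q,p,e). (e,p,q)"]) (auto simp: ac_simps)
    ultimately show ?thesis using * by simp
  qed
  then show ?thesis unfolding L_def by (rule lreg_inject[OF H])
qed

lemma hanti_unit:
  fixes H :: "('i::finite, 'k::field) hopf"
  assumes H: "hopf_algebra H"
  shows "(\<Sum>a. hunit H a * hanti H a e) = hunit H e"
proof -
  have "hunit H e = (\<Sum>a. hunit H a * hcounit H a) * hunit H e"
    by (simp add: hopf_counit_unit[OF H])
  also have "\<dots> = (\<Sum>a b c d. hunit H a * hcomul H a b c * hanti H b d * hmul H d c e)"
    using hopf_antipode(1)[OF H, of _ e]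
    by (simp add: sum_distrib_right mult.assoc sum_distrib_left[symmetric])
  also have "\<dots> = (\<Sum>b c d. (\<Sum>a. hunit H a * hcomul H a b c) * (hanti H b d * hmul H d c e))"
    by (simp add: sum_distrib_right, simp only: sum_nested,
      rule sum_permute[of "\<lambda>(a,b,c,d). (b,c,d,a)"]) (auto simp: ac_simps)
  also have "\<dots> = (\<Sum>b d. hunit H b * hanti H b d * (\<Sum>c. hunit H c * hmul H d c e))"
    by (simp add: hopf_comul_unit[OF H] sum_distrib_left, subst (2) sum.swap, simp add: ac_simps)
  finally show ?thesis by (simp add: hopf_unit[OF H] sum_distrib_left[symmetric])
qed

lemma hanti_counit:
  fixes H :: "('i::finite, 'k::field) hopf"
  assumes H: "hopf_algebra H"
  shows "(\<Sum>e. hanti H a e * hcounit H e) = hcounit H a"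
  using hanti_unit[OF dual_hopf[OF H], of a] by (simp add: mult.commute)

lemma hanti_comult:
  fixes H :: "('i::finite, 'k::field) hopf"
  assumes H: "hopf_algebra H"
  shows "(\<Sum>c. hanti H e c * hcomul H c a b) = (\<Sum>p q. hcomul H e p q * hanti H p b * hanti H q a)"
  using hanti_mult[OF dual_hopf[OF H], of a b e] by (simp add: ac_simps)

section \<open>Operators attached to a single edge\<close>

text \<open>\<open>p\<close> is a family of vertex operators and \<open>q\<close> one of face operators.  In
  \<open>Hom(H \<otimes> H\<^sup>*, A)\<close>, with \<open>P\<close>, \<open>Q\<close> the lifts of \<open>p\<close>, \<open>q\<close> and \<open>W\<close> the canonical element, the three
  conditions read \<open>Q P = P W Q\<close>, \<open>P Q = Q W P\<close> and \<open>P W Q = Q W P\<close>.\<close>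

definition arriving :: "('i::finite, 'k::comm_ring_1) hopf \<Rightarrow> ('i \<Rightarrow> ('n::finite, 'k) sqm) \<Rightarrow> ('i \<Rightarrow> ('n, 'k) sqm) \<Rightarrow> bool" where
  "arriving H p q \<longleftrightarrow> (\<forall>y g. q g * p y = (\<Sum>a x b. scl (hcomul H y a x * hmul H x b g) (p a * q b)))"

definition departing :: "('i::finite, 'k::comm_ring_1) hopf \<Rightarrow> ('i \<Rightarrow> ('n::finite, 'k) sqm) \<Rightarrow> ('i \<Rightarrow> ('n, 'k) sqm) \<Rightarrow> bool" where
  "departing H p q \<longleftrightarrow> (\<forall>y g. p y * q g = (\<Sum>a x b. scl (hmul H a x g * hcomul H y x b) (q a * p b)))"

definition straighten :: "('i::finite, 'k::comm_ring_1) hopf \<Rightarrow> ('i \<Rightarrow> ('n::finite, 'k) sqm) \<Rightarrow> ('i \<Rightarrow> ('n, 'k) sqm) \<Rightarrow> bool" where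
  "straighten H p q \<longleftrightarrow> (\<forall>y g. (\<Sum>a x b. scl (hcomul H y a x * hmul H x b g) (p a * q b))
     = (\<Sum>a x b. scl (hmul H a x g * hcomul H y x b) (q a * p b)))"

abbreviation "hconv H \<equiv> cnv (ctens (hcomul H) (hcomul (dual H)))"
abbreviation "vlift H \<equiv> liftl (hcounit (dual H))"
abbreviation "flift H \<equiv> liftr (hcounit H)"

lemma fun_pair_eq: "f = g \<longleftrightarrow> (\<forall>y z. f (y, z) = g (y, z))"
  by (auto simp: fun_eq_iff)

context
  fixes H :: "('i::finite, 'k::field) hopf"
  assumes H: "hopf_algebra H"
begin

lemma hopf_coalgebras: "coalgebra (hcomul H) (hcounit H)" "coalgebra (hcomul (dual H)) (hcounit (dual H))"
  by (intro hopf_coalgebra H dual_hopf)+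

lemma hconv_monoid: "monoid (hconv H) (\<lambda>c. scl (case c of (a, b) \<Rightarrow> hcounit H a * hcounit (dual H) b) (1 :: ('n::finite, 'k) sqm))"
  by (rule cnv_monoid[OF coalgebra_ctens[OF hopf_coalgebras]])

lemma arriving_iff: "arriving H p q \<longleftrightarrow> hconv H (flift H q) (vlift H p) = hconv H (vlift H p) (hconv H Wfam (flift H q))"
  unfolding arriving_def fun_pair_eq cnv_liftr_liftl[OF hopf_coalgebras] cnv_liftl_W_liftr[OF hopf_coalgebras] by simp

lemma departing_iff: "departing H p q \<longleftrightarrow> hconv H (vlift H p) (flift H q) = hconv H (flift H q) (hconv H Wfam (vlift H p))"
  unfolding departing_def fun_pair_eq cnv_liftl_liftr[OF hopf_coalgebras] cnv_liftr_W_liftl[OF hopf_coalgebras] by simp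

lemma straighten_iff: "straighten H p q \<longleftrightarrow>
    hconv H (vlift H p) (hconv H Wfam (flift H q)) = hconv H (flift H q) (hconv H Wfam (vlift H p))"
  unfolding straighten_def fun_pair_eq cnv_liftl_W_liftr[OF hopf_coalgebras] cnv_liftr_W_liftl[OF hopf_coalgebras] by simp

lemma comm_iff: "(\<forall>y g. p y * q g = q g * p y) \<longleftrightarrow> hconv H (vlift H p) (flift H q) = hconv H (flift H q) (vlift H p)"
  unfolding fun_pair_eq cnv_liftl_liftr[OF hopf_coalgebras] cnv_liftr_liftl[OF hopf_coalgebras] by simp

lemma vlift_unit: "vlift H (\<lambda>a. scl (hcounit H a) 1) =
    (\<lambda>c. scl (case c of (a, b) \<Rightarrow> hcounit H a * hcounit (dual H) b) 1)"
  by (auto simp: liftl_def fun_eq_iff mult.commute)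

text \<open>Multiplicativity of Delta: the functional acts on a product y k by y_(1) k_(1) <alpha,
  y_(2) k_(2)>.\<close>

lemma arriving_lreg_lact: "arriving H (lreg H) (lact H)"
  unfolding arriving_def
proof (intro allI, rule ent_inject')
  fix y g i j
  have "ent (lact H g * lreg H y) i j = (\<Sum>l. hmul H y j l * hcomul H l i g)"
    by (simp add: ent_simps lreg_def lact_def mult.commute)
  also have "\<dots> = (\<Sum>a x l b. hcomul H y a x * hcomul H j l b * hmul H a l i * hmul H x b g)"
    by (simp only: hopf_comul_mult[OF H])
  also have "\<dots> = (\<Sum>a x b l. hcomul H y a x * hcomul H j l b * hmul H a l i * hmul H x b g)"
    by (intro sum.cong refl sum.swap)
  also have "\<dots> = ent (\<Sum>a x b. scl (hcomul H y a x * hmul H x b g) (lreg H a * lact H b)) i j"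
    by (simp add: ent_simps lreg_def lact_def sum_distrib_left ac_simps)
  finally show "ent (lact H g * lreg H y) i j = \<dots>" .
qed

text \<open>Here Delta is applied to k y, so the pairing uses the second leg of the functional; in
  convolution form this reads G R = R G W.\<close>

lemma lact_rreg: "lact H g * rreg H y = (\<Sum>a x b. scl (hcomul H y a x * hmul H b x g) (rreg H a * lact H b))"
proof (rule ent_inject')
  fix i j
  have "ent (lact H g * rreg H y) i j = (\<Sum>l. hmul H j y l * hcomul H l i g)"
    by (simp add: ent_simps rreg_def lact_def mult.commute)
  also have "\<dots> = (\<Sum>l b a x. hcomul H j l b * hcomul H y a x * hmul H l a i * hmul H b x g)"
    by (simp only: hopf_comul_mult[OF H])
  also have "\<dots> = (\<Sum>a x b l. hcomul H j l b * hcomul H y a x * hmul H l a i * hmul H b x g)"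
    unfolding sum_nested
    by (rule sum_permute[of "\<lambda>(l,b,a,x). (a,x,b,l)"]) auto
  also have "\<dots> = ent (\<Sum>a x b. scl (hcomul H y a x * hmul H b x g) (rreg H a * lact H b)) i j"
    by (simp add: ent_simps rreg_def lact_def sum_distrib_left ac_simps)
  finally show "ent (lact H g * rreg H y) i j = \<dots>" .
qed

lemma lreg_rreg_comm: "lreg H a * rreg H b = rreg H b * lreg H a"
proof (rule ent_inject')
  fix i j show "ent (lreg H a * rreg H b) i j = ent (rreg H b * lreg H a) i j"
    using hopf_assoc[OF H, of a j b i] by (simp add: ent_simps lreg_def rreg_def mult.commute)
qed

lemma lact_ract_comm: "lact H a * ract H b = ract H b * lact H a"
proof (rule ent_inject')
  fix i j show "ent (lact H a * ract H b) i j = ent (ract H b * lact H a) i j"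
    using hopf_coassoc[OF H, of j a b i] by (simp add: ent_simps lact_def ract_def mult.commute)
qed

end

text \<open>The operators for an edge met against its direction. Since S^2 = id, they are k -> k
  S(h) and k -> <S(alpha), k_(1)> k_(2); see \<open>fneg_eq\<close> and
  \<open>gneg_eq\<close>.\<close>

definition fneg :: "('i::finite, 'k::comm_ring_1) hopf \<Rightarrow> 'i \<Rightarrow> ('i, 'k) sqm" where
  "fneg H a = smat H * lreg H a * smat H"
definition gneg :: "('i::finite, 'k::comm_ring_1) hopf \<Rightarrow> 'i \<Rightarrow> ('i, 'k) sqm" where
  "gneg H a = smat H * lact H a * smat H"

locale inv_hopf =
  fixes H :: "('i::finite, 'k::field) hopf"
  assumes H: "hopf_algebra H" and inv: "antipode_involutive H"
begin

lemma dual_inv: "inv_hopf (dual H)"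
proof
  show "hopf_algebra (dual H)" by (rule dual_hopf[OF H])
  show "antipode_involutive (dual H)"
    using inv by (simp add: antipode_involutive_def bas_commute mult.commute)
qed

lemma hanti_hanti: "(\<Sum>b. hanti H a b * hanti H b c) = bas a c"
  using inv by (simp add: antipode_involutive_def)

lemma smat_sq [simp]: "smat H * smat H = 1" "smat H * (smat H * A) = A"
proof -
  show *: "smat H * smat H = 1"
  proof (rule ent_inject')
    fix i j show "ent (smat H * smat H) i j = ent 1 i j"
      using hanti_hanti[of j i] by (auto simp: ent_simps smat_def mult.commute bas_def)
  qed
  show "smat H * (smat H * A) = A" by (simp add: * mult.assoc[symmetric])
qed

lemma conj_mult: "(smat H * A * smat H) * (smat H * B * smat H) = smat H * (A * B) * smat H"
  by (simp add: mult.assoc)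

lemma fneg_eq: "fneg H a = antip H (rreg H) a"
proof -
  have "smat H * lreg H a = antip H (rreg H) a * smat H"
  proof (rule ent_inject')
    fix m k
    have "ent (antip H (rreg H) a * smat H) m k = (\<Sum>p q. hanti H k p * hanti H a q * hmul H p q m)"
      by (simp add: ent_simps antip_def rreg_def smat_def sum_distribs ac_simps)
        (rule sum.swap)
    then show "ent (smat H * lreg H a) m k = ent (antip H (rreg H) a * smat H) m k"
      by (simp only: hanti_mult[OF H, symmetric]) (simp add: ent_simps lreg_def smat_def mult.commute)
  qed
  then show ?thesis by (simp add: fneg_def mult.assoc)
qed

text \<open>S reverses the coproduct, so conjugation moves the pairing from the second leg of k to
  the first.\<close>

lemma gneg_eq: "gneg H c = antip (dual H) (ract H) c"
proof -
  have "smat H * lact H c = antip (dual H) (ract H) c * smat H"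
  proof (rule ent_inject')
    fix m k
    have "ent (antip (dual H) (ract H) c * smat H) m k = (\<Sum>b l. (hanti H b c * (hanti H k l * hcomul H l b m)))"
      by (simp add: ent_simps antip_def ract_def smat_def sum_distribs ac_simps)
    also have "\<dots> = (\<Sum>b. hanti H b c * (\<Sum>p q. hcomul H k p q * hanti H p m * hanti H q b))"
      by (simp only: sum_distrib_left[symmetric] hanti_comult[OF H])
    also have "\<dots> = (\<Sum>p q b. hcomul H k p q * hanti H p m * (hanti H q b * hanti H b c))"
      by (simp add: sum_distrib_left, simp only: sum_nested,
      rule sum_permute[of "\<lambda>(b,p,q). (p,q,b)"]) (auto simp: ac_simps)
    also have "\<dots> = (\<Sum>p. hcomul H k p c * hanti H p m)"
      by (simp add: sum_distrib_left[symmetric] hanti_hanti)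
    finally show "ent (smat H * lact H c) m k = ent (antip (dual H) (ract H) c * smat H) m k"
      by (simp add: ent_simps lact_def smat_def mult.commute)
  qed
  then show ?thesis by (simp add: gneg_def mult.assoc)
qed

lemma fneg_hom: "alg_hom H (fneg H)"
  unfolding alg_hom_def alg_fam_def
proof (intro conjI allI)
  fix a b
  show "fneg H a * fneg H b = (\<Sum>c. scl (hmul H a b c) (fneg H c))"
    by (simp add: fneg_def conj_mult alg_hom_mult[OF lreg_hom[OF H]] sum_distribs)
  have "(\<Sum>c. scl (hunit H c) (fneg H c)) = smat H * (\<Sum>c. scl (hunit H c) (lreg H c)) * smat H"
    by (simp add: fneg_def sum_distribs)
  then show "(\<Sum>c. scl (hunit H c) (fneg H c)) = 1"
    by (simp add: alg_hom_unit[OF lreg_hom[OF H]])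
qed

lemma gneg_hom: "alg_hom (dual H) (gneg H)"
  unfolding alg_hom_def alg_fam_def
proof (intro conjI allI)
  fix a b
  show "gneg H a * gneg H b = (\<Sum>c. scl (hmul (dual H) a b c) (gneg H c))"
    by (simp add: gneg_def conj_mult alg_hom_mult[OF lact_hom[OF H]] sum_distribs)
  have "(\<Sum>c. scl (hunit (dual H) c) (gneg H c)) = smat H * (\<Sum>c. scl (hunit (dual H) c) (lact H c)) * smat H"
    by (simp add: gneg_def sum_distribs)
  then show "(\<Sum>c. scl (hunit (dual H) c) (gneg H c)) = 1"
    using alg_hom_unit[OF lact_hom[OF H]] by simp
qed

lemma lreg_fneg_comm: "lreg H a * fneg H b = fneg H b * lreg H a"
  by (simp add: fneg_eq antip_def sum_distribs lreg_rreg_comm[OF H])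

lemma lact_gneg_comm: "lact H a * gneg H b = gneg H b * lact H a"
  by (simp add: gneg_eq antip_def sum_distribs lact_ract_comm[OF H])

lemma arriving_fneg_gneg: "arriving H (fneg H) (gneg H)"
  using arriving_lreg_lact[OF H]
  by (simp add: arriving_def fneg_def gneg_def conj_mult sum_distribs)

lemma antip_pant: "antip H (antip H p) = p"
proof
  fix a
  have "antip H (antip H p) a = (\<Sum>c. scl (\<Sum>b. hanti H a b * hanti H b c) (p c))"
    by (simp add: antip_def scl_sum sum_scl) (rule sum.swap)
  then show "antip H (antip H p) a = p a" by (simp add: hanti_hanti)
qed

lemma smat_pant_lreg: "smat H * antip H (lreg H) b * smat H = rreg H b"
proof -
  have "smat H * antip H (lreg H) b * smat H = antip H (fneg H) b"
    by (simp add: antip_def fneg_def sum_distribs)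
  then show ?thesis using fneg_eq antip_pant[of "rreg H"] by (metis ext)
qed

lemma cnv_conj: "cnv D (\<lambda>a. smat H * p a * smat H) (\<lambda>a. smat H * q a * smat H) = (\<lambda>a. smat H * cnv D p q a * smat H)"
  by (rule ext) (simp add: cnv_def conj_mult sum_distribs)

text \<open>The antipode axioms for \<open>lreg\<close>, conjugated by S. On vectors the first
  equation says k S(a_(2)) a_(1) = eps(a) k, a skew antipode law.\<close>

lemma rreg_fneg_cnv:
  "cnv (hcomul H) (rreg H) (fneg H) = (\<lambda>a. scl (hcounit H a) 1)"
  "cnv (hcomul H) (fneg H) (rreg H) = (\<lambda>a. scl (hcounit H a) 1)"
  using cnv_conj[of "hcomul H" "antip H (lreg H)" "lreg H"] cnv_conj[of "hcomul H" "lreg H" "antip H (lreg H)"]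
  unfolding smat_pant_lreg fneg_def[symmetric] antip_cnv(1)[OF H lreg_hom[OF H]] antip_cnv(2)[OF H lreg_hom[OF H]]
  by simp_all

text \<open>F is the convolution inverse of the right multiplications R, and G R = R G W by
  \<open>lact_rreg\<close>. Hence F G = F G R F = F R G W F = G W F.\<close>

lemma departing_fneg_lact: "departing H (fneg H) (lact H)"
proof -
  let ?R = "vlift H (rreg H)" and ?F = "vlift H (fneg H)" and ?G = "flift H (lact H)"
  let ?one = "\<lambda>c. scl (case c of (a, b) \<Rightarrow> hcounit H a * hcounit (dual H) b) (1 :: ('i, 'k) sqm)"
  interpret monoid "hconv H" ?one by (rule hconv_monoid[OF H])
  have RF: "hconv H ?R ?F = ?one" "hconv H ?F ?R = ?one"
    by (simp_all only: cnv_liftl_liftl[OF hopf_coalgebras[OF H]] rreg_fneg_cnv vlift_unit[OF H])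
  have GR: "hconv H ?G ?R = hconv H ?R (hconv H ?G Wfam)"
    unfolding fun_pair_eq
  proof (intro allI)
    fix y g
    have "hconv H ?G Wfam (y, g) = (\<Sum>b. scl (hmul H b y g) (lact H b))" for y g
    proof -
      have "hconv H ?G Wfam (y, g) = (\<Sum>b x. scl (bas y x) (scl (hmul H b x g) (lact H b)))"
        unfolding cnv_liftr_any[OF hopf_coalgebras(1)[OF H]] by (simp add: Wfam_def ac_simps)
      then show ?thesis by (simp only: scl_bas)
    qed
    then show "hconv H ?G ?R (y, g) = hconv H ?R (hconv H ?G Wfam) (y, g)"
      unfolding cnv_liftl_any[OF hopf_coalgebras(2)[OF H]] cnv_liftr_liftl[OF hopf_coalgebras[OF H]] lact_rreg[OF H]
      by (simp add: sum_distrib_left scl_sum)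
  qed
  have "hconv H ?F ?G = hconv H (hconv H ?F (hconv H ?G ?R)) ?F"
    by (simp only: assoc RF right_neutral)
  also have "\<dots> = hconv H ?G (hconv H Wfam ?F)"
    unfolding GR by (simp only: assoc[symmetric] RF left_neutral)
  finally show ?thesis by (simp only: departing_iff[OF H])
qed

lemma departing_lreg_gneg: "departing H (lreg H) (gneg H)"
proof -
  have *: "smat H * (fneg H y * lact H g) * smat H = lreg H y * gneg H g"
    "smat H * (lact H g * fneg H y) * smat H = gneg H g * lreg H y" for y g
    by (simp_all add: fneg_def gneg_def mult.assoc)
  have "smat H * (fneg H y * lact H g) * smat H = (\<Sum>a x b. scl (hmul H a x g * hcomul H y x b) (smat H * (lact H a * fneg H b) * smat H))" for y g
    using departing_fneg_lact by (simp add: departing_def sum_distribs)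
  then show ?thesis unfolding departing_def * by blast
qed

lemma rreg_rreg: "(\<Sum>k. ent (rreg H b * rreg H d) m k * hunit H k) = hmul H d b m"
proof -
  have "(\<Sum>k. ent (rreg H b * rreg H d) m k * hunit H k) = (\<Sum>l. hmul H l b m * (\<Sum>k. hunit H k * hmul H k d l))"
    by (simp add: ent_simps rreg_def sum_distribs, subst sum.swap) (simp add: ac_simps)
  then show ?thesis by (simp add: hopf_unit[OF H])
qed

text \<open>The operator identity \<open>rreg_fneg_cnv\<close> evaluated at the unit vector.\<close>

lemma cop_antipode1: "(\<Sum>b c d. hcomul H a b c * hanti H c d * hmul H d b e) = hcounit H a * hunit H e"
proof -
  have "(\<Sum>k. ent (cnv (hcomul H) (rreg H) (fneg H) a) e k * hunit H k)
     = (\<Sum>b c d. hcomul H a b c * hanti H c d * (\<Sum>k. ent (rreg H b * rreg H d) e k * hunit H k))"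
    by (simp add: cnv_def fneg_eq antip_def sum_distribs ent_sum ent_scl, simp only: sum_nested,
      rule sum_permute[of "\<lambda>(k,b,c,d). (b,c,d,k)"]) (auto simp: ac_simps)
  moreover have "(\<Sum>k. ent (scl (hcounit H a) 1) e k * hunit H k) = (\<Sum>k. bas e k * (hcounit H a * hunit H k))"
    by (rule sum.cong) (auto simp: ent_simps bas_def)
  ultimately show ?thesis by (simp only: rreg_rreg rreg_fneg_cnv sum_bas)
qed

end

lemma (in inv_hopf) cop_antipode:
  "(\<Sum>b c d. hcomul H a b c * hanti H c d * hmul H d b e) = hcounit H a * hunit H e"
  "(\<Sum>b c d. hcomul H a b c * hanti H b d * hmul H c d e) = hcounit H a * hunit H e"
proof -
  show "(\<Sum>b c d. hcomul H a b c * hanti H c d * hmul H d b e) = hcounit H a * hunit H e"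
    by (rule cop_antipode1)
  have "(\<Sum>b c d. hcomul H a b c * hanti H b d * hmul H c d e) = (\<Sum>c d b. hmul H c d e * hanti H b d * hcomul H a b c)"
    by (simp only: sum_nested, rule sum_permute[of "\<lambda>(b,c,d). (c,d,b)"]) (auto simp: ac_simps)
  also have "\<dots> = hcounit H a * hunit H e"
    using inv_hopf.cop_antipode1[OF dual_inv, of e a] by (simp only: dual_simps mult.commute[of "hunit H e"])
  finally show "(\<Sum>b c d. hcomul H a b c * hanti H b d * hmul H c d e) = hcounit H a * hunit H e" .
qed

section \<open>The Heisenberg double as a matrix algebra\<close>

definition lincomb :: "('c::finite \<Rightarrow> ('n::finite, 'k::comm_ring_1) sqm) \<Rightarrow> ('c \<Rightarrow> 'k) \<Rightarrow> ('n, 'k) sqm" where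
  "lincomb B x = (\<Sum>p. scl (x p) (B p))"

lemma lincomb_bas [simp]: "lincomb B (bas a) = B a"
  by (simp add: lincomb_def)

lemma lincomb_bil:
  assumes "alg_fam M u B"
  shows "lincomb B (bil M x y) = lincomb B x * lincomb B y"
proof -
  have "lincomb B x * lincomb B y = (\<Sum>p q r. scl (x p * y q * M p q r) (B r))"
    using assms by (simp add: lincomb_def sum_distribs alg_fam_def scl_sum, subst sum.swap)
      (simp add: ac_simps)
  also have "\<dots> = (\<Sum>r p q. scl (x p * y q * M p q r) (B r))"
    unfolding sum_nested
    by (rule sum_permute[of "\<lambda>(p,q,r). (r,p,q)"]) auto
  finally show ?thesis by (simp add: lincomb_def bil_def sum_scl)
qed

lemma lincomb_unit: "alg_fam M u B \<Longrightarrow> lincomb B u = 1"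
  by (simp add: alg_fam_def lincomb_def)

lemma lincomb_scale: "lincomb B (\<lambda>i. c * x i) = scl c (lincomb B x)"
  by (simp add: lincomb_def scl_sum)

lemma lincomb_sum: "lincomb B (\<lambda>i. \<Sum>s\<in>S. x s i) = (\<Sum>s\<in>S. lincomb B (x s))"
  by (simp add: lincomb_def sum_scl) (rule sum.swap)

definition algebra :: "('c::finite \<Rightarrow> 'c \<Rightarrow> 'c \<Rightarrow> 'k::comm_ring_1) \<Rightarrow> ('c \<Rightarrow> 'k) \<Rightarrow> bool" where
  "algebra M u \<longleftrightarrow>
     (\<forall>a b c e. (\<Sum>d. M a b d * M d c e) = (\<Sum>d. M b c d * M a d e)) \<and>
     (\<forall>a b. (\<Sum>c. u c * M c a b) = bas a b) \<and>
     (\<forall>a b. (\<Sum>c. u c * M a c b) = bas a b)"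

lemma lincomb_product: "lincomb A x * lincomb B y = (\<Sum>a b. scl (x a * y b) (A a * B b))"
  by (simp only: lincomb_def sum_distrib_right) (simp add: sum_distrib_left mult.commute)

lemma bil_bas_right: "bil M x (bas b) c = (\<Sum>a. x a * M a b c)"
proof -
  have "bil M x (bas b) c = (\<Sum>a. x a * (\<Sum>b'. bas b b' * M a b' c))"
    by (simp only: bil_def sum_distrib_left mult.assoc)
  then show ?thesis by simp
qed

lemma bil_bas_left: "bil M (bas a) y c = (\<Sum>b. y b * M a b c)"
proof -
  have "bil M (bas a) y c = (\<Sum>a'. bas a a' * (\<Sum>b. y b * M a' b c))"
    by (simp only: bil_def sum_distrib_left mult.assoc)
  then show ?thesis by simp
qed

lemma bil_bas: "bil M (bas a) (bas b) = M a b"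
  by (rule ext) (simp add: bil_bas_left)

definition hbas :: "('i::finite, 'k::comm_ring_1) hopf \<Rightarrow> 'i \<times> 'i \<Rightarrow> ('i, 'k) sqm" where
  "hbas H = (\<lambda>(a, b). lreg H a * lact H b)"

text \<open>The inverse of the isomorphism from \<open>H(H)\<close> to \<open>End(H)\<close>:
  \<open>T \<mapsto> \<Sum>\<^sub>k T(k\<^sub>(\<^sub>2\<^sub>)) S(k\<^sub>(\<^sub>1\<^sub>)) \<otimes> \<alpha>\<^sup>k\<close>.\<close>

definition hh_of :: "('i::finite, 'k::comm_ring_1) hopf \<Rightarrow> ('i, 'k) sqm \<Rightarrow> 'i \<times> 'i \<Rightarrow> 'k" where
  "hh_of H T = (\<lambda>(c, d). \<Sum>k1 k2 m s. hcomul H d k1 k2 * ent T m k2 * hanti H k1 s * hmul H m s c)"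

text \<open>Left multiplication by T(x_k), so that T(x_k) can be multiplied inside the matrix
  ring.\<close>

definition colv :: "('i::finite, 'k::comm_ring_1) hopf \<Rightarrow> ('i, 'k) sqm \<Rightarrow> 'i \<Rightarrow> ('i, 'k) sqm" where
  "colv H T k = (\<Sum>m. scl (ent T m k) (lreg H m))"

lemma outer_mult:
  "T * outer u v = outer (\<lambda>m. \<Sum>l. ent T m l * u l) v"
  "outer u v * T = outer u (\<lambda>k. \<Sum>l. v l * ent T l k)"
  by (rule ent_inject'; simp add: ent_simps outer_def sum_distribs ac_simps)+

context inv_hopf
begin

text \<open>The skew counterparts of \<open>antip_cnv\<close>. Conjugation by a vertex holonomy has
  S(z_(2)) on the left and z_(1) on the right, and needs exactly these.\<close>

lemma antip_cop:
  assumes p: "alg_hom H p"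
  shows "(\<Sum>b c. scl (hcomul H a b c) (antip H p c * p b)) = scl (hcounit H a) 1"
    "(\<Sum>b c. scl (hcomul H a b c) (p c * antip H p b)) = scl (hcounit H a) 1"
proof -
  have swap: "(\<Sum>b c d. f c b * hanti H b d * g d c) = (\<Sum>b c d. f b c * hanti H c d * g d b)"
    for f g :: "'i \<Rightarrow> 'i \<Rightarrow> 'k" by (rule sum.swap)
  show "(\<Sum>b c. scl (hcomul H a b c) (antip H p c * p b)) = scl (hcounit H a) 1"
    by (subst sum.swap) (simp only: antip_sum[OF p] swap cop_antipode alg_hom_scaled_unit[OF p])
  show "(\<Sum>b c. scl (hcomul H a b c) (p c * antip H p b)) = scl (hcounit H a) 1"
    by (subst sum.swap) (simp only: antip_sum[OF p] swap[symmetric] cop_antipode alg_hom_scaled_unit[OF p])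
qed

lemma lreg_outer: "lreg H a * outer (hunit H) v = outer (bas a) v" "lreg H i * outer (bas a) v = outer (hmul H i a) v"
  by (simp_all add: outer_mult lreg_def ent_Mat hopf_unit[OF H] mult.commute[of _ "hunit H _"] fun_eq_iff)

lemma outer_lact: "outer u (hcounit H) * lact H i = outer u (bas i)" "outer u (bas q) * lact H i = outer u (\<lambda>k. hcomul H k q i)"
  by (simp_all add: outer_mult lact_def ent_Mat hopf_counit[OF H] bas_commute[of _ i])

lemma sum_outer:
  "(\<Sum>i. outer (hmul H i a) (bas i)) = rreg H a"
  "(\<Sum>i. outer (bas i) (\<lambda>k. hcomul H k q i)) = ract H q"
  by (rule ent_inject'; simp add: ent_simps outer_def rreg_def ract_def)+

text \<open>On vectors, k -> S(k_(2)) k_(1) = eps(k) 1. This rank one operator is what collapses the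
  double sums in the holonomies of l(e) and lbar(e).\<close>

lemma sum_pant_lreg_lact: "(\<Sum>j. antip H (lreg H) j * lact H j) = outer (hunit H) (hcounit H)"
proof (rule ent_inject')
  fix m k
  have "ent (\<Sum>j. antip H (lreg H) j * lact H j) m k
    = (\<Sum>b c d. hcomul H k b c * hanti H c d * hmul H d b m)"
    by (simp add: ent_simps antip_def lreg_def lact_def sum_distribs, simp only: sum_nested,
      rule sum_permute[of "\<lambda>(c,d,b). (b,c,d)"]) (auto simp: ac_simps)
  then show "ent (\<Sum>j. antip H (lreg H) j * lact H j) m k = ent (outer (hunit H) (hcounit H)) m k"
    by (simp add: cop_antipode outer_def ent_Mat)
qed

text \<open>The Heisenberg product is the exchange relation \<open>arriving_lreg_lact\<close> read
  as a rule for moving lact past lreg.\<close>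

lemma hbas_mult: "hbas H p * hbas H q = (\<Sum>r. scl (HHmul H p q r) (hbas H r))"
proof (cases p; cases q)
  fix a b a' b' assume [simp]: "p = (a, b)" "q = (a', b')"
  have "lact H b * lreg H a' = (\<Sum>c1 b1 b2. scl (hcomul H a' c1 b1 * hmul H b1 b2 b) (lreg H c1 * lact H b2))"
    using arriving_lreg_lact[OF H] by (simp add: arriving_def)
  then have "lact H b * (lreg H a' * lact H b') = (\<Sum>c1 b1 b2. scl (hcomul H a' c1 b1 * hmul H b1 b2 b) (lreg H c1 * (lact H b2 * lact H b')))"
    by (simp add: mult.assoc[symmetric] sum_distrib_right)
  then have "hbas H p * hbas H q = (\<Sum>c1 b1 b2. scl (hcomul H a' c1 b1 * hmul H b1 b2 b) ((lreg H a * lreg H c1) * (lact H b2 * lact H b')))"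
    by (simp add: hbas_def mult.assoc sum_distrib_left)
  also have "\<dots> = (\<Sum>r. scl (HHmul H p q r) (hbas H r))"
    by (simp add: alg_hom_mult[OF lreg_hom[OF H]] alg_hom_mult[OF lact_hom[OF H]] sum_pair HHmul_def hbas_def
        sum_distribs scl_sum sum_scl, simp only: sum_nested,
      rule sum_permute[of "\<lambda>(c1,b1,b2,d,g). (g,d,b1,b2,c1)"]) (auto simp: ac_simps)
  finally show ?thesis .
qed

lemma hbas_unit: "(\<Sum>r. scl (DDunit H r) (hbas H r)) = 1"
proof -
  have "(\<Sum>r. scl (DDunit H r) (hbas H r)) = lincomb (lreg H) (hunit H) * lincomb (lact H) (hcounit H)"
    by (simp add: sum_pair DDunit_def hbas_def lincomb_product)
  then show ?thesis using alg_hom_unit[OF lreg_hom[OF H]] alg_hom_unit[OF lact_hom[OF H]] by (simp add: lincomb_def)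
qed

lemma hbas_fam: "alg_fam (HHmul H) (DDunit H) (hbas H)"
  unfolding alg_fam_def using hbas_mult hbas_unit by blast

lemma hh_of_lreg: "(\<Sum>c. scl (hh_of H T (c, d)) (lreg H c)) =
    (\<Sum>k1 k2. scl (hcomul H d k1 k2) (colv H T k2 * antip H (lreg H) k1))"
  by (simp add: hh_of_def colv_def antip_def sum_distribs scl_sum sum_scl alg_hom_mult[OF lreg_hom[OF H]],
      simp only: sum_nested,
      rule sum_permute[of "\<lambda>(c,k1,k2,m,s). (k1,k2,s,m,c)"]) (auto simp: ac_simps)

text \<open>For T = h alpha the formula of \<open>hh_of\<close> contains k_(2) S(k_(1)), which
  collapses to the counit by the skew antipode law.\<close>

lemma hh_of_hbas: "hh_of H (hbas H p) = bas p"
proof (rule ext)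
  fix q show "hh_of H (hbas H p) q = bas p q"
  proof (cases p; cases q)
    fix a b c d assume [simp]: "p = (a, b)" "q = (c, d)"
    have col: "colv H (hbas H p) k = lreg H a * (\<Sum>l. scl (hcomul H k l b) (lreg H l))" for k
    proof -
      have "colv H (hbas H p) k = (\<Sum>m l. scl (hcomul H k l b * hmul H a l m) (lreg H m))"
        by (simp add: colv_def hbas_def ent_times sum_scl) (simp add: lreg_def lact_def ent_Mat mult.commute)
      also have "\<dots> = (\<Sum>l. scl (hcomul H k l b) (lreg H a * lreg H l))"
        by (subst sum.swap) (simp add: alg_hom_mult[OF lreg_hom[OF H]] scl_sum)
      finally show ?thesis by (simp add: sum_distrib_left)
    qed
    have "(\<Sum>c. scl (hh_of H (hbas H p) (c, d)) (lreg H c)) =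
      lreg H a * (\<Sum>k1 l k2. scl (hcomul H d k1 k2 * hcomul H k2 l b) (lreg H l * antip H (lreg H) k1))"
      unfolding hh_of_lreg col
      by (simp add: sum_distribs scl_sum mult.assoc, simp only: sum_nested,
      rule sum_permute[of "\<lambda>(k1,k2,l). (k1,l,k2)"]) (auto simp: ac_simps)
    also have "\<dots> = lreg H a * (\<Sum>k1 l u. scl (hcomul H d u b * hcomul H u k1 l) (lreg H l * antip H (lreg H) k1))"
      by (simp only: sum_scl[symmetric] hopf_coassoc[OF H])
    also have "\<dots> = lreg H a * (\<Sum>u. scl (hcomul H d u b) (\<Sum>k1 l. scl (hcomul H u k1 l) (lreg H l * antip H (lreg H) k1)))"
      by (simp add: scl_sum, simp only: sum_nested,
         rule arg_cong[where f="\<lambda>x. lreg H a * x"],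
      rule sum_permute[of "\<lambda>(k1,l,u). (u,k1,l)"]) auto
    also have "\<dots> = lreg H a * (\<Sum>u. scl (hcounit H u * hcomul H d u b) 1)"
      unfolding antip_cop(2)[OF lreg_hom[OF H]] by (simp add: mult.commute)
    also have "\<dots> = scl (bas d b) (lreg H a)"
      by (simp add: sum_scl[symmetric] hopf_counit[OF H])
    also have "\<dots> = (\<Sum>c. scl (bas d b * bas a c) (lreg H c))"
      by (simp add: scl_sum[symmetric] flip: scl_simps(4))
    finally have "hh_of H (hbas H p) (c, d) = bas d b * bas a c"
      by (rule lreg_inject[OF H])
    then show ?thesis by (simp add: bas_def)
  qed
qed

lemma hh_of_lc: "hh_of H (lincomb B x) = (\<lambda>q. \<Sum>p. x p * hh_of H (B p) q)"
proof (rule ext)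
  fix q
  show "hh_of H (lincomb B x) q = (\<Sum>p. x p * hh_of H (B p) q)"
  proof (cases q)
    case (Pair c d)
    show ?thesis
      by (simp add: Pair hh_of_def lincomb_def ent_sum ent_scl sum_distribs, simp only: sum_nested,
      rule sum_permute[of "\<lambda>(k1,k2,m,s,p). (p,k1,k2,m,s)"]) (auto simp: ac_simps)
  qed
qed

lemma hh_of_phi: "hh_of H (lincomb (hbas H) x) = x"
  unfolding hh_of_lc hh_of_hbas by simp

lemma phi_inject: "lincomb (hbas H) x = lincomb (hbas H) y \<Longrightarrow> x = y"
  by (metis hh_of_phi)

text \<open>The operators formed from S(k_(1)) and the dual basis add up, by E, to the rank one map
  x -> <alpha^k2, x> 1. Multiplying each on the left by T(x_k2) and summing reassembles T.\<close>

lemma phi_psi: "lincomb (hbas H) (hh_of H T) = T"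
proof -
  have E: "(\<Sum>d k1. scl (hcomul H d k1 k2) (antip H (lreg H) k1 * lact H d)) = outer (hunit H) (bas k2)" for k2
  proof (rule ent_inject')
    fix m k
    have "ent (\<Sum>d k1. scl (hcomul H d k1 k2) (antip H (lreg H) k1 * lact H d)) m k
      = (\<Sum>k1 l s. hanti H k1 s * hmul H s l m * (\<Sum>d. hcomul H k l d * hcomul H d k1 k2))"
      by (simp add: ent_simps antip_def lreg_def lact_def sum_distribs, simp only: sum_nested,
      rule sum_permute[of "\<lambda>(d,k1,s,l). (k1,l,s,d)"]) (auto simp: ac_simps)
    also have "\<dots> = (\<Sum>k1 l s. hanti H k1 s * hmul H s l m * (\<Sum>u. hcomul H k u k2 * hcomul H u l k1))"
      by (simp only: hopf_coassoc[OF H])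
    also have "\<dots> = (\<Sum>u. hcomul H k u k2 * (\<Sum>l k1 s. hcomul H u l k1 * hanti H k1 s * hmul H s l m))"
      by (simp add: sum_distribs, simp only: sum_nested,
      rule sum_permute[of "\<lambda>(k1,l,s,u). (u,l,k1,s)"]) (auto simp: ac_simps)
    also have "\<dots> = hunit H m * (\<Sum>u. hcounit H u * hcomul H k u k2)"
      by (simp only: cop_antipode) (simp add: sum_distrib_left ac_simps)
    finally show "ent (\<Sum>d k1. scl (hcomul H d k1 k2) (antip H (lreg H) k1 * lact H d)) m k
        = ent (outer (hunit H) (bas k2)) m k"
      by (simp add: hopf_counit[OF H] outer_def ent_Mat bas_commute)
  qed
  have "lincomb (hbas H) (hh_of H T) = (\<Sum>d. (\<Sum>c. scl (hh_of H T (c, d)) (lreg H c)) * lact H d)"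
    by (simp add: lincomb_def sum_pair hbas_def sum_distrib_right) (rule sum.swap)
  also have "\<dots> = (\<Sum>k2. colv H T k2 * (\<Sum>d k1. scl (hcomul H d k1 k2) (antip H (lreg H) k1 * lact H d)))"
    unfolding hh_of_lreg
    by (simp add: sum_distribs mult.assoc, simp only: sum_nested,
      rule sum_permute[of "\<lambda>(d,k1,k2). (k2,d,k1)"]) auto
  also have "\<dots> = (\<Sum>k2 m. scl (ent T m k2) (outer (bas m) (bas k2)))"
    unfolding E by (simp add: colv_def sum_distrib_right lreg_outer)
  also have "\<dots> = T"
    by (rule ent_inject') (simp add: ent_simps outer_def sum_distrib_right[symmetric] mult.assoc[symmetric])
  finally show ?thesis .
qed

lemma hh_of_mult: "hh_of H (T * T') = bil (HHmul H) (hh_of H T) (hh_of H T')"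
  by (rule phi_inject) (simp add: phi_psi lincomb_bil[OF hbas_fam])

lemma hh_of_one: "hh_of H 1 = DDunit H"
  by (rule phi_inject) (simp add: phi_psi lincomb_unit[OF hbas_fam])

text \<open>Pulled back from the matrix ring along the injective map
  \<open>lincomb (hbas H)\<close>, which avoids a computation with structure constants.\<close>

lemma HH_algebra: "algebra (HHmul H) (DDunit H)"
  unfolding algebra_def
proof (intro conjI allI)
  let ?M = "HHmul H" and ?u = "DDunit H"
  fix a b c e
  have "bil ?M (bil ?M (bas a) (bas b)) (bas c) = bil ?M (bas a) (bil ?M (bas b) (bas c))"
    by (rule phi_inject) (simp only: lincomb_bil[OF hbas_fam] mult.assoc)
  from fun_cong[OF this, of e] show "(\<Sum>d. ?M a b d * ?M d c e) = (\<Sum>d. ?M b c d * ?M a d e)"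
    unfolding bil_bas by (simp only: bil_bas_left bil_bas_right)
  have "bil ?M ?u (bas a) = bas a" "bil ?M (bas a) ?u = bas a"
    by (rule phi_inject, simp only: lincomb_bil[OF hbas_fam] lincomb_unit[OF hbas_fam], simp)+
  from this[THEN fun_cong, of b] show "(\<Sum>c. ?u c * ?M c a b) = bas a b" "(\<Sum>c. ?u c * ?M a c b) = bas a b"
    by (simp_all only: bil_bas_left bil_bas_right)
qed

end

text \<open>The factors in \<open>H(H)\<close> of the holonomies of \<open>rbar(e)\<close>, \<open>lbar(e)\<^sup>-\<^sup>1\<close> at \<open>z \<otimes> 1\<close> (\<open>hh_fp\<close>, \<open>hh_fm\<close>) and of
  \<open>r(e)\<close>, \<open>l(e)\<^sup>-\<^sup>1\<close> at \<open>1 \<otimes> \<gamma>\<close> (\<open>hh_gp\<close>, \<open>hh_gm\<close>).\<close>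

definition hh_fp :: "('i, 'k::comm_ring_1) hopf \<Rightarrow> 'i \<Rightarrow> 'i \<times> 'i \<Rightarrow> 'k" where
  "hh_fp H z = (\<lambda>(c, d). bas z c * hcounit H d)"
definition hh_gp :: "('i, 'k::comm_ring_1) hopf \<Rightarrow> 'i \<Rightarrow> 'i \<times> 'i \<Rightarrow> 'k" where
  "hh_gp H b = (\<lambda>(c, d). hunit H c * bas b d)"
definition hh_fm :: "('i::finite, 'k::comm_ring_1) hopf \<Rightarrow> 'i \<Rightarrow> 'i \<times> 'i \<Rightarrow> 'k" where
  "hh_fm H z = (\<lambda>(c, d). \<Sum>a. hanti H z a * (\<Sum>i j p f. hmul H i a f * hanti H j p * hmul H f p c * hcomul H d j i))"
definition hh_gm :: "('i::finite, 'k::comm_ring_1) hopf \<Rightarrow> 'i \<Rightarrow> 'i \<times> 'i \<Rightarrow> 'k" where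
  "hh_gm H b = (\<lambda>(c, d). \<Sum>a. hanti H a b * (\<Sum>i j p q. hanti H j p * hmul H i p c * hcomul H q j a * hcomul H d q i))"

context inv_hopf
begin

lemma phi_fp: "lincomb (hbas H) (hh_fp H z) = lreg H z"
proof -
  have "lincomb (hbas H) (hh_fp H z) = lincomb (lreg H) (bas z) * lincomb (lact H) (hcounit H)"
    unfolding lincomb_product by (simp add: lincomb_def hh_fp_def sum_pair hbas_def)
  then show ?thesis using alg_hom_unit[OF lact_hom[OF H]] by (simp add: lincomb_def)
qed

lemma phi_gp: "lincomb (hbas H) (hh_gp H b) = lact H b"
proof -
  have "lincomb (hbas H) (hh_gp H b) = lincomb (lreg H) (hunit H) * lincomb (lact H) (bas b)"
    unfolding lincomb_product by (simp add: lincomb_def hh_gp_def sum_pair hbas_def)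
  then show ?thesis using alg_hom_unit[OF lreg_hom[OF H]] by (simp add: lincomb_def)
qed

text \<open>Let E be the rank one operator of \<open>sum_pant_lreg_lact\<close>. The holonomy of
  lbar(e) at h is sum_i x_i h E alpha^i, which is right multiplication by h because E =
  \<open>outer\<close> of 1 and eps; inverting the path puts h = S(z).\<close>

lemma phi_fm: "lincomb (hbas H) (hh_fm H z) = fneg H z"
proof -
  have key: "lreg H i * (lreg H a * (lreg H p * (lact H j * lact H i)))
     = (\<Sum>f c d. scl (hmul H i a f * hmul H f p c * hcomul H d j i) (lreg H c * lact H d))" for a i j p
    unfolding mult.assoc[symmetric, of "lreg H i"] mult.assoc[symmetric, of _ "lreg H p"] alg_hom_mult[OF lact_hom[OF H]]
    by (simp add: alg_hom_mult[OF lreg_hom[OF H]] sum_distribs scl_sum, simp only: sum_nested,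
      rule sum_permute[of "\<lambda>(d,f,c). (f,c,d)"]) (auto simp: ac_simps)
  have "fneg H z = (\<Sum>a. scl (hanti H z a) (\<Sum>i. lreg H i * (lreg H a * ((\<Sum>j. antip H (lreg H) j * lact H j) * lact H i))))"
    unfolding sum_pant_lreg_lact outer_lact lreg_outer sum_outer fneg_eq antip_def[of H "rreg H"] ..
  also have "\<dots> = (\<Sum>a i j p. scl (hanti H z a * hanti H j p) (lreg H i * (lreg H a * (lreg H p * (lact H j * lact H i)))))"
    by (simp add: antip_def sum_distribs scl_sum mult.assoc)
  also have "\<dots> = lincomb (hbas H) (hh_fm H z)"
    unfolding key
    by (simp add: lincomb_def hh_fm_def sum_pair hbas_def sum_distrib_left scl_sum sum_scl, simp only: sum_nested,
      rule sum_permute[of "\<lambda>(a,i,j,p,f,c,d). (c,d,a,i,j,p,f)"]) (auto simp: ac_simps)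
  finally show ?thesis by simp
qed

lemma phi_gm: "lincomb (hbas H) (hh_gm H b) = gneg H b"
proof -
  have key: "lreg H i * (lreg H p * (lact H j * (lact H a * lact H i)))
     = (\<Sum>q c d. scl (hmul H i p c * hcomul H q j a * hcomul H d q i) (lreg H c * lact H d))" for a i j p
    unfolding mult.assoc[symmetric, of "lreg H i"] mult.assoc[symmetric, of "lact H j"] alg_hom_mult[OF lreg_hom[OF H]]
    by (simp add: alg_hom_mult[OF lact_hom[OF H]] sum_distribs scl_sum, simp only: sum_nested,
      rule sum_permute[of "\<lambda>(q,d,c). (q,c,d)"]) (auto simp: ac_simps)
  have "gneg H b = (\<Sum>a. scl (hanti H a b) (\<Sum>i. lreg H i * ((\<Sum>j. antip H (lreg H) j * lact H j) * (lact H a) * lact H i)))"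
    unfolding sum_pant_lreg_lact outer_lact lreg_outer sum_outer gneg_eq antip_def[of "dual H"] dual_simps ..
  also have "\<dots> = (\<Sum>a i j p. scl (hanti H a b * hanti H j p) (lreg H i * (lreg H p * (lact H j * (lact H a * lact H i)))))"
    by (simp add: antip_def sum_distribs scl_sum mult.assoc)
  also have "\<dots> = lincomb (hbas H) (hh_gm H b)"
    unfolding key
    by (simp add: lincomb_def hh_gm_def sum_pair hbas_def sum_distrib_left scl_sum sum_scl, simp only: sum_nested,
      rule sum_permute[of "\<lambda>(a,i,j,p,f,c,d). (c,d,a,i,j,p,f)"]) (auto simp: ac_simps)
  finally show ?thesis by simp
qed

lemma hh_of_edge: "hh_of H (lreg H z) = hh_fp H z" "hh_of H (lact H z) = hh_gp H z"
  "hh_of H (fneg H z) = hh_fm H z" "hh_of H (gneg H z) = hh_gm H z"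
  by (simp_all only: hh_of_phi flip: phi_fp phi_gp phi_fm phi_gm)

end

section \<open>Tensor powers\<close>

lemma prod_sum_UNIV:
  fixes f :: "'x::finite \<Rightarrow> 'd::finite \<Rightarrow> 'k::comm_semiring_1"
  shows "(\<Prod>x\<in>UNIV. \<Sum>d. f x d) = (\<Sum>F. \<Prod>x\<in>UNIV. f x (F x))"
  using prod_sum_PiE[of "UNIV :: 'x set" "\<lambda>_. UNIV :: 'd set" f] by simp

lemma prod_bas: "(\<Prod>x\<in>UNIV. bas (a x) (b x)) = (bas a b :: 'k::comm_ring_1)" for a b :: "'x::finite \<Rightarrow> 'd"
proof (cases "a = b")
  case False
  then obtain x where "a x \<noteq> b x" by auto
  then have "(\<Prod>x\<in>UNIV. bas (a x) (b x)) = (0 :: 'k)"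
    by (intro prod_zero) (auto simp: bas_def intro!: exI[of _ x])
  then show ?thesis using False by (simp add: bas_def)
qed (simp add: bas_def)

lemma algebra_assoc: "algebra M u \<Longrightarrow> (\<Sum>d. M a b d * M d c e) = (\<Sum>d. M b c d * M a d e)"
  unfolding algebra_def by blast

lemma algebra_unit:
  assumes "algebra M u"
  shows "(\<Sum>c. u c * M c a b) = bas a b" "(\<Sum>c. u c * M a c b) = bas a b"
  using assms unfolding algebra_def by blast+

lemma tpow_algebra:
  assumes "algebra M u"
  shows "algebra (tpow3 M) (tpow1 u)"
  unfolding algebra_def
proof (intro conjI allI)
  fix a b c e :: "'x::finite \<Rightarrow> 'a"
  show "(\<Sum>d. tpow3 M a b d * tpow3 M d c e) = (\<Sum>d. tpow3 M b c d * tpow3 M a d e)"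
    unfolding tpow3_def prod.distrib[symmetric]
      prod_sum_UNIV[of "\<lambda>x d. M (a x) (b x) d * M d (c x) (e x)", symmetric]
      prod_sum_UNIV[of "\<lambda>x d. M (b x) (c x) d * M (a x) d (e x)", symmetric]
    by (intro prod.cong refl algebra_assoc[OF assms])
  show "(\<Sum>c. tpow1 u c * tpow3 M c a b) = bas a b" "(\<Sum>c. tpow1 u c * tpow3 M a c b) = bas a b"
    unfolding tpow3_def tpow1_def prod.distrib[symmetric]
      prod_sum_UNIV[of "\<lambda>x d. u d * M d (a x) (b x)", symmetric]
      prod_sum_UNIV[of "\<lambda>x d. u d * M (a x) d (b x)", symmetric]
    by (simp_all only: algebra_unit[OF assms] prod_bas)
qed

text \<open>Here the rows are the arguments, contrary to \<open>lreg\<close>: row vectors are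
  multiplied by matrices from the right, so a product of matrices is applied from left to right, as
  a right action requires.\<close>

definition rmul :: "('c::finite \<Rightarrow> 'c \<Rightarrow> 'c \<Rightarrow> 'k::comm_ring_1) \<Rightarrow> 'c \<Rightarrow> ('c, 'k) sqm" where
  "rmul M K = Mat (\<lambda>G F. M G K F)"
definition lmul :: "('c::finite \<Rightarrow> 'c \<Rightarrow> 'c \<Rightarrow> 'k::comm_ring_1) \<Rightarrow> 'c \<Rightarrow> ('c, 'k) sqm" where
  "lmul M K = Mat (\<lambda>G F. M K G F)"

lemma rmul_fam:
  assumes "algebra M u"
  shows "alg_fam M u (rmul M)"
  unfolding alg_fam_def
proof (intro conjI allI)
  fix a b
  show "rmul M a * rmul M b = (\<Sum>c. scl (M a b c) (rmul M c))"
  proof (rule ent_inject')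
    fix i j show "ent (rmul M a * rmul M b) i j = ent (\<Sum>c. scl (M a b c) (rmul M c)) i j"
      using algebra_assoc[OF assms, of i a b j] by (simp add: ent_times ent_sum ent_scl rmul_def ent_Mat)
  qed
  show "(\<Sum>c. scl (u c) (rmul M c)) = 1"
    by (rule ent_inject') (simp add: ent_simps rmul_def algebra_unit[OF assms], simp add: bas_def)
qed

lemma lmul_fam:
  assumes "algebra M u"
  shows "alg_fam (\<lambda>a b. M b a) u (lmul M)"
  unfolding alg_fam_def
proof (intro conjI allI)
  fix a b
  show "lmul M a * lmul M b = (\<Sum>c. scl (M b a c) (lmul M c))"
  proof (rule ent_inject')
    fix i j show "ent (lmul M a * lmul M b) i j = ent (\<Sum>c. scl (M b a c) (lmul M c)) i j"
      using algebra_assoc[OF assms, of b a i j] by (simp add: ent_times ent_sum ent_scl lmul_def ent_Mat mult.commute)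
  qed
  show "(\<Sum>c. scl (u c) (lmul M c)) = 1"
    by (rule ent_inject') (simp add: ent_simps lmul_def algebra_unit[OF assms], simp add: bas_def)
qed

lemma rmul_lmul_comm:
  assumes "algebra M u"
  shows "rmul M a * lmul M b = lmul M b * rmul M a"
proof (rule ent_inject')
  fix i j show "ent (rmul M a * lmul M b) i j = ent (lmul M b * rmul M a) i j"
    using algebra_assoc[OF assms, of b i a j] by (simp add: ent_times lmul_def rmul_def ent_Mat mult.commute)
qed

abbreviation Rm where "Rm M \<equiv> lincomb (rmul M)"
abbreviation Lm where "Lm M \<equiv> lincomb (lmul M)"

lemma bil_flip: "bil (\<lambda>a b. M b a) x y = bil M y x"
  by (rule ext) (simp add: bil_def, subst sum.swap, simp add: mult.commute)

lemma Rm_bil: "algebra M u \<Longrightarrow> Rm M (bil M x y) = Rm M x * Rm M y"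
  by (rule lincomb_bil[OF rmul_fam])

lemma Lm_bil:
  assumes "algebra M u"
  shows "Lm M (bil M x y) = Lm M y * Lm M x"
  using lincomb_bil[OF lmul_fam[OF assms], of y x] unfolding bil_flip[of M] .

lemma Rm_Lm_comm:
  assumes "algebra M u"
  shows "Rm M x * Lm M y = Lm M y * Rm M x"
  unfolding lincomb_product rmul_lmul_comm[OF assms] by (subst sum.swap) (simp add: mult.commute)

abbreviation rv :: "('n::finite \<Rightarrow> 'k::comm_ring_1) \<Rightarrow> ('n, 'k) sqm \<Rightarrow> ('n \<Rightarrow> 'k)" where
  "rv X T \<equiv> lin (ent T) X"

lemma rv_Rm: "rv X (Rm M Z) = bil M X Z"
  by (rule ext) (simp add: lin_def bil_def lincomb_def ent_simps rmul_def sum_distrib_left ac_simps)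

lemma rv_Lm: "rv X (Lm M Z) = bil M Z X"
  by (rule ext) (simp add: lin_def bil_def lincomb_def ent_simps lmul_def sum_distrib_left, subst sum.swap, simp add: ac_simps)

lemma rv_mult: "rv X (S * T) = rv (rv X S) T"
  by (rule ext) (simp add: lin_def ent_simps sum_distribs, subst sum.swap, simp add: ac_simps)

lemma rv_one: "rv X 1 = X"
proof
  fix F
  have "rv X 1 F = (\<Sum>a. X a * bas F a)"
    unfolding lin_def by (rule sum.cong) (auto simp: ent_one bas_def)
  then show "rv X 1 F = X F" by simp
qed

lemma rv_sum: "rv X (\<Sum>i\<in>S. T i) F = (\<Sum>i\<in>S. rv X (T i) F)"
  by (simp add: lin_def ent_sum sum_distrib_left) (rule sum.swap)

lemma rv_scl: "rv X (scl c T) F = c * rv X T F"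
  by (simp add: lin_def ent_scl sum_distrib_left ac_simps)

text \<open>Evaluation at the unit. This is how identities between elements are deduced from
  identities between operators.\<close>

lemma Rm_inject:
  assumes "algebra M u" "Rm M x = Rm M y"
  shows "x = y"
proof -
  have "rv u (Rm M x) = x" for x
  proof
    fix F
    have "rv u (Rm M x) F = (\<Sum>b. x b * (\<Sum>a. u a * M a b F))"
      unfolding rv_Rm by (simp add: bil_def sum_distrib_left, subst sum.swap, simp add: ac_simps)
    then show "rv u (Rm M x) F = x F" by (simp add: algebra_unit[OF assms(1)])
  qed
  then show ?thesis using assms(2) by metis
qed

section \<open>Operators and words in single tensor factors\<close>

definition off :: "'x \<Rightarrow> ('x \<Rightarrow> 'b) \<Rightarrow> ('x \<Rightarrow> 'b) \<Rightarrow> 'k::comm_ring_1" where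
  "off e G F = (if \<forall>x. x \<noteq> e \<longrightarrow> G x = F x then 1 else 0)"

lemma off_sym: "off e G F = off e F G"
  unfolding off_def by (intro if_cong) (auto dest: sym)

lemma off_upd [simp]: "off e (G(e := l)) F = off e G F"
  unfolding off_def by (intro if_cong) auto

text \<open>The operator N tensored with the identity in all factors other than e;
  \<open>off\<close> is the Kronecker delta of those factors.\<close>

definition atm :: "'x::finite \<Rightarrow> ('b::finite, 'k::comm_ring_1) sqm \<Rightarrow> ('x \<Rightarrow> 'b, 'k) sqm" where
  "atm e N = Mat (\<lambda>G F. ent N (G e) (F e) * off e G F)"

lemma ent_atm: "ent (atm e N) G F = ent N (G e) (F e) * off e G F"
  by (simp add: atm_def ent_Mat)

lemma sum_off:
  fixes h :: "('x::finite \<Rightarrow> 'b::finite) \<Rightarrow> 'k::comm_ring_1"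
  shows "(\<Sum>L. off e G L * h L) = (\<Sum>l. h (G(e := l)))"
proof -
  have "(\<Sum>L. off e G L * h L) = (\<Sum>L\<in>{L. off e G L = (1 :: 'k)}. h L)"
    by (rule sum.mono_neutral_cong_right) (auto simp: off_def split: if_splits)
  also have "\<dots> = (\<Sum>l. h (G(e := l)))"
    by (rule sum.reindex_bij_witness[of _ "\<lambda>l. G(e := l)" "\<lambda>L. L e"])
      (auto simp: off_def split: if_splits intro!: arg_cong[where f=h])
  finally show ?thesis .
qed

lemma atm_mult: "atm e (A * B) = atm e A * atm e B"
proof (rule ent_inject')
  fix G F :: "'a \<Rightarrow> 'b"
  have "ent (atm e A * atm e B) G F = (\<Sum>L. off e G L * (ent A (G e) (L e) * ent B (L e) (F e) * off e L F))"
    by (simp add: ent_times ent_atm ac_simps)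
  also have "\<dots> = (\<Sum>l. ent A (G e) l * ent B l (F e) * off e G F)"
    unfolding sum_off by simp
  finally show "ent (atm e (A * B)) G F = ent (atm e A * atm e B) G F"
    by (simp add: ent_times ent_atm sum_distrib_right)
qed

lemma atm_one: "atm e 1 = 1"
  by (rule ent_inject') (auto simp: ent_atm off_def ent_simps fun_eq_iff)

lemma atm_scl: "atm e (scl c A) = scl c (atm e A)"
  by (rule ent_inject') (simp add: ent_atm ent_simps)

lemma atm_sum: "atm e (\<Sum>i\<in>S. A i) = (\<Sum>i\<in>S. atm e (A i))"
  by (rule ent_inject') (simp add: ent_atm ent_simps sum_distrib_right)

lemma ent_atm_atm:
  assumes "e \<noteq> e'"
  shows "ent (atm e A * atm e' B) G F = ent A (G e) (F e) * ent B (G e') (F e') * off e' (G(e := F e)) F"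
proof -
  have "ent (atm e A * atm e' B) G F = (\<Sum>L. off e G L * (ent A (G e) (L e) * ent B (L e') (F e') * off e' L F))"
    by (simp add: ent_times ent_atm ac_simps)
  also have "\<dots> = (\<Sum>l. bas (F e) l * (ent A (G e) l * ent B (G e') (F e') * off e' (G(e := l)) F))"
    unfolding sum_off using assms by (intro sum.cong) (auto simp: bas_def off_def)
  finally show ?thesis by simp
qed

lemma atm_comm:
  assumes "e \<noteq> e'"
  shows "atm e A * atm e' B = atm e' B * atm e A"
proof (rule ent_inject')
  fix G F :: "'a \<Rightarrow> 'b"
  have "off e' (G(e := F e)) F = (off e (G(e' := F e')) F :: 'c)"
    unfolding off_def by (intro if_cong) auto
  then show "ent (atm e A * atm e' B) G F = ent (atm e' B * atm e A) G F"
    by (simp add: ent_atm_atm[OF assms] ent_atm_atm[OF assms[symmetric]])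
qed

text \<open>The common ground of \<open>DDmul\<close> and \<open>HHmul\<close>, which share the unit
  \<open>DDunit\<close>.\<close>

definition unital :: "('c::finite \<Rightarrow> 'c \<Rightarrow> 'c \<Rightarrow> 'k::comm_ring_1) \<Rightarrow> ('c \<Rightarrow> 'k) \<Rightarrow> bool" where
  "unital M u \<longleftrightarrow> (\<forall>a b. (\<Sum>c. u c * M c a b) = bas a b) \<and> (\<forall>a b. (\<Sum>c. u c * M a c b) = bas a b)"

lemma algebra_unital: "algebra M u \<Longrightarrow> unital M u"
  unfolding algebra_def unital_def by blast

lemma emb_prod: "emb u e y F = (\<Prod>x\<in>UNIV. ((\<lambda>_. u)(e := y)) x (F x))"
  by (subst prod.remove[of _ e]) (auto simp: emb_def intro!: prod.cong)

lemma Rm_emb: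
  fixes M :: "'b::finite \<Rightarrow> 'b \<Rightarrow> 'b \<Rightarrow> 'k::comm_ring_1"
  assumes "unital M u"
  shows "Rm (tpow3 M) (emb u e y) = atm e (Rm M y)"
proof (rule ent_inject')
  fix G F
  have "ent (Rm (tpow3 M) (emb u e y)) G F = (\<Sum>K. \<Prod>x\<in>UNIV. ((\<lambda>_. u)(e := y)) x (K x) * M (G x) (K x) (F x))"
    by (simp add: lincomb_def ent_sum ent_scl rmul_def ent_Mat tpow3_def emb_prod prod.distrib)
  also have "\<dots> = (\<Prod>x\<in>UNIV. \<Sum>k. ((\<lambda>_. u)(e := y)) x k * M (G x) k (F x))"
    by (rule prod_sum_UNIV[symmetric])
  also have "\<dots> = (\<Sum>k. y k * M (G e) k (F e)) * (\<Prod>x\<in>UNIV - {e}. bas (G x) (F x))"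
    using assms by (subst prod.remove[of _ e]) (auto simp: unital_def intro!: prod.cong)
  also have "(\<Prod>x\<in>UNIV - {e}. bas (G x) (F x)) = (off e G F :: 'k)"
  proof (cases "\<forall>x. x \<noteq> e \<longrightarrow> G x = F x")
    case False
    then obtain x where "x \<noteq> e" "G x \<noteq> F x" by auto
    then have "(\<Prod>x\<in>UNIV - {e}. bas (G x) (F x)) = (0 :: 'k)"
      by (intro prod_zero) (auto simp: bas_def intro!: bexI[of _ x])
    then show ?thesis using False by (simp add: off_def)
  qed (simp add: bas_def off_def)
  finally show "ent (Rm (tpow3 M) (emb u e y)) G F = ent (atm e (Rm M y)) G F"
    by (simp add: ent_atm lincomb_def ent_sum ent_scl rmul_def ent_Mat)
qed

lemma Lm_emb:
  fixes M :: "'b::finite \<Rightarrow> 'b \<Rightarrow> 'b \<Rightarrow> 'k::comm_ring_1"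
  assumes "unital M u"
  shows "Lm (tpow3 M) (emb u e y) = atm e (Lm M y)"
proof -
  have *: "lmul (tpow3 M) = rmul (tpow3 (\<lambda>a b. M b a))" "lmul M = rmul (\<lambda>a b. M b a)"
    by (simp_all add: lmul_def rmul_def tpow3_def fun_eq_iff)
  have "unital (\<lambda>a b. M b a) u" using assms by (simp add: unital_def)
  from Rm_emb[OF this] show ?thesis unfolding * .
qed

lemma rv_atm: "rv X (atm e N) F = (\<Sum>g. X (F(e := g)) * ent N g (F e))"
proof -
  have "rv X (atm e N) F = (\<Sum>L. off e F L * (X L * ent N (L e) (F e)))"
    by (simp add: lin_def ent_atm off_sym[of e F] ac_simps)
  then show ?thesis by (simp add: sum_off)
qed

text \<open>\<open>X\<close> carries the unit \<open>u\<close> in the factor \<open>e\<close>, expressed without division.  On such \<open>X\<close> left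
  multiplication by an element of the factor \<open>e\<close> does not depend on the multiplication, so words in
  distinct edges are the same in \<open>D(H)\<^sup>*\<close> and in \<open>H(H)\<close>.\<close>

definition efree :: "('b \<Rightarrow> 'k::comm_ring_1) \<Rightarrow> 'x \<Rightarrow> (('x \<Rightarrow> 'b) \<Rightarrow> 'k) \<Rightarrow> bool" where
  "efree u e X \<longleftrightarrow> (\<forall>F c. u c * X F = u (F e) * X (F(e := c)))"

text \<open>The right-hand side does not mention M: X at c divided by \<open>u c\<close> is X with
  the unit stripped from the factor e, and y takes the free place.\<close>

lemma bil_emb_efree:
  fixes u :: "'b::finite \<Rightarrow> 'k::field"
  assumes M: "unital M u" and X: "efree u e X" and c: "u c \<noteq> 0"
  shows "bil (tpow3 M) (emb u e y) X F = y (F e) * X (F(e := c)) / u c"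
proof -
  have X': "X (F(e := g)) = u g * (X (F(e := c)) / u c)" for g
  proof -
    have "u g * X (F(e := c)) = u c * X (F(e := g))"
      using X[unfolded efree_def, rule_format, of g "F(e := c)"] by simp
    then show ?thesis using c by (simp add: field_simps)
  qed
  have "bil (tpow3 M) (emb u e y) X F = (\<Sum>g. X (F(e := g)) * ent (Lm M y) g (F e))"
    unfolding rv_Lm[symmetric] Lm_emb[OF M] rv_atm ..
  also have "\<dots> = X (F(e := c)) / u c * (\<Sum>b. y b * (\<Sum>g. u g * M b g (F e)))"
    by (subst X') (simp add: lincomb_def ent_simps lmul_def sum_distrib_left, subst sum.swap, simp add: ac_simps)
  also have "\<dots> = X (F(e := c)) / u c * y (F e)"
    using M by (simp add: unital_def)
  finally show ?thesis by (simp add: mult.commute)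
qed

lemma efree_unit:
  fixes u :: "'b \<Rightarrow> 'k::comm_ring_1" and e :: "'x::finite"
  shows "efree u e (tpow1 u)"
proof -
  have *: "tpow1 u F = u (F e) * (\<Prod>x\<in>UNIV - {e}. u (F x))" for F :: "'x \<Rightarrow> 'b"
    unfolding tpow1_def by (subst prod.remove[of _ e]) auto
  have **: "(\<Prod>x\<in>UNIV - {e}. u ((F(e := c)) x)) = (\<Prod>x\<in>UNIV - {e}. u (F x))" for F :: "'x \<Rightarrow> 'b" and c
    by (intro prod.cong) auto
  show ?thesis unfolding efree_def * ** by simp
qed

lemma efree_lin:
  assumes "\<And>i. i \<in> S \<Longrightarrow> efree u e (X i)"
  shows "efree u e (\<lambda>F. \<Sum>i\<in>S. a i * X i F)"
  unfolding efree_def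
proof (intro allI)
  fix F c
  have "u c * (\<Sum>i\<in>S. a i * X i F) = (\<Sum>i\<in>S. a i * (u c * X i F))"
    by (simp add: sum_distrib_left mult.left_commute)
  also have "\<dots> = (\<Sum>i\<in>S. a i * (u (F e) * X i (F(e := c))))"
  proof (intro sum.cong refl)
    fix i assume "i \<in> S"
    then show "a i * (u c * X i F) = a i * (u (F e) * X i (F(e := c)))"
      using assms unfolding efree_def by metis
  qed
  finally show "u c * (\<Sum>i\<in>S. a i * X i F) = u (F e) * (\<Sum>i\<in>S. a i * X i (F(e := c)))"
    by (simp add: sum_distrib_left mult.left_commute)
qed

lemma efree_bil:
  assumes M: "unital M u" and X: "efree u e X" and ne: "e \<noteq> e'"
  shows "efree u e (bil (tpow3 M) (emb u e' y) X)"
proof -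
  have *: "bil (tpow3 M) (emb u e' y) X = rv X (atm e' (Lm M y))"
    by (simp only: rv_Lm[symmetric] Lm_emb[OF M])
  show ?thesis
    unfolding efree_def *
  proof (intro allI)
    fix F c
    have "u c * X (F(e' := g)) = u (F e) * X (F(e := c, e' := g))" for g
      using X[unfolded efree_def, rule_format, of c "F(e' := g)"] ne by (simp add: fun_upd_twist[OF ne])
    then show "u c * rv X (atm e' (Lm M y)) F = u (F e) * rv X (atm e' (Lm M y)) (F(e := c))"
      using ne by (simp add: rv_atm sum_distrib_left mult.assoc[symmetric])
  qed
qed

lemma bil_lin:
  "bil M (\<lambda>i. c * x i) (\<lambda>i. d * y i) k = c * d * bil M x y k"
  by (simp add: bil_def sum_distrib_left ac_simps)

lemma bil_unit:
  assumes "unital M u"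
  shows "bil M x u = x"
proof
  fix c
  have "bil M x u c = (\<Sum>a. x a * (\<Sum>b. u b * M a b c))"
    by (simp add: bil_def sum_distrib_left ac_simps)
  then show "bil M x u c = x c" using assms by (simp add: unital_def)
qed

context inv_hopf
begin

abbreviation "ME \<equiv> tpow3 (HHmul H)"

lemma ME_algebra: "algebra ME (tpow1 (DDunit H))"
  by (rule tpow_algebra[OF HH_algebra])

text \<open>An algebra map from End(H) to the operators on the whole tensor power; it transports the
  relations found for a single edge.\<close>

definition edge_op :: "'e::finite \<Rightarrow> ('i, 'k) sqm \<Rightarrow> ('e \<Rightarrow> 'i \<times> 'i, 'k) sqm" where
  "edge_op e T = atm e (Rm (HHmul H) (hh_of H T))"

lemma hh_of_sum: "hh_of H (\<Sum>i\<in>S. T i) = (\<lambda>q. \<Sum>i\<in>S. hh_of H (T i) q)"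
  by (rule phi_inject) (simp add: phi_psi lincomb_sum)

lemma hh_of_scl: "hh_of H (scl c T) = (\<lambda>q. c * hh_of H T q)"
  by (rule phi_inject) (simp add: phi_psi lincomb_scale)

lemma edge_op_sum: "edge_op e (\<Sum>i\<in>S. T i) = (\<Sum>i\<in>S. edge_op e (T i))"
  by (simp add: edge_op_def hh_of_sum lincomb_sum atm_sum)

lemma edge_op_scl: "edge_op e (scl c T) = scl c (edge_op e T)"
  by (simp add: edge_op_def hh_of_scl lincomb_scale atm_scl)

lemma edge_op_mult: "edge_op e (S * T) = edge_op e S * edge_op e T"
  by (simp add: edge_op_def hh_of_mult Rm_bil[OF HH_algebra] atm_mult)

lemma edge_op_one: "edge_op e 1 = 1"
  by (simp add: edge_op_def hh_of_one lincomb_unit[OF rmul_fam[OF HH_algebra]] atm_one)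

lemma edge_op_comm: "e \<noteq> e' \<Longrightarrow> edge_op e S * edge_op e' T = edge_op e' T * edge_op e S"
  by (simp add: edge_op_def atm_comm)

lemma edge_op_emb: "Rm ME (emb (DDunit H) e (hh_of H T)) = edge_op e T"
  by (simp add: edge_op_def Rm_emb[OF algebra_unital[OF HH_algebra]])

end

section \<open>Holonomies of vertex and face loops\<close>

lemma emb_scale: "emb u e (\<lambda>x. c * y x) F = c * emb u e y F"
  by (simp add: emb_def mult.assoc)

lemma emb_sum: "emb u e (\<lambda>x. \<Sum>i\<in>S. y i x) F = (\<Sum>i\<in>S. emb u e (y i) F)"
  by (simp add: emb_def sum_distrib_right)

text \<open>The iterated convolution of letters, each an edge with a family of elements for its
  factor. K is H for vertex loops and the dual for face loops; M is a parameter so that D(H)^* and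
  the Heisenberg double can be compared.\<close>

fun wfam :: "('i::finite, 'k::comm_ring_1) hopf \<Rightarrow> ('b::finite \<Rightarrow> 'b \<Rightarrow> 'b \<Rightarrow> 'k) \<Rightarrow> ('b \<Rightarrow> 'k)
    \<Rightarrow> ('e::finite \<times> ('i \<Rightarrow> 'b \<Rightarrow> 'k)) list \<Rightarrow> 'i \<Rightarrow> ('e \<Rightarrow> 'b) \<Rightarrow> 'k" where
  "wfam K M u [] a = (\<lambda>F. hcounit K a * tpow1 u F)"
| "wfam K M u (x # xs) a = (\<lambda>F. \<Sum>a1 a2. hcomul K a a1 a2 *
     bil (tpow3 M) (emb u (fst x) (snd x a1)) (wfam K M u xs a2) F)"

lemma efree_scale: "efree u e X \<Longrightarrow> efree u e (\<lambda>F. a * X F)"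
  using efree_lin[of "{()}" u e "\<lambda>_. X" "\<lambda>_. a"] by simp

lemma efree_sum: "(\<And>i. i \<in> S \<Longrightarrow> efree u e (X i)) \<Longrightarrow> efree u e (\<lambda>F. \<Sum>i\<in>S. X i F)"
  using efree_lin[of S u e X "\<lambda>_. 1"] by simp

lemma wfam_efree:
  assumes M: "unital M u"
  shows "e \<notin> fst ` set xs \<Longrightarrow> efree u e (wfam K M u xs a)"
proof (induction xs arbitrary: a)
  case Nil
  then show ?case by (simp add: efree_scale efree_unit)
next
  case (Cons x xs)
  then have "efree u e (bil (tpow3 M) (emb u (fst x) (snd x a1)) (wfam K M u xs a2))" for a1 a2
    by (intro efree_bil[OF M]) auto
  then show ?case unfolding wfam.simps by (intro efree_sum efree_scale)
qed

text \<open>As the edges are distinct, the rest of the word carries the unit in the factor of its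
  first letter, and \<open>bil_emb_efree\<close> evaluates both products to the same value.\<close>

lemma wfam_indep:
  fixes u :: "'b::finite \<Rightarrow> 'k::field"
  assumes M: "unital M u" "unital M' u" and c: "u c \<noteq> 0"
  shows "distinct (map fst xs) \<Longrightarrow> wfam K M u xs a = wfam K M' u xs a"
proof (induction xs arbitrary: a)
  case (Cons x xs)
  have "bil (tpow3 M) (emb u (fst x) (snd x a1)) (wfam K M u xs a2) F
      = bil (tpow3 M') (emb u (fst x) (snd x a1)) (wfam K M' u xs a2) F" for a1 a2 F
  proof -
    have "efree u (fst x) (wfam K M' u xs a2)"
      using Cons.prems by (intro wfam_efree[OF M(2)]) auto
    with Cons show ?thesis by (simp add: bil_emb_efree[OF M(1) _ c] bil_emb_efree[OF M(2) _ c])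
  qed
  then show ?case by simp
qed simp

definition cword :: "('i::finite, 'k::comm_ring_1) hopf \<Rightarrow> ('i \<Rightarrow> ('n::finite, 'k) sqm) list \<Rightarrow> 'i \<Rightarrow> ('n, 'k) sqm" where
  "cword K ps = foldr (cnv (hcomul K)) ps (\<lambda>a. scl (hcounit K a) 1)"

lemma cword_simps [simp]:
  "cword K [] = (\<lambda>a. scl (hcounit K a) 1)" "cword K (p # ps) = cnv (hcomul K) p (cword K ps)"
  by (simp_all add: cword_def)

lemma Rm_wfam:
  assumes M: "algebra M u"
  shows "Rm (tpow3 M) (wfam K M u xs a) = cword K (map (\<lambda>x a. Rm (tpow3 M) (emb u (fst x) (snd x a))) xs) a"
proof (induction xs arbitrary: a)
  case Nil
  show ?case by (simp add: lincomb_scale lincomb_unit[OF rmul_fam[OF tpow_algebra[OF M]]])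
next
  case (Cons x xs)
  then show ?case
    by (simp add: lincomb_sum lincomb_scale cnv_def Rm_bil[OF tpow_algebra[OF M]])
qed

context inv_hopf
begin

lemma DDmul_unital: "unital (DDmul H) (DDunit H)"
  unfolding unital_def
proof (intro conjI allI)
  fix p q :: "'i \<times> 'i"
  obtain a b c d where [simp]: "p = (a, b)" "q = (c, d)" by (cases p; cases q) auto
  have "(\<Sum>r. DDunit H r * DDmul H r p q) = (\<Sum>i. hunit H i * hmul H a i c) * (\<Sum>j. hcounit H j * hcomul H d j b)"
    by (simp add: sum_pair DDunit_def DDmul_def sum_product mult.assoc mult.left_commute)
  then show "(\<Sum>r. DDunit H r * DDmul H r p q) = bas p q"
    by (simp add: hopf_unit[OF H] hopf_counit[OF H]) (auto simp: bas_def)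
  have "(\<Sum>r. DDunit H r * DDmul H p r q) = (\<Sum>i. hunit H i * hmul H i a c) * (\<Sum>j. hcounit H j * hcomul H d b j)"
    by (simp add: sum_pair DDunit_def DDmul_def sum_product mult.assoc mult.left_commute)
  then show "(\<Sum>r. DDunit H r * DDmul H p r q) = bas p q"
    by (simp add: hopf_unit[OF H] hopf_counit[OF H]) (auto simp: bas_def)
qed

text \<open>Since eps(1) = 1, the unit has a coordinate by which \<open>bil_emb_efree\<close> can
  divide.\<close>

lemma DDunit_nonzero: "\<exists>c. DDunit H c \<noteq> 0"
proof -
  have "\<exists>i. hunit H i * hcounit H i \<noteq> 0"
  proof (rule ccontr)
    assume "\<not> ?thesis"
    then have "(\<Sum>i. hunit H i * hcounit H i) = 0" by (intro sum.neutral) auto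
    then show False by (simp add: hopf_counit_unit[OF H])
  qed
  then obtain i where "DDunit H (i, i) \<noteq> 0" by (auto simp: DDunit_def)
  then show ?thesis by blast
qed

lemma wfam_DD:
  assumes "distinct (map fst xs)"
  shows "wfam K (DDmul H) (DDunit H) xs a = wfam K (HHmul H) (DDunit H) xs a"
proof -
  obtain c where "DDunit H c \<noteq> 0" using DDunit_nonzero by blast
  from wfam_indep[OF DDmul_unital algebra_unital[OF HH_algebra] this assms] show ?thesis .
qed

text \<open>The map y (x) gamma -> gamma(1) y from D(H)^* to H respects comultiplication. Vertex
  letters factor through it, so they convolve as families over H; \<open>DDcomul_Q\<close> does the
  same for face letters and the dual.\<close>

lemma DDcomul_P:
  "(\<Sum>d1 d2. DDcomul H (a, b) (c1, d1) (c2, d2) * hunit H d1 * hunit H d2) = hunit H b * hcomul H a c1 c2"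
proof -
  have "(\<Sum>d1 d2. DDcomul H (a, b) (c1, d1) (c2, d2) * hunit H d1 * hunit H d2) =
    (\<Sum>b1 a2 f i c e j. hcomul H a c1 a2 * hcomul H c i b1 * hanti H j e * hmul H e a2 f * hmul H f i c2
       * (\<Sum>d2. hunit H d2 * hmul H b1 d2 b) * (\<Sum>d1. hunit H d1 * hcomul H d1 c j))"
    by (simp add: DDcomul_def sum_distribs, simp only: sum_nested,
      rule sum_permute[of "\<lambda>(d1,d2,i,j,a2,b1,c,e,f). (b1,a2,f,i,c,e,j,d1,d2)"]) (auto simp: ac_simps)
  also have "\<dots> = (\<Sum>b1 a2 f i c e j. hcomul H a c1 a2 * hcomul H c i b1 * hanti H j e * hmul H e a2 f * hmul H f i c2
       * bas b1 b * (hunit H c * hunit H j))"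
    by (simp only: hopf_unit[OF H] hopf_comul_unit[OF H])
  also have "\<dots> = (\<Sum>f i a2. hcomul H a c1 a2 * hmul H f i c2
      * (\<Sum>b1. bas b1 b * (\<Sum>c. hunit H c * hcomul H c i b1))
      * (\<Sum>e. (\<Sum>j. hunit H j * hanti H j e) * hmul H e a2 f))"
    by (simp only: sum_distribs, simp only: sum_nested,
      rule sum_permute[of "\<lambda>(b1,a2,f,i,c,e,j). (f,i,a2,e,j,b1,c)"]) (auto simp: ac_simps)
  also have "\<dots> = (\<Sum>f i a2. hcomul H a c1 a2 * hmul H f i c2 * (hunit H i * hunit H b) * bas a2 f)"
    by (simp only: hopf_unit[OF H] hopf_comul_unit[OF H] hanti_unit[OF H] sum_bas)
  also have "\<dots> = (\<Sum>a2 f i. hunit H b * hcomul H a c1 a2 * bas a2 f * (hunit H i * hmul H f i c2))"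
    by (simp only: sum_nested,
      rule sum_permute[of "\<lambda>(f,i,a2). (a2,f,i)"]) (auto simp: ac_simps)
  also have "\<dots> = (\<Sum>a2. hunit H b * hcomul H a c1 a2 * (\<Sum>f. bas a2 f * bas f c2))"
    by (simp only: sum_distrib_left[symmetric] hopf_unit[OF H] mult.assoc)
  also have "\<dots> = hunit H b * hcomul H a c1 c2" by simp
  finally show ?thesis .
qed

lemma DDcomul_Q:
  "(\<Sum>c1 c2. DDcomul H (a, b) (c1, d1) (c2, d2) * hcounit H c1 * hcounit H c2) = hcounit H a * hmul H d1 d2 b"
proof -
  have "(\<Sum>c1 c2. DDcomul H (a, b) (c1, d1) (c2, d2) * hcounit H c1 * hcounit H c2) =
    (\<Sum>b1 a2 i c e j f. hmul H b1 d2 b * hcomul H c i b1 * hcomul H d1 c j * hanti H j e * hmul H e a2 f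
       * (\<Sum>c1. hcounit H c1 * hcomul H a c1 a2) * (\<Sum>c2. hmul H f i c2 * hcounit H c2))"
    by (simp add: DDcomul_def sum_distribs, simp only: sum_nested,
      rule sum_permute[of "\<lambda>(c1,c2,i,j,a2,b1,c,e,f). (b1,a2,i,c,e,j,f,c2,c1)"]) (auto simp: ac_simps)
  also have "\<dots> = (\<Sum>b1 a2 i c e j f. hmul H b1 d2 b * hcomul H c i b1 * hcomul H d1 c j * hanti H j e * hmul H e a2 f
       * bas a a2 * (hcounit H f * hcounit H i))"
    by (simp only: hopf_counit[OF H] hopf_counit_mult[OF H])
  also have "\<dots> = (\<Sum>b1 a2 c j. hmul H b1 d2 b * bas a a2 * hcomul H d1 c j * (\<Sum>i. hcounit H i * hcomul H c i b1)
       * (\<Sum>e. hanti H j e * (\<Sum>f. hmul H e a2 f * hcounit H f)))"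
    by (simp only: sum_distribs, simp only: sum_nested,
      rule sum_permute[of "\<lambda>(b1,a2,i,c,e,j,f). (b1,a2,c,j,e,f,i)"]) (auto simp: ac_simps)
  also have "\<dots> = (\<Sum>b1 a2 c j. hmul H b1 d2 b * bas a a2 * hcomul H d1 c j * bas c b1 * (hcounit H j * hcounit H a2))"
    by (simp only: hopf_counit[OF H] hopf_counit_mult[OF H] mult.assoc[symmetric] sum_distrib_right[symmetric] hanti_counit[OF H])
  also have "\<dots> = (\<Sum>b1. hmul H b1 d2 b * (\<Sum>a2. bas a a2 * (hcounit H a2 * (\<Sum>c. bas c b1 * (\<Sum>j. hcounit H j * hcomul H d1 c j)))))"
    by (simp only: sum_distrib_left ac_simps)
  also have "\<dots> = hcounit H a * hmul H d1 d2 b"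
    by (simp only: hopf_counit[OF H] sum_bas) (simp add: mult.left_commute[of _ "hcounit H a"] flip: sum_distrib_left)
  finally show ?thesis .
qed

text \<open>The projections of \<open>DDcomul_P\<close> and \<open>DDcomul_Q\<close> also carry S_D
  to the antipodes, so a reversed letter is a letter composed with S.\<close>

lemma DDanti_Q: "(\<Sum>g. DDanti H (a, b) (g, d) * hcounit H g) = hcounit H a * hanti H d b"
proof -
  have "(\<Sum>g. DDanti H (a, b) (g, d) * hcounit H g) =
    (\<Sum>e r q p i j f. hanti H a e * hmul H i e f * hanti H p j * hanti H q b * hcomul H r p q * hcomul H d r i
       * (\<Sum>g. hmul H f j g * hcounit H g))"
    by (simp add: DDanti_def sum_distribs, simp only: sum_nested,
      rule sum_permute[of "\<lambda>(g,i,j,e,f,p,q,r). (e,r,q,p,i,j,f,g)"]) (auto simp: ac_simps)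
  also have "\<dots> = (\<Sum>e r q p i j f. hanti H a e * hmul H i e f * hanti H p j * hanti H q b * hcomul H r p q * hcomul H d r i
       * (hcounit H f * hcounit H j))"
    by (simp only: hopf_counit_mult[OF H])
  also have "\<dots> = (\<Sum>e r q p i. hanti H a e * hanti H q b * hcomul H r p q * hcomul H d r i
       * (\<Sum>j. hanti H p j * hcounit H j) * (\<Sum>f. hmul H i e f * hcounit H f))"
    by (simp only: sum_distribs, simp only: sum_nested,
      rule sum_permute[of "\<lambda>(e,r,q,p,i,j,f). (e,r,q,p,i,f,j)"]) (auto simp: ac_simps)
  also have "\<dots> = (\<Sum>e r q p i. hanti H a e * hanti H q b * hcomul H r p q * hcomul H d r i * hcounit H p * (hcounit H i * hcounit H e))"
    by (simp only: hopf_counit_mult[OF H] hanti_counit[OF H])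
  also have "\<dots> = (\<Sum>e. hanti H a e * hcounit H e * (\<Sum>q. hanti H q b *
      (\<Sum>r. (\<Sum>i. hcounit H i * hcomul H d r i) * (\<Sum>p. hcounit H p * hcomul H r p q))))"
    by (simp only: sum_distribs, simp only: sum_nested,
      rule sum_permute[of "\<lambda>(e,r,q,p,i). (e,q,r,p,i)"]) (auto simp: ac_simps)
  also have "\<dots> = (\<Sum>e. hanti H a e * hcounit H e * hanti H d b)"
    by (simp only: hopf_counit[OF H] sum_bas)
  finally show ?thesis by (simp only: sum_distrib_right[symmetric] hanti_counit[OF H])
qed

lemma DDanti_P: "(\<Sum>d. DDanti H (a, b) (g, d) * hunit H d) = hunit H b * hanti H a g"
proof -
  have "(\<Sum>d. DDanti H (a, b) (g, d) * hunit H d) =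
    (\<Sum>f e i q j p r. hanti H a e * hmul H i e f * hmul H f j g * hanti H p j * hanti H q b * hcomul H r p q
       * (\<Sum>d. hunit H d * hcomul H d r i))"
    by (simp add: DDanti_def sum_distribs, simp only: sum_nested,
      rule sum_permute[of "\<lambda>(d,i,j,e,f,p,q,r). (f,e,i,q,j,p,r,d)"]) (auto simp: ac_simps)
  also have "\<dots> = (\<Sum>f e i q j p r. hanti H a e * hmul H i e f * hmul H f j g * hanti H p j * hanti H q b * hcomul H r p q
       * (hunit H r * hunit H i))"
    by (simp only: hopf_comul_unit[OF H])
  also have "\<dots> = (\<Sum>f e i q j p. hanti H a e * (hunit H i * hmul H i e f) * hmul H f j g * hanti H p j * hanti H q b
       * (\<Sum>r. hunit H r * hcomul H r p q))"
    by (simp only: sum_distrib_left, intro sum.cong refl) (simp add: ac_simps)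
  also have "\<dots> = (\<Sum>f e i q j p. hanti H a e * (hunit H i * hmul H i e f) * hmul H f j g * hanti H p j * hanti H q b * (hunit H p * hunit H q))"
    by (simp only: hopf_comul_unit[OF H])
  also have "\<dots> = (\<Sum>e. hanti H a e * (\<Sum>f. (\<Sum>i. hunit H i * hmul H i e f) * (\<Sum>j. (\<Sum>p. hunit H p * hanti H p j) * hmul H f j g)))
       * (\<Sum>q. hunit H q * hanti H q b)"
    by (simp only: sum_distribs, simp only: sum_nested,
      rule sum_permute[of "\<lambda>(f,e,i,q,j,p). (q,e,f,j,p,i)"]) (auto simp: ac_simps)
  also have "\<dots> = hunit H b * hanti H a g"
    by (simp only: hopf_unit[OF H] hanti_unit[OF H] sum_bas) (simp only: mult.commute)
  finally show ?thesis .
qed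

lemma conv_P:
  "conv H (\<lambda>(a, b) F. hunit H b * x a F) (\<lambda>(a, b) F. hunit H b * y a F) (a, b) F
   = hunit H b * (\<Sum>a1 a2. hcomul H a a1 a2 * bil (tpow3 (DDmul H)) (x a1) (y a2) F)"
proof -
  have "conv H (\<lambda>(a, b) F. hunit H b * x a F) (\<lambda>(a, b) F. hunit H b * y a F) (a, b) F =
    (\<Sum>a1 a2. (\<Sum>d1 d2. DDcomul H (a, b) (a1, d1) (a2, d2) * hunit H d1 * hunit H d2)
      * bil (tpow3 (DDmul H)) (x a1) (y a2) F)"
    by (simp add: conv_def sum_pair DDmulE_def bil_lin sum_distribs, simp only: sum_nested,
      rule sum_permute[of "\<lambda>(a1,d1,a2,d2). (a1,a2,d1,d2)"]) (auto simp: ac_simps)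
  then show ?thesis by (simp only: DDcomul_P) (simp add: sum_distrib_left ac_simps)
qed

lemma conv_Q:
  "conv H (\<lambda>(a, b) F. hcounit H a * x b F) (\<lambda>(a, b) F. hcounit H a * y b F) (a, b) F
   = hcounit H a * (\<Sum>b1 b2. hmul H b1 b2 b * bil (tpow3 (DDmul H)) (x b1) (y b2) F)"
proof -
  have "conv H (\<lambda>(a, b) F. hcounit H a * x b F) (\<lambda>(a, b) F. hcounit H a * y b F) (a, b) F =
    (\<Sum>d1 d2. (\<Sum>a1 a2. DDcomul H (a, b) (a1, d1) (a2, d2) * hcounit H a1 * hcounit H a2)
      * bil (tpow3 (DDmul H)) (x d1) (y d2) F)"
    by (simp add: conv_def sum_pair DDmulE_def bil_lin sum_distribs, simp only: sum_nested,
      rule sum_permute[of "\<lambda>(a1,d1,a2,d2). (d1,d2,a1,a2)"]) (auto simp: ac_simps)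
  then show ?thesis by (simp only: DDcomul_Q) (simp add: sum_distrib_left ac_simps)
qed

lemma tpow_unital:
  assumes "unital M u"
  shows "unital (tpow3 M) (tpow1 u)"
  unfolding unital_def tpow3_def tpow1_def prod.distrib[symmetric]
    prod_sum_UNIV[of "\<lambda>x d. u d * M d (a x) (b x)" for a b, symmetric]
    prod_sum_UNIV[of "\<lambda>x d. u d * M (a x) d (b x)" for a b, symmetric]
  using assms by (simp add: unital_def prod_bas)

lemma wfam_single:
  fixes M :: "'c::finite \<Rightarrow> 'c \<Rightarrow> 'c \<Rightarrow> 'b::field" and x :: "'d::finite \<times> ('a::finite \<Rightarrow> 'c \<Rightarrow> 'b)"
  assumes K: "hopf_algebra K" and M: "unital M u"
  shows "wfam K M u [x] a = emb u (fst x) (snd x a)"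
proof
  fix F
  have *: "bil (tpow3 M) X (\<lambda>F. c * tpow1 u F) F = c * X F" for X c and F :: "'d \<Rightarrow> 'c"
    using bil_lin[of "tpow3 M" 1 X c "tpow1 u" F] by (simp add: bil_unit[OF tpow_unital[OF M]])
  have "wfam K M u [x] a F = (\<Sum>a1. (\<Sum>a2. hcounit K a2 * hcomul K a a1 a2) * emb u (fst x) (snd x a1) F)"
    by (simp add: * sum_distribs ac_simps)
  then show "wfam K M u [x] a F = emb u (fst x) (snd x a) F"
    by (simp add: hopf_counit[OF K])
qed

text \<open>One induction for both kinds of loops: \<open>pr\<close> selects the factor of D(H)^* on
  which the letters depend, \<open>wt\<close> is the counit of the other one.\<close>

lemma hol_word_letters:
  fixes xs :: "('e::finite \<times> ('j::finite \<Rightarrow> 'i \<times> 'i \<Rightarrow> 'k)) list"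
  assumes K: "hopf_algebra K" and counit: "\<And>b. DDcounit H b = wt b * hcounit K (pr b)"
    and conv: "\<And>(x :: 'j \<Rightarrow> ('e \<Rightarrow> 'i \<times> 'i) \<Rightarrow> 'k) y b F. conv H (\<lambda>b F. wt b * x (pr b) F) (\<lambda>b F. wt b * y (pr b) F) b F
      = wt b * (\<Sum>a1 a2. hcomul K (pr b) a1 a2 * bil (tpow3 (DDmul H)) (x a1) (y a2) F)"
  shows "hol_word H (map (\<lambda>x b F. wt b * emb (DDunit H) (fst x) (snd x (pr b)) F) xs)
   = (\<lambda>b F. wt b * wfam K (DDmul H) (DDunit H) xs (pr b) F)"
proof (induction xs)
  case Nil
  show ?case by (simp add: fun_eq_iff conv_unit_def counit unitE_def mult.assoc)
next
  case (Cons x xs)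
  show ?case
  proof (cases xs)
    case Nil
    then show ?thesis using wfam_single[OF K DDmul_unital, of x] by (simp add: fun_eq_iff)
  next
    case (Cons y ys)
    have "hol_word H (map (\<lambda>x b F. wt b * emb (DDunit H) (fst x) (snd x (pr b)) F) (x # xs))
      = conv H (\<lambda>b F. wt b * emb (DDunit H) (fst x) (snd x (pr b)) F) (\<lambda>b F. wt b * wfam K (DDmul H) (DDunit H) xs (pr b) F)"
      unfolding Cons.IH[symmetric] unfolding Cons by simp
    also have "\<dots> = (\<lambda>b F. wt b * wfam K (DDmul H) (DDunit H) (x # xs) (pr b) F)"
      by (intro ext) (simp only: conv[of "\<lambda>a. emb (DDunit H) (fst x) (snd x a)"] wfam.simps)
    finally show ?thesis .
  qed
qed

lemma hol_word_P:
  "hol_word H (map (\<lambda>x. \<lambda>(a, b) F. hunit H b * emb (DDunit H) (fst x) (snd x a) F) xs)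
   = (\<lambda>(a, b) F. hunit H b * wfam H (DDmul H) (DDunit H) xs a F)"
proof -
  have c: "DDcounit H b = hunit H (snd b) * hcounit H (fst b)" for b
    by (simp add: DDcounit_def case_prod_unfold mult.commute)
  have "conv H (\<lambda>b F. hunit H (snd b) * x (fst b) F) (\<lambda>b F. hunit H (snd b) * y (fst b) F) b F
    = hunit H (snd b) * (\<Sum>a1 a2. hcomul H (fst b) a1 a2 * bil (tpow3 (DDmul H)) (x a1) (y a2) F)" for x y b F
    using conv_P[of x y "fst b" "snd b" F] by (simp only: case_prod_unfold prod.collapse)
  from hol_word_letters[OF H c this] show ?thesis by (simp only: case_prod_unfold)
qed

lemma hol_word_Q:
  "hol_word H (map (\<lambda>x. \<lambda>(a, b) F. hcounit H a * emb (DDunit H) (fst x) (snd x b) F) xs)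
   = (\<lambda>(a, b) F. hcounit H a * wfam (dual H) (DDmul H) (DDunit H) xs b F)"
proof -
  have c: "DDcounit H b = hcounit H (fst b) * hcounit (dual H) (snd b)" for b
    by (simp add: DDcounit_def case_prod_unfold)
  have "conv H (\<lambda>b F. hcounit H (fst b) * x (snd b) F) (\<lambda>b F. hcounit H (fst b) * y (snd b) F) b F
    = hcounit H (fst b) * (\<Sum>a1 a2. hcomul (dual H) (snd b) a1 a2 * bil (tpow3 (DDmul H)) (x a1) (y a2) F)" for x y b F
    using conv_Q[of x y "fst b" "snd b" F] by (simp only: case_prod_unfold prod.collapse dual_simps)
  from hol_word_letters[OF dual_hopf[OF H] c this] show ?thesis by (simp only: case_prod_unfold)
qed

lemma vertex_letter:
  "hol_vertex_letter H (e, s) = (\<lambda>(a, b) F. hunit H b * emb (DDunit H) e ((if s then hh_fp H else hh_fm H) a) F)"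
proof (cases s)
  case True
  then show ?thesis
    by (auto simp: fun_eq_iff hol_vertex_letter_def hol_rbar_def hh_fp_def emb_scale[symmetric] case_prod_unfold)
next
  case False
  define core where "core a = (\<lambda>(c, d). \<Sum>i j p f. hmul H i a f * hanti H j p * hmul H f p c * hcomul H d j i)" for a
  have l: "hol_lbar H e (g, d) F = hunit H d * emb (DDunit H) e (core g) F" for g d F
    by (simp add: hol_lbar_def core_def emb_scale[symmetric] case_prod_unfold)
  have m: "hh_fm H a = (\<lambda>x. \<Sum>g. hanti H a g * core g x)" for a
    by (auto simp: hh_fm_def core_def fun_eq_iff)
  have "hol_inv H (hol_lbar H e) (a, b) F = hunit H b * emb (DDunit H) e (hh_fm H a) F" for a b F
  proof -
    have "hol_inv H (hol_lbar H e) (a, b) F = (\<Sum>g. (\<Sum>d. DDanti H (a, b) (g, d) * hunit H d) * emb (DDunit H) e (core g) F)"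
      by (simp add: hol_inv_def sum_pair l sum_distribs ac_simps)
    then show ?thesis by (simp add: DDanti_P m emb_sum emb_scale) (simp add: sum_distrib_left ac_simps)
  qed
  then show ?thesis using False by (auto simp: fun_eq_iff hol_vertex_letter_def)
qed

lemma face_letter:
  "hol_face_letter H (e, s) = (\<lambda>(a, b) F. hcounit H a * emb (DDunit H) e ((if s then hh_gp H else hh_gm H) b) F)"
proof (cases s)
  case True
  then show ?thesis
    by (auto simp: fun_eq_iff hol_face_letter_def hol_r_def hh_gp_def emb_scale[symmetric] case_prod_unfold)
next
  case False
  define core where "core a = (\<lambda>(c, d). \<Sum>i j p q. hanti H j p * hmul H i p c * hcomul H q j a * hcomul H d q i)" for a
  have l: "hol_l H e (g, d) F = hcounit H g * emb (DDunit H) e (core d) F" for g d F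
    by (simp add: hol_l_def core_def emb_scale[symmetric] case_prod_unfold)
  have m: "hh_gm H a = (\<lambda>x. \<Sum>g. hanti H g a * core g x)" for a
    by (auto simp: hh_gm_def core_def fun_eq_iff)
  have "hol_inv H (hol_l H e) (a, b) F = hcounit H a * emb (DDunit H) e (hh_gm H b) F" for a b F
  proof -
    have "hol_inv H (hol_l H e) (a, b) F = (\<Sum>d. (\<Sum>g. DDanti H (a, b) (g, d) * hcounit H g) * emb (DDunit H) e (core d) F)"
      by (simp add: hol_inv_def sum_pair l sum_distribs, subst sum.swap, simp add: ac_simps)
    then show ?thesis by (simp add: DDanti_Q m emb_sum emb_scale) (simp add: sum_distrib_left ac_simps)
  qed
  then show ?thesis using False by (auto simp: fun_eq_iff hol_face_letter_def)
qed

definition vfam :: "('e::finite \<Rightarrow> 'v) \<Rightarrow> 'v \<Rightarrow> 'e list \<Rightarrow> 'i \<Rightarrow> ('e \<Rightarrow> 'i \<times> 'i) \<Rightarrow> 'k" where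
  "vfam tgt v es = wfam H (HHmul H) (DDunit H) (map (\<lambda>e. (e, if tgt e = v then hh_fp H else hh_fm H)) es)"

definition ffam :: "('e::finite \<times> bool) list \<Rightarrow> 'i \<Rightarrow> ('e \<Rightarrow> 'i \<times> 'i) \<Rightarrow> 'k" where
  "ffam ds = wfam (dual H) (HHmul H) (DDunit H) (map (\<lambda>d. (fst d, if snd d then hh_gp H else hh_gm H)) ds)"

lemma hol_vertex_eq:
  fixes src tgt :: "'e::finite \<Rightarrow> 'v"
  assumes "distinct (ord v)"
  shows "hol_vertex H src tgt ord v = (\<lambda>(a, b) F. hunit H b * vfam tgt v (ord v) a F)"
proof -
  have "hol_vertex H src tgt ord v = hol_word H (map (\<lambda>x. \<lambda>(a, b) F. hunit H b * emb (DDunit H) (fst x) (snd x a) F)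
      (map (\<lambda>e. (e, if tgt e = v then hh_fp H else hh_fm H)) (ord v)))"
    by (simp add: hol_vertex_def vertex_letter comp_def)
  \<comment> \<open>\<open>wfam_DD\<close> exchanges the product of D(H)^* for that of the
    Heisenberg double; this is where the distinctness of the edges is used.\<close>
  then show ?thesis unfolding hol_word_P vfam_def
    using assms by (subst wfam_DD[symmetric]) (auto simp: comp_def)
qed

lemma hol_face_eq:
  fixes src tgt :: "'e::finite \<Rightarrow> 'v"
  assumes "distinct (map fst (face_at src tgt ord v))"
  shows "hol_face H src tgt ord v = (\<lambda>(a, b) F. hcounit H a * ffam (rev (face_at src tgt ord v)) b F)"
proof -
  have *: "hol_face_letter H = (\<lambda>d :: 'e \<times> bool. \<lambda>(a, b) F. hcounit H a * emb (DDunit H) (fst d) ((if snd d then hh_gp H else hh_gm H) b) F)"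
  proof
    fix d :: "'e \<times> bool"
    show "hol_face_letter H d = (\<lambda>(a, b) F. hcounit H a * emb (DDunit H) (fst d) ((if snd d then hh_gp H else hh_gm H) b) F)"
      by (cases d) (simp only: face_letter fst_conv snd_conv)
  qed
  have "hol_face H src tgt ord v = hol_word H (map (\<lambda>x. \<lambda>(a, b) F. hcounit H a * emb (DDunit H) (fst x) (snd x b) F)
      (map (\<lambda>d. (fst d, if snd d then hh_gp H else hh_gm H)) (rev (face_at src tgt ord v))))"
    unfolding hol_face_def * by (simp add: comp_def rev_map)
  then show ?thesis unfolding hol_word_Q ffam_def
    using assms by (subst wfam_DD[symmetric]) (auto simp: comp_def rev_map[symmetric])
qed

lemma Rm_vfam:
  fixes tgt :: "'e::finite \<Rightarrow> 'v"
  shows "Rm ME (vfam tgt v es a) = cword H (map (\<lambda>e a. edge_op e (if tgt e = v then lreg H a else fneg H a)) es) a"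
proof -
  have *: "Rm ME (emb (DDunit H) e ((if s then hh_fp H else hh_fm H) a)) = edge_op e (if s then lreg H a else fneg H a)" for e :: 'e and s a
    by (simp add: hh_of_edge[symmetric] edge_op_emb)
  show ?thesis unfolding vfam_def Rm_wfam[OF HH_algebra] by (simp add: comp_def *)
qed

lemma Rm_ffam:
  fixes ds :: "('e::finite \<times> bool) list"
  shows "Rm ME (ffam ds a) = cword (dual H) (map (\<lambda>d a. edge_op (fst d) (if snd d then lact H a else gneg H a)) ds) a"
proof -
  have *: "Rm ME (emb (DDunit H) e ((if s then hh_gp H else hh_gm H) a)) = edge_op e (if s then lact H a else gneg H a)" for e :: 'e and s a
    by (simp add: hh_of_edge[symmetric] edge_op_emb)
  show ?thesis unfolding ffam_def Rm_wfam[OF HH_algebra] by (simp add: comp_def *)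
qed

end

section \<open>Faces of regular ciliated ribbon graphs\<close>

lemma cyc_succ_nth:
  assumes "distinct xs" "k < length xs"
  shows "cyc_succ xs (xs ! k) = xs ! (Suc k mod length xs)"
proof -
  have "(THE j. j < length xs \<and> xs ! j = xs ! k) = k"
    using assms by (intro the_equality) (auto simp: nth_eq_iff_index_eq)
  then show ?thesis by (simp add: cyc_succ_def)
qed

lemma cyc_succ_inj:
  assumes "distinct xs" "x \<in> set xs" "y \<in> set xs" "cyc_succ xs x = cyc_succ xs y"
  shows "x = y"
proof -
  obtain i j where ij: "i < length xs" "x = xs ! i" "j < length xs" "y = xs ! j"
    using assms by (metis in_set_conv_nth)
  then have "Suc i mod length xs < length xs" "Suc j mod length xs < length xs"
    by (auto intro: mod_less_divisor)
  with assms ij have "Suc i mod length xs = Suc j mod length xs"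
    by (simp add: cyc_succ_nth nth_eq_iff_index_eq)
  with ij have "i = j"
    by (auto simp: mod_Suc split: if_splits)
  with ij show ?thesis by simp
qed

lemma cyc_succ_set:
  assumes "distinct xs" "x \<in> set xs"
  shows "cyc_succ xs x \<in> set xs"
proof -
  obtain i where i: "i < length xs" "x = xs ! i"
    using assms by (metis in_set_conv_nth)
  then have "Suc i mod length xs < length xs" by (auto intro: mod_less_divisor)
  with i show ?thesis by (simp add: cyc_succ_nth assms(1))
qed

lemma cyc_succ_hd:
  assumes "distinct xs" "x \<in> set xs" "cyc_succ xs x = hd xs"
  shows "x = last xs"
proof -
  have ne: "xs \<noteq> []" using assms by auto
  then have "cyc_succ xs (last xs) = hd xs"
    using cyc_succ_nth[of xs "length xs - 1"] assms(1) by (simp add: last_conv_nth hd_conv_nth)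
  then show ?thesis using cyc_succ_inj[OF assms(1,2), of "last xs"] assms(3) ne by simp
qed

lemma cyc_succ_split:
  assumes "distinct xs" "x \<in> set xs" "x \<noteq> last xs"
  obtains ys zs where "xs = ys @ x # cyc_succ xs x # zs"
proof -
  obtain i where i: "i < length xs" "x = xs ! i"
    using assms by (metis in_set_conv_nth)
  have "Suc i < length xs"
  proof (rule ccontr)
    assume "\<not> Suc i < length xs"
    then have "i = length xs - 1" using i by simp
    moreover have "xs \<noteq> []" using assms(2) by auto
    ultimately show False using i assms(3) by (simp add: last_conv_nth)
  qed
  then have "take i xs @ x # cyc_succ xs x # drop (Suc (Suc i)) xs = xs"
    using i by (simp add: cyc_succ_nth[OF assms(1)] Cons_nth_drop_Suc)
  then show ?thesis using that by metis
qed

definition dtail :: "('e \<Rightarrow> 'v) \<Rightarrow> ('e \<Rightarrow> 'v) \<Rightarrow> 'e \<times> bool \<Rightarrow> 'v" where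
  "dtail src tgt = (\<lambda>(e, pos). if pos then src e else tgt e)"

locale reg_graph =
  fixes src tgt :: "'e::finite \<Rightarrow> 'v::finite" and ord :: "'v \<Rightarrow> 'e list"
  assumes reg: "regular_ciliated_ribbon_graph src tgt ord"
begin

abbreviation "nd \<equiv> next_dart src tgt ord"
abbreviation "hd_v \<equiv> dhead src tgt"
abbreviation "tl_v \<equiv> dtail src tgt"
abbreviation "face v \<equiv> face_at src tgt ord v"
abbreviation "orbit \<equiv> face_orbit src tgt ord"
abbreviation "cil \<equiv> passes_cilium src tgt ord"

lemma dist_ord: "distinct (ord v)"
  using reg by (simp add: regular_ciliated_ribbon_graph_def ciliated_ribbon_graph_def)

lemma set_ord: "set (ord v) = {e. src e = v \<or> tgt e = v}"
  using reg by (simp add: regular_ciliated_ribbon_graph_def ciliated_ribbon_graph_def)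

lemma no_loop: "src e \<noteq> tgt e"
  using reg by (simp add: regular_ciliated_ribbon_graph_def)

lemma flip_orbit: "flip_dart d \<notin> orbit d"
proof -
  have "\<forall>d. flip_dart d \<notin> orbit d"
    using reg unfolding regular_ciliated_ribbon_graph_def by (elim conjE)
  then show ?thesis by (rule spec)
qed

lemma one_cilium: "d1 \<in> orbit d \<Longrightarrow> d2 \<in> orbit d \<Longrightarrow> cil d1 \<Longrightarrow> cil d2 \<Longrightarrow> d1 = d2"
proof -
  assume *: "d1 \<in> orbit d" "d2 \<in> orbit d" "cil d1" "cil d2"
  have "\<forall>d. card {d' \<in> orbit d. cil d'} = 1"
    using reg unfolding regular_ciliated_ribbon_graph_def by (elim conjE)
  then have "card {d' \<in> orbit d. cil d'} = 1" by (rule spec)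
  then obtain x where "{d' \<in> orbit d. cil d'} = {x}" by (auto simp: card_1_singleton_iff)
  moreover have "d1 \<in> {d' \<in> orbit d. cil d'}" "d2 \<in> {d' \<in> orbit d. cil d'}" using * by auto
  ultimately show ?thesis by simp
qed

lemma head_in: "fst d \<in> set (ord (hd_v d))"
  by (cases d) (auto simp: set_ord dhead_def)

lemma head_tail: "hd_v d \<noteq> tl_v d"
  using no_loop by (cases d) (auto simp: dhead_def dtail_def, metis)

lemma ord_cases: "fst d \<in> set (ord v) \<Longrightarrow> hd_v d = v \<or> tl_v d = v"
  by (cases d) (auto simp: set_ord dhead_def dtail_def)

lemma snd_head: "hd_v d = v \<Longrightarrow> snd d = (tgt (fst d) = v)"
  using no_loop[of "fst d"] by (cases d; cases "snd d") (auto simp: dhead_def)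

lemma snd_tail: "tl_v d = v \<Longrightarrow> snd d = (tgt (fst d) \<noteq> v)"
  using no_loop[of "fst d"] by (cases d; cases "snd d") (auto simp: dtail_def)

lemma nd_fst: "fst (nd d) = cyc_succ (ord (hd_v d)) (fst d)"
  by (simp add: next_dart_def Let_def)

lemma nd_tail: "tl_v (nd d) = hd_v d"
proof -
  have "cyc_succ (ord (hd_v d)) (fst d) \<in> set (ord (hd_v d))"
    by (rule cyc_succ_set[OF dist_ord head_in])
  then show ?thesis by (auto simp: next_dart_def Let_def dtail_def set_ord)
qed

lemma nd_inj: "inj nd"
proof (rule injI)
  fix d d' assume eq: "nd d = nd d'"
  then have h: "hd_v d = hd_v d'" using nd_tail by metis
  have "fst d = fst d'"
    using eq nd_fst[of d] nd_fst[of d'] h head_in[of d] head_in[of d']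
    by (metis cyc_succ_inj dist_ord)
  moreover have "snd d = snd d'"
    using snd_head[of d] snd_head[of d'] h calculation by metis
  ultimately show "d = d'" by (simp add: prod_eq_iff)
qed

definition d0 :: "'v \<Rightarrow> 'e \<times> bool" where
  "d0 v = (hd (ord v), src (hd (ord v)) = v)"

definition flen :: "'v \<Rightarrow> nat" where
  "flen v = (LEAST k. 0 < k \<and> (nd ^^ k) (d0 v) = d0 v)"

lemma face_eq: "ord v \<noteq> [] \<Longrightarrow> face v = map (\<lambda>k. (nd ^^ k) (d0 v)) [0..<flen v]"
  by (simp only: face_at_def flen_def d0_def Let_def if_False)

lemma flen: "0 < flen v" "(nd ^^ flen v) (d0 v) = d0 v"
proof -
  have fin: "finite {y. \<exists>n. y = (nd ^^ n) (d0 v)}" by (rule finite)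
  obtain n where "n > 0" "(nd ^^ n) (d0 v) = d0 v" by (rule funpow_inj_finite[OF nd_inj fin])
  then have "\<exists>k. 0 < k \<and> (nd ^^ k) (d0 v) = d0 v" by (intro exI conjI)
  then have "0 < flen v \<and> (nd ^^ flen v) (d0 v) = d0 v"
    unfolding flen_def by (rule LeastI_ex)
  then show "0 < flen v" "(nd ^^ flen v) (d0 v) = d0 v" by auto
qed

lemma nd_pow_inj: "inj (nd ^^ k)"
  using nd_inj by (rule inj_fn)

lemma pow_split: "k \<le> l \<Longrightarrow> (nd ^^ l) d = (nd ^^ k) ((nd ^^ (l - k)) d)"
  using funpow_add[of k "l - k" nd] by (simp only: le_add_diff_inverse comp_apply)

lemma nd_distinct:
  assumes "k < l" "l < flen v"
  shows "(nd ^^ k) (d0 v) \<noteq> (nd ^^ l) (d0 v)"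
proof
  assume eq: "(nd ^^ k) (d0 v) = (nd ^^ l) (d0 v)"
  have "(nd ^^ l) (d0 v) = (nd ^^ k) ((nd ^^ (l - k)) (d0 v))"
    using assms by (intro pow_split) simp
  with eq have "(nd ^^ k) ((nd ^^ (l - k)) (d0 v)) = (nd ^^ k) (d0 v)" by metis
  then have "(nd ^^ (l - k)) (d0 v) = d0 v"
    by (rule injD[OF nd_pow_inj])
  then have "flen v \<le> l - k"
    unfolding flen_def using assms by (intro Least_le conjI) auto
  then show False using assms by linarith
qed

lemma orbit_pow: "k \<le> l \<Longrightarrow> (nd ^^ l) d \<in> orbit ((nd ^^ k) d)"
proof -
  assume "k \<le> l"
  then have "(nd ^^ l) d = (nd ^^ (l - k)) ((nd ^^ k) d)"
    using pow_split[of "l - k" l d] by (simp only: diff_le_self diff_diff_cancel)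
  then show ?thesis unfolding face_orbit_def by (intro image_eqI[of _ _ "l - k"]) (simp_all only: UNIV_I)
qed

text \<open>Two darts over one edge are equal or opposite. The minimality of \<open>flen\<close>
  excludes the first, regularity (\<open>flip_orbit\<close>) the second.\<close>

lemma face_dist: "distinct (map fst (face v))"
proof (cases "ord v = []")
  case False
  have *: "fst ((nd ^^ k) (d0 v)) \<noteq> fst ((nd ^^ l) (d0 v))" if "k < l" "l < flen v" for k l
  proof
    assume eq: "fst ((nd ^^ k) (d0 v)) = fst ((nd ^^ l) (d0 v))"
    with nd_distinct[OF that] have "(nd ^^ l) (d0 v) = flip_dart ((nd ^^ k) (d0 v))"
      by (auto simp: flip_dart_def prod_eq_iff split: prod.splits)
    then show False using orbit_pow[of k l "d0 v"] flip_orbit that by simp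
  qed
  have "inj_on (fst \<circ> (\<lambda>k. (nd ^^ k) (d0 v))) (set [0..<flen v])"
  proof (rule inj_onI)
    fix k l assume "k \<in> set [0..<flen v]" "l \<in> set [0..<flen v]"
      and "(fst \<circ> (\<lambda>k. (nd ^^ k) (d0 v))) k = (fst \<circ> (\<lambda>k. (nd ^^ k) (d0 v))) l"
    then show "k = l"
      using *[of k l] *[of l k] by (cases k l rule: linorder_cases) auto
  qed
  then show ?thesis
    unfolding face_eq[OF False] map_map distinct_map by simp
qed (simp add: face_at_def)

lemma face_nonempty: "ord v \<noteq> [] \<Longrightarrow> face v \<noteq> []"
  using flen(1) by (simp add: face_eq)

lemma face_hd: "ord v \<noteq> [] \<Longrightarrow> hd (face v) = d0 v"
  using flen(1)[of v] by (simp add: face_eq hd_map)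

lemma face_last: "ord v \<noteq> [] \<Longrightarrow> last (face v) = (nd ^^ (flen v - 1)) (d0 v)"
  using flen(1)[of v] by (simp add: face_eq last_map)

lemma nd_last: "ord v \<noteq> [] \<Longrightarrow> nd (last (face v)) = d0 v"
proof -
  assume "ord v \<noteq> []"
  then have "nd (last (face v)) = (nd ^^ Suc (flen v - 1)) (d0 v)" by (simp add: face_last)
  then show ?thesis using flen[of v] by simp
qed

lemma tail_d0: "ord v \<noteq> [] \<Longrightarrow> tl_v (d0 v) = v"
proof -
  assume "ord v \<noteq> []"
  then have "hd (ord v) \<in> set (ord v)" by simp
  then show ?thesis by (auto simp: d0_def dtail_def set_ord)
qed

lemma head_last: "ord v \<noteq> [] \<Longrightarrow> hd_v (last (face v)) = v"
  using nd_tail[of "last (face v)"] by (simp add: nd_last tail_d0)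

lemma fst_last: "ord v \<noteq> [] \<Longrightarrow> fst (last (face v)) = last (ord v)"
proof -
  assume v: "ord v \<noteq> []"
  have "cyc_succ (ord v) (fst (last (face v))) = hd (ord v)"
    using nd_fst[of "last (face v)"] by (simp add: nd_last[OF v] head_last[OF v] d0_def)
  then show ?thesis
    using cyc_succ_hd[OF dist_ord] head_in[of "last (face v)"] head_last[OF v] by metis
qed

lemma cil_last: "ord v \<noteq> [] \<Longrightarrow> cil (last (face v))"
  by (simp add: passes_cilium_def head_last fst_last)

lemma face_orbit_last:
  assumes "ord v \<noteq> []" "d \<in> set (face v)"
  shows "last (face v) \<in> orbit d" "d \<in> orbit (d0 v)"
proof -
  obtain k where k: "k < flen v" "d = (nd ^^ k) (d0 v)" using assms by (auto simp: face_eq)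
  then show "last (face v) \<in> orbit d"
    unfolding face_last[OF assms(1)] k(2) by (intro orbit_pow) simp
  show "d \<in> orbit (d0 v)" using k by (auto simp: face_orbit_def)
qed

text \<open>The last dart already passes the one cilium of the face. At every earlier vertex the
  incoming and outgoing edge ends are thus neighbours in the linear order as well.\<close>

lemma face_no_cil: "ord v \<noteq> [] \<Longrightarrow> d \<in> set (butlast (face v)) \<Longrightarrow> \<not> cil d"
proof
  assume v: "ord v \<noteq> []" and d: "d \<in> set (butlast (face v))" "cil d"
  have "d \<in> set (face v)" "last (face v) \<in> set (face v)"
    using d face_nonempty[OF v] by (auto dest: in_set_butlastD)
  then have "d = last (face v)"
    using one_cilium[of d "d0 v" "last (face v)"] face_orbit_last(2)[OF v] d cil_last[OF v] by blast
  moreover have "distinct (butlast (face v) @ [last (face v)])"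
    using face_dist[of v] face_nonempty[OF v] by (simp add: distinct_map)
  ultimately show False using d by simp
qed

text \<open>A common dart would put the last darts of both faces in one orbit. Both pass a cilium,
  so they coincide, but they end at v and at w.\<close>

lemma face_disjoint:
  assumes "v \<noteq> w" "d \<in> set (face v)" "d \<in> set (face w)"
  shows False
proof -
  have "ord v \<noteq> []" "ord w \<noteq> []" using assms by (auto simp: face_at_def)
  then have "last (face v) = last (face w)"
    using assms face_orbit_last(1) cil_last one_cilium by meson
  then show False using head_last \<open>ord v \<noteq> []\<close> \<open>ord w \<noteq> []\<close> assms(1) by metis
qed

lemma face_succ: "ord v \<noteq> [] \<Longrightarrow> successively (\<lambda>d d'. d' = nd d) (face v)"
proof -
  assume "ord v \<noteq> []"
  moreover have "successively (\<lambda>d d'. d' = nd d) (map (\<lambda>k. (nd ^^ k) d) [0..<n])" for d n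
  proof (induction n)
    case (Suc n)
    then show ?case by (cases n) (simp_all add: successively_append_iff)
  qed simp
  ultimately show ?thesis by (simp add: face_eq)
qed

text \<open>The face leaves v by the lowest edge end and returns by the highest. As there are no
  loops, the middle part neither starts nor ends at v; it may still visit v in between, away from
  the cilium.\<close>

lemma face_split:
  assumes v: "ord v \<noteq> []"
  obtains mid xs where "face v = d0 v # mid @ [last (face v)]"
    "ord v = fst (d0 v) # xs @ [fst (last (face v))]"
    "mid \<noteq> [] \<Longrightarrow> tl_v (hd mid) \<noteq> v \<and> hd_v (last mid) \<noteq> v"
proof -
  have ne: "last (face v) \<noteq> d0 v"
    using head_last[OF v] tail_d0[OF v] head_tail by metis
  obtain r where r: "face v = d0 v # r"
    using face_nonempty[OF v] face_hd[OF v] by (metis list.collapse)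
  then have "r \<noteq> []" using ne by auto
  then have r2: "face v = d0 v # butlast r @ [last (face v)]" using r by simp
  have f: "fst (last (face v)) \<noteq> fst (d0 v)"
    using face_dist[of v] by (subst (asm) r2) auto
  obtain s where s: "ord v = fst (d0 v) # s" using v by (cases "ord v") (auto simp: d0_def)
  then have "s \<noteq> []" using f fst_last[OF v] by auto
  then have s2: "ord v = fst (d0 v) # butlast s @ [fst (last (face v))]" using s fst_last[OF v] by simp
  have "tl_v (hd (butlast r)) \<noteq> v \<and> hd_v (last (butlast r)) \<noteq> v" if m: "butlast r \<noteq> []"
  proof -
    have succ: "successively (\<lambda>d d'. d' = nd d) (d0 v # butlast r @ [last (face v)])"
      using face_succ[OF v] r2 by simp
    then have "hd (butlast r) = nd (d0 v)" "last (face v) = nd (last (butlast r))"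
      using m by (auto simp: successively_Cons successively_append_iff)
    then have "tl_v (hd (butlast r)) = hd_v (d0 v)" "hd_v (last (butlast r)) = tl_v (last (face v))"
      by (simp_all add: nd_tail)
    then show ?thesis using head_last[OF v] tail_d0[OF v] head_tail by metis
  qed
  then show ?thesis by (rule that[OF r2 s2])
qed

end

section \<open>Words of edge operators\<close>

context monoid
begin

primrec wrd :: "('x \<Rightarrow> 'a) \<Rightarrow> 'x list \<Rightarrow> 'a" where
  "wrd P [] = \<^bold>1"
| "wrd P (x # xs) = P x \<^bold>* wrd P xs"

lemma wrd_append: "wrd P (xs @ ys) = wrd P xs \<^bold>* wrd P ys"
  by (induction xs) (simp_all add: assoc)

lemma wrd_comm: "(\<And>x. x \<in> set xs \<Longrightarrow> g \<^bold>* P x = P x \<^bold>* g) \<Longrightarrow> g \<^bold>* wrd P xs = wrd P xs \<^bold>* g"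
proof (induction xs)
  case (Cons x xs)
  then have 1: "g \<^bold>* P x = P x \<^bold>* g" and 2: "g \<^bold>* wrd P xs = wrd P xs \<^bold>* g" by auto
  have "g \<^bold>* (P x \<^bold>* wrd P xs) = P x \<^bold>* (g \<^bold>* wrd P xs)" by (simp only: assoc[symmetric] 1)
  then show ?case by (simp add: 2 assoc)
qed simp

lemma comm_left: "g \<^bold>* x = x \<^bold>* g \<Longrightarrow> g \<^bold>* (x \<^bold>* y) = x \<^bold>* (g \<^bold>* y)"
  by (simp only: assoc[symmetric])

lemma rule_left: "g \<^bold>* x = x \<^bold>* (w \<^bold>* g) \<Longrightarrow> g \<^bold>* (x \<^bold>* y) = x \<^bold>* (w \<^bold>* (g \<^bold>* y))"
  by (simp only: assoc[symmetric])

lemma comm_mult: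
  assumes a: "a \<^bold>* g = g \<^bold>* a" and b: "b \<^bold>* g = g \<^bold>* b"
  shows "(a \<^bold>* b) \<^bold>* g = g \<^bold>* (a \<^bold>* b)"
proof -
  have "(a \<^bold>* b) \<^bold>* g = a \<^bold>* (g \<^bold>* b)" by (simp only: assoc b)
  also have "\<dots> = g \<^bold>* (a \<^bold>* b)" by (simp only: assoc[symmetric] a)
  finally show ?thesis .
qed

text \<open>Moving \<open>ga\<close> past \<open>pa\<close> creates a w just in front of
  \<open>pb\<close>; moving \<open>gb\<close> past \<open>w\<close> and \<open>pb\<close> absorbs
  it. Thus w disappears without having to be invertible.\<close>

lemma block_comm:
  assumes a: "ga \<^bold>* pa = pa \<^bold>* (w \<^bold>* ga)" and b: "pb \<^bold>* gb = gb \<^bold>* (w \<^bold>* pb)"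
    and c: "gb \<^bold>* pa = pa \<^bold>* gb" "ga \<^bold>* pb = pb \<^bold>* ga" "ga \<^bold>* x = x \<^bold>* ga" "ga \<^bold>* y = y \<^bold>* ga"
      "gb \<^bold>* x = x \<^bold>* gb" "gb \<^bold>* y = y \<^bold>* gb"
  shows "(gb \<^bold>* ga) \<^bold>* (x \<^bold>* (pa \<^bold>* (pb \<^bold>* y))) = (x \<^bold>* (pa \<^bold>* (pb \<^bold>* y))) \<^bold>* (gb \<^bold>* ga)"
proof -
  have "(gb \<^bold>* ga) \<^bold>* (x \<^bold>* (pa \<^bold>* (pb \<^bold>* y))) = x \<^bold>* (pa \<^bold>* (gb \<^bold>* (w \<^bold>* (pb \<^bold>* (ga \<^bold>* y)))))"
    by (simp only: assoc rule_left[OF a] c(1)[THEN comm_left] c(2)[THEN comm_left] c(3)[THEN comm_left] c(5)[THEN comm_left])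
  also have "\<dots> = x \<^bold>* (pa \<^bold>* (pb \<^bold>* (gb \<^bold>* (ga \<^bold>* y))))"
    by (simp only: rule_left[OF b])
  also have "\<dots> = (x \<^bold>* (pa \<^bold>* (pb \<^bold>* y))) \<^bold>* (gb \<^bold>* ga)"
    by (simp only: assoc c(4) c(6)[THEN comm_left])
  finally show ?thesis .
qed

text \<open>At the cilium the face departs along the first letter of the vertex word and arrives
  along the last. The w on the left is absorbed by \<open>pn\<close> and \<open>gn\<close>, and a
  new one is created by \<open>p1\<close> and \<open>g1\<close> on the other side.\<close>

lemma cilium_relation:
  assumes n: "gn \<^bold>* pn = pn \<^bold>* (w \<^bold>* gn)" and one: "p1 \<^bold>* g1 = g1 \<^bold>* (w \<^bold>* p1)"
    and c: "gn \<^bold>* p1 = p1 \<^bold>* gn" "gn \<^bold>* m = m \<^bold>* gn" "g1 \<^bold>* m = m \<^bold>* g1" "g1 \<^bold>* pn = pn \<^bold>* g1"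
    and b: "b \<^bold>* (p1 \<^bold>* (m \<^bold>* pn)) = (p1 \<^bold>* (m \<^bold>* pn)) \<^bold>* b"
  shows "(p1 \<^bold>* (m \<^bold>* pn)) \<^bold>* (w \<^bold>* (gn \<^bold>* (b \<^bold>* g1))) = (gn \<^bold>* (b \<^bold>* g1)) \<^bold>* (w \<^bold>* (p1 \<^bold>* (m \<^bold>* pn)))"
proof -
  have "(p1 \<^bold>* (m \<^bold>* pn)) \<^bold>* (w \<^bold>* (gn \<^bold>* (b \<^bold>* g1))) = p1 \<^bold>* (m \<^bold>* (gn \<^bold>* (pn \<^bold>* (b \<^bold>* g1))))"
    by (simp only: assoc rule_left[OF n])
  also have "\<dots> = gn \<^bold>* ((p1 \<^bold>* (m \<^bold>* pn)) \<^bold>* b \<^bold>* g1)"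
    by (simp only: assoc c(1)[THEN comm_left] c(2)[THEN comm_left])
  also have "\<dots> = gn \<^bold>* (b \<^bold>* (p1 \<^bold>* (m \<^bold>* (pn \<^bold>* g1))))"
    by (simp only: assoc comm_left[OF b, of g1, unfolded assoc])
  also have "\<dots> = gn \<^bold>* (b \<^bold>* (p1 \<^bold>* (g1 \<^bold>* (m \<^bold>* pn))))"
    by (simp only: c(3)[THEN comm_left] c(4)[symmetric])
  also have "\<dots> = (gn \<^bold>* (b \<^bold>* g1)) \<^bold>* (w \<^bold>* (p1 \<^bold>* (m \<^bold>* pn)))"
    by (simp only: rule_left[OF one] assoc)
  finally show ?thesis .
qed

end

text \<open>The graph part is separated from the algebra: it needs three relations in a monoid. The
  monoid will be the convolution algebra, in which one letter stands for a whole family of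
  operators.\<close>

locale word_graph = reg_graph src tgt ord + monoid f z
  for src tgt :: "'e::finite \<Rightarrow> 'v::finite" and ord :: "'v \<Rightarrow> 'e list"
    and f :: "'a \<Rightarrow> 'a \<Rightarrow> 'a" (infixl "\<^bold>*" 70) and z :: 'a ("\<^bold>1") +
  fixes P :: "'e \<times> bool \<Rightarrow> 'a" and G :: "'e \<times> bool \<Rightarrow> 'a" and W :: 'a
  assumes arr_rel: "G (e, s) \<^bold>* P (e, s) = P (e, s) \<^bold>* (W \<^bold>* G (e, s))"
    and dep_rel: "P (e, s) \<^bold>* G (e, \<not> s) = G (e, \<not> s) \<^bold>* (W \<^bold>* P (e, s))"
    and PG_comm: "e \<noteq> e' \<Longrightarrow> G (e, s) \<^bold>* P (e', s') = P (e', s') \<^bold>* G (e, s)"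
begin

abbreviation "Pv v e \<equiv> P (e, tgt e = v)"
abbreviation "vword v \<equiv> wrd (Pv v) (ord v)"
abbreviation "fword ds \<equiv> wrd G (rev ds)"

lemma arr_rel': "hd_v d = v \<Longrightarrow> fst d = e \<Longrightarrow> G d \<^bold>* Pv v e = Pv v e \<^bold>* (W \<^bold>* G d)"
  using arr_rel[of e "snd d"] snd_head[of d v] by (cases d) simp

lemma dep_rel': "tl_v d = v \<Longrightarrow> fst d = e \<Longrightarrow> Pv v e \<^bold>* G d = G d \<^bold>* (W \<^bold>* Pv v e)"
  using dep_rel[of e "tgt e = v"] snd_tail[of d v] by (cases d) simp

lemma PG_comm': "fst d \<noteq> e \<Longrightarrow> G d \<^bold>* Pv v e = Pv v e \<^bold>* G d"
  using PG_comm[of "fst d" e "snd d"] by simp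

text \<open>Induction that removes one dart not touching w, or a pair arriving at w and leaving it
  again. Requiring that no segment starts at w keeps such pairs together.\<close>

lemma segment_comm:
  assumes "successively (\<lambda>d d'. d' = nd d) ds"
    and "\<forall>d\<in>set ds. hd_v d = w \<longrightarrow> \<not> cil d"
    and "ds \<noteq> [] \<Longrightarrow> tl_v (hd ds) \<noteq> w \<and> hd_v (last ds) \<noteq> w"
  shows "fword ds \<^bold>* vword w = vword w \<^bold>* fword ds"
  using assms
proof (induction ds rule: length_induct)
  case (1 ds)
  show ?case
  proof (cases ds)
    case Nil
    then show ?thesis by simp
  next
    case (Cons d ds')
    have tl: "tl_v d \<noteq> w" using 1 Cons by simp
    have app: "fword (xs @ ys) = fword ys \<^bold>* fword xs" for xs ys
      by (simp add: wrd_append)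
    have step: ?thesis if "ds = pre @ rest" "pre \<noteq> []" "fword pre \<^bold>* vword w = vword w \<^bold>* fword pre"
      "rest \<noteq> [] \<Longrightarrow> tl_v (hd rest) \<noteq> w" for pre rest
    proof -
      have "successively (\<lambda>d d'. d' = nd d) rest"
        using 1(2) that(1) by (simp add: successively_append_iff)
      moreover have "length rest < length ds" "\<forall>d\<in>set rest. hd_v d = w \<longrightarrow> \<not> cil d"
        using that(1,2) 1(3) by auto
      moreover have "rest \<noteq> [] \<longrightarrow> tl_v (hd rest) \<noteq> w \<and> hd_v (last rest) \<noteq> w"
        using that(1,4) 1(4) by auto
      ultimately have IH: "fword rest \<^bold>* vword w = vword w \<^bold>* fword rest"
        using 1(1)[THEN spec, of rest] by iprover
      show ?thesis unfolding that(1) app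
        by (rule comm_mult[OF IH that(3)])
    qed
    show ?thesis
    proof (cases "hd_v d = w")
      case False
      \<comment> \<open>Neither end of d is w, so no letter of the vertex word lies on its
        edge.\<close>
      have nin: "fst d \<notin> set (ord w)" using ord_cases[of d w] tl False by auto
      have "G d \<^bold>* vword w = vword w \<^bold>* G d"
        by (intro wrd_comm PG_comm') (use nin in auto)
      moreover have "tl_v (hd ds') \<noteq> w" if "ds' \<noteq> []"
        using 1(2) Cons that nd_tail[of d] False by (auto simp: successively_Cons)
      ultimately show ?thesis
        by (intro step[of "[d]" ds']) (simp_all add: Cons)
    next
      case True
      have "ds' \<noteq> []" using 1(4) Cons True by auto
      then obtain d' r where ds': "ds' = d' # r" by (cases ds') auto
      have d': "d' = nd d" using 1(2) Cons ds' by simp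
      \<comment> \<open>Away from the cilium the cyclic successor is the linear one, so the edges of
        d and of the next dart are adjacent letters of \<open>vword w\<close>.\<close>
      have "\<not> cil d" using 1(3) Cons True by simp
      then have "fst d \<noteq> last (ord w)" using True by (simp add: passes_cilium_def)
      moreover have "fst d \<in> set (ord w)" using head_in[of d] True by simp
      ultimately obtain xs ys where o: "ord w = xs @ fst d # cyc_succ (ord w) (fst d) # ys"
        using cyc_succ_split[OF dist_ord] by metis
      have o: "ord w = xs @ fst d # fst d' # ys" using o nd_fst[of d] True d' by simp
      have t': "tl_v d' = w" using nd_tail[of d] True d' by simp
      have dist: "distinct (xs @ fst d # fst d' # ys)" using dist_ord[of w] o by simp
      have "(G d' \<^bold>* G d) \<^bold>* (wrd (Pv w) xs \<^bold>* (Pv w (fst d) \<^bold>* (Pv w (fst d') \<^bold>* wrd (Pv w) ys)))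
        = (wrd (Pv w) xs \<^bold>* (Pv w (fst d) \<^bold>* (Pv w (fst d') \<^bold>* wrd (Pv w) ys))) \<^bold>* (G d' \<^bold>* G d)"
        by (rule block_comm, rule arr_rel'[OF True refl], rule dep_rel'[OF t' refl])
          (use dist in \<open>auto intro!: PG_comm' wrd_comm\<close>)
      then have "fword [d, d'] \<^bold>* vword w = vword w \<^bold>* fword [d, d']"
        by (simp add: o wrd_append)
      moreover have "tl_v (hd r) \<noteq> w" if "r \<noteq> []"
        using 1(2) Cons ds' that nd_tail[of d'] head_tail[of d'] t' by (auto simp: successively_Cons)
      ultimately show ?thesis
        by (intro step[of "[d, d']" r]) (simp_all add: Cons ds')
    qed
  qed
qed

lemma face_vertex_comm:
  assumes "v \<noteq> w"
  shows "fword (face v) \<^bold>* vword w = vword w \<^bold>* fword (face v)"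
proof (cases "ord v = []")
  case True
  then show ?thesis by (simp add: face_at_def)
next
  case v: False
  show ?thesis
  proof (rule segment_comm)
    show "successively (\<lambda>d d'. d' = nd d) (face v)" by (rule face_succ[OF v])
    show "\<forall>d\<in>set (face v). hd_v d = w \<longrightarrow> \<not> cil d"
    proof (intro ballI impI)
      fix d assume d: "d \<in> set (face v)" "hd_v d = w"
      then have "d \<noteq> last (face v)" using head_last[OF v] assms by auto
      with d have "d \<in> set (butlast (face v))"
        using face_nonempty[OF v] by (metis append_butlast_last_id in_set_conv_decomp rotate1.simps(2) set_ConsD set_rotate1)
      then show "\<not> cil d" by (rule face_no_cil[OF v])
    qed
    show "tl_v (hd (face v)) \<noteq> w \<and> hd_v (last (face v)) \<noteq> w"
      using face_hd[OF v] tail_d0[OF v] head_last[OF v] assms by simp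
  qed
qed

lemma face_vertex_straighten: "vword v \<^bold>* (W \<^bold>* fword (face v)) = fword (face v) \<^bold>* (W \<^bold>* vword v)"
proof (cases "ord v = []")
  case True
  then show ?thesis by (simp add: face_at_def)
next
  case v: False
  obtain mid xs where fs: "face v = d0 v # mid @ [last (face v)]"
    and os: "ord v = fst (d0 v) # xs @ [fst (last (face v))]"
    and ends: "mid \<noteq> [] \<Longrightarrow> tl_v (hd mid) \<noteq> v \<and> hd_v (last mid) \<noteq> v"
    by (rule face_split[OF v]) blast
  define dl where "dl = last (face v)"
  have dist: "distinct (fst (d0 v) # xs @ [fst dl])" using dist_ord[of v] os dl_def by simp
  have fs': "face v = d0 v # mid @ [dl]" and os': "ord v = fst (d0 v) # xs @ [fst dl]"
    using fs os by (simp_all add: dl_def)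
  have mid: "fword mid \<^bold>* vword v = vword v \<^bold>* fword mid"
  proof (rule segment_comm)
    have "successively (\<lambda>d d'. d' = nd d) (d0 v # mid @ [dl])"
      using face_succ[OF v] fs' by simp
    then show "successively (\<lambda>d d'. d' = nd d) mid"
      by (auto simp: successively_Cons successively_append_iff)
    have "set mid \<subseteq> set (butlast (face v))" by (auto simp: fs' butlast_append)
    then show "\<forall>d\<in>set mid. hd_v d = v \<longrightarrow> \<not> cil d" using face_no_cil[OF v] by blast
  qed (rule ends)
  have vw: "vword v = Pv v (fst (d0 v)) \<^bold>* (wrd (Pv v) xs \<^bold>* Pv v (fst dl))"
    by (simp add: os' wrd_append)
  have fw: "fword (face v) = G dl \<^bold>* (fword mid \<^bold>* G (d0 v))"
    by (simp add: fs' wrd_append)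
  have 1: "G dl \<^bold>* Pv v (fst dl) = Pv v (fst dl) \<^bold>* (W \<^bold>* G dl)"
    by (rule arr_rel') (simp_all add: dl_def head_last[OF v])
  have 2: "Pv v (fst (d0 v)) \<^bold>* G (d0 v) = G (d0 v) \<^bold>* (W \<^bold>* Pv v (fst (d0 v)))"
    by (rule dep_rel') (simp_all add: tail_d0[OF v])
  show ?thesis
    unfolding vw fw
    by (rule cilium_relation[OF 1 2]) (use dist mid[unfolded vw] in \<open>auto intro!: PG_comm' wrd_comm\<close>)
qed

end

section \<open>The action at a single vertex\<close>

lemma cword_comm:
  assumes "\<And>x a. x \<in> set xs \<Longrightarrow> T * g x a = g x a * T"
  shows "T * cword K (map g xs) a = cword K (map g xs) a * T"
  using assms
proof (induction xs arbitrary: a)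
  case (Cons x xs)
  have "T * (g x a1 * cword K (map g xs) a2) = g x a1 * cword K (map g xs) a2 * T" for a1 a2
  proof -
    have "T * (g x a1 * cword K (map g xs) a2) = g x a1 * (T * cword K (map g xs) a2)"
      using Cons.prems[of x a1] by (simp add: mult.assoc[symmetric])
    also have "T * cword K (map g xs) a2 = cword K (map g xs) a2 * T"
      using Cons by auto
    finally show ?thesis by (simp add: mult.assoc)
  qed
  then show ?case by (simp add: cnv_def sum_distribs)
qed simp

lemma counit_alg_hom:
  assumes "hopf_algebra K"
  shows "alg_hom K (\<lambda>a. scl (hcounit K a) 1)"
  by (simp add: alg_hom_def alg_fam_def sum_scl[symmetric] hopf_counit_mult[OF assms] hopf_counit_unit[OF assms])
     (simp add: mult.commute)

lemma cword_alg_hom: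
  fixes K :: "('i::finite, 'k::field) hopf"
  assumes K: "hopf_algebra K" and "\<And>x. x \<in> set xs \<Longrightarrow> alg_hom K (g x)"
    and "\<And>x y a b. x \<in> set xs \<Longrightarrow> y \<in> set xs \<Longrightarrow> x \<noteq> y \<Longrightarrow> g x a * g y b = g y b * g x a"
    and "distinct xs"
  shows "alg_hom K (cword K (map g xs))"
  using assms(2-)
proof (induction xs)
  case Nil
  show ?case by (simp add: counit_alg_hom[OF K])
next
  case (Cons x xs)
  have "alg_hom K (cnv (hcomul K) (g x) (cword K (map g xs)))"
  proof (rule cnv_alg_hom[OF K])
    show "alg_hom K (g x)" using Cons by simp
    show "alg_hom K (cword K (map g xs))" using Cons by simp
    fix a b
    show "g x a * cword K (map g xs) b = cword K (map g xs) b * g x a"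
    proof (rule cword_comm)
      fix y c assume "y \<in> set xs"
      with Cons.prems(3) have "x \<noteq> y" by auto
      then show "g x a * g y c = g y c * g x a"
        using Cons.prems(2)[of x y] \<open>y \<in> set xs\<close> by simp
    qed
  qed
  then show ?case by simp
qed

lemma coalgebra_flip:
  assumes "coalgebra D e"
  shows "coalgebra (\<lambda>c a b. D c b a) e"
  unfolding coalgebra_def
proof (intro conjI allI)
  fix a b1 b2 c
  have "(\<Sum>d. D a d b1 * D d c b2) = (\<Sum>d. D a c d * D d b2 b1)"
    using assms unfolding coalgebra_def by blast
  then show "(\<Sum>d. D a c d * D d b2 b1) = (\<Sum>d. D a d b1 * D d c b2)" by simp
qed (use assms in \<open>auto simp: coalgebra_def\<close>)

text \<open>Conjugation X -> p'(c_(2)) X p(c_(1)). For face holonomies D will be the flipped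
  coproduct, because there the first leg stands on the left.\<close>

definition Ad :: "('c::finite \<Rightarrow> 'c \<Rightarrow> 'c \<Rightarrow> 'k::comm_ring_1) \<Rightarrow> ('c \<Rightarrow> ('n::finite, 'k) sqm) \<Rightarrow> ('c \<Rightarrow> ('n, 'k) sqm)
    \<Rightarrow> 'c \<Rightarrow> ('n, 'k) sqm \<Rightarrow> ('n, 'k) sqm" where
  "Ad D p p' c X = (\<Sum>a b. scl (D c a b) (p' b * X * p a))"

text \<open>The inner factor collapses: with Sweedler indices the right-hand side is
  p'(c4) Y p(c3) p'(c2) X p(c1).\<close>

lemma Ad_mult:
  fixes D :: "'c::finite \<Rightarrow> 'c \<Rightarrow> 'c \<Rightarrow> 'k::comm_ring_1"
  assumes co: "coalgebra D e" and inv: "\<And>c. (\<Sum>a b. scl (D c a b) (p b * p' a)) = scl (e c) 1"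
  shows "Ad D p p' c (Y * X) = (\<Sum>a b. scl (D c a b) (Ad D p p' b Y * Ad D p p' a X))"
proof -
  have cas: "(\<Sum>d. D a d c * D d b1 b2) = (\<Sum>d. D a b1 d * D d b2 c)" for a b1 b2 c
    using co unfolding coalgebra_def by blast
  have "(\<Sum>a b. scl (D c a b) (Ad D p p' b Y * Ad D p p' a X)) =
    (\<Sum>a1 b a2 b1 b2 a. scl (D c a b * D a a1 a2 * D b b1 b2) (p' b2 * Y * (p b1 * p' a2) * X * p a1))"
    by (simp add: Ad_def sum_distribs scl_sum mult.assoc, simp only: sum_nested,
      rule sum_permute[of "\<lambda>(a,b,a1,a2,b1,b2). (a1,b,a2,b1,b2,a)"])
      (auto simp: ac_simps)
  also have "\<dots> = (\<Sum>a1 b a2 b1 b2. scl ((\<Sum>a. D c a b * D a a1 a2) * D b b1 b2) (p' b2 * Y * (p b1 * p' a2) * X * p a1))"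
    by (simp only: sum_scl sum_distrib_right)
  also have "\<dots> = (\<Sum>a1 b a2 b1 b2. scl ((\<Sum>d. D c a1 d * D d a2 b) * D b b1 b2) (p' b2 * Y * (p b1 * p' a2) * X * p a1))"
    by (simp only: cas)
  also have "\<dots> = (\<Sum>a1 d a2 b1 b2. scl (D c a1 d * (\<Sum>b. D d a2 b * D b b1 b2)) (p' b2 * Y * (p b1 * p' a2) * X * p a1))"
    by (simp only: sum_scl sum_distribs, simp only: sum_nested,
      rule sum_permute[of "\<lambda>(a1,b,a2,b1,b2,d). (a1,d,a2,b1,b2,b)"])
      (auto simp: ac_simps)
  also have "\<dots> = (\<Sum>a1 d a2 b1 b2. scl (D c a1 d * (\<Sum>b. D d b b2 * D b a2 b1)) (p' b2 * Y * (p b1 * p' a2) * X * p a1))"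
    by (simp only: cas)
  also have "\<dots> = (\<Sum>a1 d b2 b. scl (D c a1 d * D d b b2) (p' b2 * Y * (\<Sum>a2 b1. scl (D b a2 b1) (p b1 * p' a2)) * X * p a1))"
    by (simp only: sum_scl sum_distribs scl_sum mult_scl scl_simps(4), simp only: sum_nested,
      rule sum_permute[of "\<lambda>(a1,d,a2,b1,b2,b). (a1,d,b2,b,a2,b1)"])
      (auto simp: ac_simps)
  also have "\<dots> = (\<Sum>a1 d b2. scl (D c a1 d * (\<Sum>b. e b * D d b b2)) (p' b2 * Y * X * p a1))"
    by (simp add: inv sum_scl sum_distrib_left ac_simps)
  also have "\<dots> = (\<Sum>a1 d b2. scl (bas d b2) (scl (D c a1 d) (p' b2 * Y * X * p a1)))"
    using co by (simp add: coalgebra_def mult.commute)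
  also have "\<dots> = Ad D p p' c (Y * X)"
    unfolding scl_bas by (simp add: Ad_def mult.assoc)
  finally show ?thesis by simp
qed

lemma Ad_one:
  assumes "\<And>c. (\<Sum>a b. scl (D c a b) (p' b * p a)) = scl (e c) 1"
  shows "Ad D p p' c 1 = scl (e c) 1"
  using assms by (simp add: Ad_def)

section \<open>Representations of the Drinfeld double from straightening pairs\<close>

definition dbl :: "('i \<Rightarrow> ('n::finite, 'k::comm_ring_1) sqm) \<Rightarrow> ('i \<Rightarrow> ('n, 'k) sqm) \<Rightarrow> 'i \<times> 'i \<Rightarrow> ('n, 'k) sqm" where
  "dbl q p = (\<lambda>(a, b). q a * p b)"

context inv_hopf
begin

lemma antip_antihom:
  assumes r: "\<And>a b. r a * r b = (\<Sum>c. scl (hmul H b a c) (r c))"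
    and u: "(\<Sum>c. scl (hunit H c) (r c)) = 1"
  shows "alg_hom H (antip H r)"
  unfolding alg_hom_def alg_fam_def
proof (intro conjI allI)
  fix a b
  have "antip H r a * antip H r b = (\<Sum>c. scl (\<Sum>p q. hanti H b p * hanti H a q * hmul H p q c) (r c))"
    by (simp add: antip_def sum_distribs scl_sum sum_scl r, simp only: sum_nested,
      rule sum_permute[of "\<lambda>(p,q,c). (c,p,q)"]) (auto simp: ac_simps)
  also have "\<dots> = (\<Sum>c. scl (hmul H a b c) (antip H r c))"
    unfolding hanti_mult[OF H, symmetric] by (simp add: antip_def sum_scl scl_sum) (rule sum.swap)
  finally show "antip H r a * antip H r b = (\<Sum>c. scl (hmul H a b c) (antip H r c))" .
  have "(\<Sum>c. scl (hunit H c) (antip H r c)) = (\<Sum>b. scl (\<Sum>c. hunit H c * hanti H c b) (r b))"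
    by (simp add: antip_def sum_scl scl_sum) (rule sum.swap)
  then show "(\<Sum>c. scl (hunit H c) (antip H r c)) = 1" by (simp add: hanti_unit[OF H] u)
qed

text \<open>Replacing y and gamma by S(y) and S(gamma) reverses both coproducts and, as S^2 = id,
  preserves the pairing; so S can be moved from the legs to the arguments.\<close>

lemma antip_core1:
  "(\<Sum>x a b. hcomul H y a x * hmul H x b g * hanti H a a' * hanti H b' b)
   = (\<Sum>t y' g'. hanti H y y' * hanti H g' g * hcomul H y' t a' * hmul H b' t g')"
proof -
  have "(\<Sum>t y' g'. hanti H y y' * hanti H g' g * hcomul H y' t a' * hmul H b' t g')
    = (\<Sum>t. (\<Sum>c. hanti H y c * hcomul H c t a') * (\<Sum>c. hmul H b' t c * hanti H c g))"
    by (simp only: sum_product) (intro sum.cong refl, simp add: ac_simps)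
  also have "\<dots> = (\<Sum>t. (\<Sum>p q. hcomul H y p q * hanti H p a' * hanti H q t) * (\<Sum>x b. hanti H t x * hanti H b' b * hmul H x b g))"
    by (simp only: hanti_comult[OF H] hanti_mult[OF H])
  also have "\<dots> = (\<Sum>a b q x. hcomul H y a q * hanti H a a' * hanti H b' b * hmul H x b g * (\<Sum>t. hanti H q t * hanti H t x))"
    by (simp only: sum_distribs, simp only: sum_nested,
      rule sum_permute[of "\<lambda>(t,x,b,a,q). (a,b,q,x,t)"]) (auto simp: ac_simps)
  also have "\<dots> = (\<Sum>a b q. hcomul H y a q * hanti H a a' * hanti H b' b * hmul H q b g)"
    by (simp only: hanti_hanti sum_bas)
  also have "\<dots> = (\<Sum>x a b. hcomul H y a x * hmul H x b g * hanti H a a' * hanti H b' b)"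
    by (simp only: sum_nested,
      rule sum_permute[of "\<lambda>(a,b,x). (x,a,b)"]) (auto simp: ac_simps)
  finally show "(\<Sum>x a b. hcomul H y a x * hmul H x b g * hanti H a a' * hanti H b' b)
   = (\<Sum>t y' g'. hanti H y y' * hanti H g' g * hcomul H y' t a' * hmul H b' t g')" by simp
qed

lemmas antip_core = antip_core1 inv_hopf.antip_core1[OF dual_inv, unfolded dual_simps]

text \<open>The assumption is the straightening relation in the opposite algebra, as left
  multiplications satisfy it. By \<open>antip_core\<close> composing with the antipodes reverses the
  coproducts too, and the two reversals compensate.\<close>

lemma antip_straighten:
  assumes *: "\<And>y g. (\<Sum>a x b. scl (hcomul H y a x * hmul H x b g) (s b * r a))
     = (\<Sum>a x b. scl (hmul H a x g * hcomul H y x b) (r b * s a))"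
  shows "straighten H (antip H r) (antip (dual H) s)"
  unfolding straighten_def
proof (intro allI)
  fix y g
  have "(\<Sum>a x b. scl (hcomul H y a x * hmul H x b g) (antip H r a * antip (dual H) s b))
    = (\<Sum>a' b'. scl (\<Sum>x a b. hcomul H y a x * hmul H x b g * hanti H a a' * hanti H b' b) (r a' * s b'))"
    by (simp add: antip_def sum_distribs scl_sum sum_scl, simp only: sum_nested,
      rule sum_permute[of "\<lambda>(a,x,b,b',a'). (a',b',x,a,b)"]) (auto simp: ac_simps)
  also have "\<dots> = (\<Sum>y' g'. scl (hanti H y y' * hanti H g' g)
       (\<Sum>a x b. scl (hmul H a x g' * hcomul H y' x b) (r b * s a)))"
    unfolding antip_core
    by (simp add: scl_sum sum_scl, simp only: sum_nested,
      rule sum_permute[of "\<lambda>(b,a,x,y',g'). (y',g',a,x,b)"]) (auto simp: ac_simps)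
  also have "\<dots> = (\<Sum>y' g'. scl (hanti H y y' * hanti H g' g)
       (\<Sum>a x b. scl (hcomul H y' a x * hmul H x b g') (s b * r a)))"
    by (simp only: *)
  also have "\<dots> = (\<Sum>a' b'. scl (\<Sum>x a b. hmul H a x g * hcomul H y x b * hanti H a' a * hanti H b b') (s a' * r b'))"
    unfolding antip_core
    by (simp add: scl_sum sum_scl, simp only: sum_nested,
      rule sum_permute[of "\<lambda>(y',g',b',x,a'). (a',b',x,g',y')"]) (auto simp: ac_simps)
  also have "\<dots> = (\<Sum>a x b. scl (hmul H a x g * hcomul H y x b) (antip (dual H) s a * antip H r b))"
    by (simp add: antip_def sum_distribs scl_sum sum_scl, simp only: sum_nested,
      rule sum_permute[of "\<lambda>(a',b',x,a,b). (a,x,b,b',a')"]) (auto simp: ac_simps)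
  finally show "(\<Sum>a x b. scl (hcomul H y a x * hmul H x b g) (antip H r a * antip (dual H) s b)) = \<dots>" .
qed

text \<open>P P' W Q' Q = P Q' W P' Q = Q' P W Q P' = Q' Q W P P'. The pairs are nested, hence the
  order q', q.\<close>

lemma straighten_prod:
  fixes p q p' q' :: "'i \<Rightarrow> ('n::finite, 'k) sqm"
  assumes 1: "straighten H p q" and 2: "straighten H p' q'"
    and c: "\<And>a b. p a * q' b = q' b * p a" "\<And>a b. p' a * q b = q b * p' a"
  shows "straighten H (cnv (hcomul H) p p') (cnv (hcomul (dual H)) q' q)"
proof -
  interpret monoid "hconv H" "\<lambda>c. scl (case c of (a, b) \<Rightarrow> hcounit H a * hcounit (dual H) b) (1 :: ('n, 'k) sqm)"
    by (rule hconv_monoid[OF H])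
  note b = 1[unfolded straighten_iff[OF H]] 2[unfolded straighten_iff[OF H]]
  have c1: "hconv H (vlift H p) (flift H q') = hconv H (flift H q') (vlift H p)" using c(1) by (subst comm_iff[OF H, symmetric]) simp
  have c2: "hconv H (vlift H p') (flift H q) = hconv H (flift H q) (vlift H p')" using c(2) by (subst comm_iff[OF H, symmetric]) simp
  let ?P = "vlift H p" and ?P' = "vlift H p'" and ?Q = "flift H q" and ?Q' = "flift H q'"
  have "hconv H (hconv H ?P ?P') (hconv H Wfam (hconv H ?Q' ?Q)) = hconv H ?P (hconv H (hconv H ?P' (hconv H Wfam ?Q')) ?Q)"
    by (simp only: assoc)
  also have "\<dots> = hconv H (hconv H ?P ?Q') (hconv H Wfam (hconv H ?P' ?Q))"
    unfolding b(2) by (simp only: assoc)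
  also have "\<dots> = hconv H ?Q' (hconv H (hconv H ?P (hconv H Wfam ?Q)) ?P')"
    unfolding c1 c2 by (simp only: assoc)
  also have "\<dots> = hconv H (hconv H ?Q' ?Q) (hconv H Wfam (hconv H ?P ?P'))"
    unfolding b(1) by (simp only: assoc)
  finally show ?thesis
    by (simp only: straighten_iff[OF H] cnv_liftl_liftl[OF hopf_coalgebras[OF H]] cnv_liftr_liftr[OF hopf_coalgebras[OF H]])
qed

text \<open>From \<open>P W Q = Q W P\<close> to the multiplication rule of the double:
  \<open>\<langle>a\<^sub>3, b\<^sub>1\<rangle> q(a\<^sub>2) p(b\<^sub>2) \<langle>S a\<^sub>1, b\<^sub>3\<rangle> = p(b\<^sub>1) \<langle>a\<^sub>2, b\<^sub>2\<rangle> q(a\<^sub>3) \<langle>S a\<^sub>1, b\<^sub>3\<rangle> = p(b) q(a)\<close>,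
  since the two pairings combine to \<open>\<langle>a\<^sub>2 S a\<^sub>1, b\<^sub>2\<rangle>\<close>.\<close>

lemma straighten_exchange:
  assumes "straighten H p q"
  shows "p b * q a = (\<Sum>p' q' r s u w y. scl (hmul H p' q' a * hmul H r s q' * hcomul H b s u * hcomul H u w y * hanti H y p') (q r * p w))"
proof -
  have B: "(\<Sum>r s w. scl (hmul H r s g * hcomul H y s w) (q r * p w))
     = (\<Sum>w x r. scl (hcomul H y w x * hmul H x r g) (p w * q r))" for y g
    using assms by (simp add: straighten_def)
  have "(\<Sum>p' q' r s u w y. scl (hmul H p' q' a * hmul H r s q' * hcomul H b s u * hcomul H u w y * hanti H y p') (q r * p w))
    = (\<Sum>p' q' r s w y. scl (hmul H p' q' a * hmul H r s q' * hanti H y p' * (\<Sum>u. hcomul H b s u * hcomul H u w y)) (q r * p w))"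
    by (simp only: sum_scl sum_distrib_left, simp only: sum_nested,
      rule sum_permute[of "\<lambda>(p',q',r,s,u,w,y). (p',q',r,s,w,y,u)"])
       (auto simp: ac_simps)
  also have "\<dots> = (\<Sum>p' q' r s w y. scl (hmul H p' q' a * hmul H r s q' * hanti H y p' * (\<Sum>u. hcomul H b u y * hcomul H u s w)) (q r * p w))"
    by (simp only: hopf_coassoc[OF H])
  also have "\<dots> = (\<Sum>p' q' u y. scl (hmul H p' q' a * hcomul H b u y * hanti H y p')
       (\<Sum>r s w. scl (hmul H r s q' * hcomul H u s w) (q r * p w)))"
    by (simp only: sum_scl sum_distrib_left scl_sum scl_simps(4), simp only: sum_nested,
      rule sum_permute[of "\<lambda>(p',q',r,s,w,y,u). (p',q',u,y,r,s,w)"])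
       (auto simp: ac_simps)
  also have "\<dots> = (\<Sum>p' q' u y. scl (hmul H p' q' a * hcomul H b u y * hanti H y p')
       (\<Sum>w x r. scl (hcomul H u w x * hmul H x r q') (p w * q r)))"
    by (simp only: B)
  also have "\<dots> = (\<Sum>w r p' x y. scl (hanti H y p' * (\<Sum>u. hcomul H b u y * hcomul H u w x)
       * (\<Sum>q'. hmul H x r q' * hmul H p' q' a)) (p w * q r))"
    by (simp add: sum_scl sum_distribs scl_sum, simp only: sum_nested,
      rule sum_permute[of "\<lambda>(p',q',u,y,w,x,r). (w,r,p',x,y,q',u)"])
       (auto simp: ac_simps)
  also have "\<dots> = (\<Sum>w r p' x y. scl (hanti H y p' * (\<Sum>u. hcomul H b w u * hcomul H u x y)
       * (\<Sum>d. hmul H p' x d * hmul H d r a)) (p w * q r))"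
    by (simp only: hopf_coassoc[OF H] hopf_assoc[OF H, symmetric])
  also have "\<dots> = (\<Sum>w r. scl (\<Sum>u d. hcomul H b w u * hmul H d r a *
       (\<Sum>x y p'. hcomul H u x y * hanti H y p' * hmul H p' x d)) (p w * q r))"
    by (simp add: sum_scl sum_distribs scl_sum, simp only: sum_nested,
      rule sum_permute[of "\<lambda>(w,r,p',x,y,d,u). (w,r,u,d,x,y,p')"])
       (auto simp: ac_simps)
  also have "\<dots> = (\<Sum>w r. scl ((\<Sum>u. hcounit H u * hcomul H b w u) * (\<Sum>d. hunit H d * hmul H d r a)) (p w * q r))"
    unfolding cop_antipode sum_product by (intro sum.cong refl arg_cong2[where f=scl]) (simp add: ac_simps)
  also have "\<dots> = (\<Sum>w. scl (bas b w) (\<Sum>r. scl (bas r a) (p w * q r)))"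
    by (simp add: hopf_unit[OF H] hopf_counit[OF H] scl_sum del: scl_bas)
  finally show ?thesis by simp
qed

lemma dbl_mult:
  assumes p: "alg_hom H p" and q: "alg_hom (dual H) q" and b: "straighten H p q"
  shows "dbl q p x * dbl q p y = (\<Sum>z. scl (Dmul H x y z) (dbl q p z))"
proof (cases x; cases y)
  fix a b a' b' assume xy: "x = (a, b)" "y = (a', b')"
  have "dbl q p x * dbl q p y = q a * (p b * q a') * p b'"
    by (simp add: dbl_def xy mult.assoc)
  also have "\<dots> = (\<Sum>p' q' r s u w y. scl (hmul H p' q' a' * hmul H r s q' * hcomul H b s u * hcomul H u w y * hanti H y p') ((q a * q r) * (p w * p b')))"
    unfolding straighten_exchange[OF b] by (simp add: sum_distribs mult.assoc)
  also have "\<dots> = (\<Sum>z. scl (Dmul H x y z) (dbl q p z))"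
    unfolding alg_hom_mult[OF p] alg_hom_mult[OF q]
    by (simp add: sum_pair Dmul_def dbl_def xy sum_distribs scl_sum sum_scl, simp only: sum_nested,
      rule sum_permute[of "\<lambda>(p,q,r,s,u,w,y,g,c). (c,g,p,q,r,s,u,w,y)"])
       (auto simp: ac_simps)
  finally show ?thesis .
qed

lemma dbl_unit:
  assumes p: "alg_hom H p" and q: "alg_hom (dual H) q"
  shows "(\<Sum>z. scl (Dunit H z) (dbl q p z)) = 1"
proof -
  have "(\<Sum>z. scl (Dunit H z) (dbl q p z)) = lincomb q (hcounit H) * lincomb p (hunit H)"
    unfolding lincomb_product by (simp add: sum_pair Dunit_def dbl_def)
  then show ?thesis using alg_hom_unit[OF p] alg_hom_unit[OF q] by (simp add: lincomb_def)
qed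

end

text \<open>Both sides encode the same equation between elements: faithfulness of right
  multiplication recovers it, and left multiplication rereads it with the products reversed.\<close>

lemma Rm_rel_Lm:
  assumes M: "algebra M u"
    and eq: "(\<Sum>j\<in>S. scl (c j) (Rm M (X j) * Rm M (Y j))) = (\<Sum>j\<in>T. scl (d j) (Rm M (X' j) * Rm M (Y' j)))"
  shows "(\<Sum>j\<in>S. scl (c j) (Lm M (Y j) * Lm M (X j))) = (\<Sum>j\<in>T. scl (d j) (Lm M (Y' j) * Lm M (X' j)))"
proof -
  have "(\<lambda>F. \<Sum>j\<in>S. c j * bil M (X j) (Y j) F) = (\<lambda>F. \<Sum>j\<in>T. d j * bil M (X' j) (Y' j) F)"
    by (rule Rm_inject[OF M]) (use eq in \<open>simp add: lincomb_sum lincomb_scale Rm_bil[OF M]\<close>)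
  then have "Lm M (\<lambda>F. \<Sum>j\<in>S. c j * bil M (X j) (Y j) F) = Lm M (\<lambda>F. \<Sum>j\<in>T. d j * bil M (X' j) (Y' j) F)"
    by simp
  then show ?thesis by (simp add: lincomb_sum lincomb_scale Lm_bil[OF M])
qed

lemma rv_Rm_Lm: "algebra M u \<Longrightarrow> Rm M (rv X (Rm M A * Lm M B)) = Rm M B * Rm M X * Rm M A"
  by (simp add: rv_mult rv_Rm rv_Lm Rm_bil mult.assoc)

lemma rv_Lm_Rm: "algebra M u \<Longrightarrow> Rm M (rv X (Lm M A * Rm M B)) = Rm M A * Rm M X * Rm M B"
  by (simp add: rv_mult rv_Rm rv_Lm Rm_bil mult.assoc)

lemma Rm_rv_sum: "Rm M (rv X (\<Sum>i\<in>S. T i)) = (\<Sum>i\<in>S. Rm M (rv X (T i)))"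
  by (simp only: lincomb_sum[symmetric] rv_sum[symmetric])

lemma Rm_rv_scl: "Rm M (rv X (scl c T)) = scl c (Rm M (rv X T))"
  by (simp only: lincomb_scale[symmetric] rv_scl[symmetric])

lemma Ad_sum: "Ad D p p' c (\<Sum>i\<in>S. X i) = (\<Sum>i\<in>S. Ad D p p' c (X i))"
  by (simp add: Ad_def sum_distribs scl_sum sum.swap[of _ S] cong: sum.cong)

lemma Ad_scl: "Ad D p p' c (scl k X) = scl k (Ad D p p' c X)"
  by (simp add: Ad_def scl_sum ac_simps)

lemma comm_mult_right:
  fixes T :: "'a::semigroup_mult"
  assumes a: "T * a = a * T" and b: "T * b = b * T"
  shows "T * (a * b) = (a * b) * T"
proof -
  have "T * (a * b) = a * (T * b)" by (simp add: a mult.assoc[symmetric])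
  then show ?thesis by (simp add: b mult.assoc)
qed

lemma cnv_comm:
  assumes "\<And>a. T * p a = p a * T" "\<And>a. T * q a = q a * T"
  shows "T * cnv D p q c = cnv D p q c * T"
  unfolding cnv_def sum_distribs mult_scl
  by (intro sum.cong refl arg_cong2[where f=scl] comm_mult_right assms)

section \<open>Vertex and face operators on the tensor power\<close>

locale kitaev = inv_hopf H + reg_graph src tgt ord
  for H :: "('i::finite, 'k::field) hopf"
    and src tgt :: "'e::finite \<Rightarrow> 'v::finite" and ord :: "'v \<Rightarrow> 'e list"
begin

definition vop :: "'e \<times> bool \<Rightarrow> 'i \<Rightarrow> ('e \<Rightarrow> 'i \<times> 'i, 'k) sqm" where
  "vop d a = edge_op (fst d) (if snd d then lreg H a else fneg H a)"
definition fop :: "'e \<times> bool \<Rightarrow> 'i \<Rightarrow> ('e \<Rightarrow> 'i \<times> 'i, 'k) sqm" where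
  "fop d a = edge_op (fst d) (if snd d then lact H a else gneg H a)"

lemma edge_op_hom: "alg_hom K p \<Longrightarrow> alg_hom K (\<lambda>a. edge_op e (p a))"
  unfolding alg_hom_def alg_fam_def
  by (simp add: edge_op_mult[symmetric] edge_op_scl[symmetric] edge_op_sum[symmetric] edge_op_one)

lemma edge_op_arriving: "arriving H p q \<Longrightarrow> arriving H (\<lambda>a. edge_op e (p a)) (\<lambda>a. edge_op e (q a))"
  unfolding arriving_def by (simp add: edge_op_mult[symmetric] edge_op_scl[symmetric] edge_op_sum[symmetric])

lemma edge_op_departing: "departing H p q \<Longrightarrow> departing H (\<lambda>a. edge_op e (p a)) (\<lambda>a. edge_op e (q a))"
  unfolding departing_def by (simp add: edge_op_mult[symmetric] edge_op_scl[symmetric] edge_op_sum[symmetric])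

lemma vop_hom: "alg_hom H (vop d)"
  unfolding vop_def using edge_op_hom[OF lreg_hom[OF H]] edge_op_hom[OF fneg_hom] by (cases "snd d") simp_all

lemma fop_hom: "alg_hom (dual H) (fop d)"
  unfolding fop_def using edge_op_hom[OF lact_hom[OF H]] edge_op_hom[OF gneg_hom] by (cases "snd d") simp_all

lemma vop_ge_arriving: "arriving H (vop (e, s)) (fop (e, s))"
  unfolding vop_def fop_def using edge_op_arriving[OF arriving_lreg_lact[OF H]] edge_op_arriving[OF arriving_fneg_gneg] by (cases s) simp_all

lemma vop_ge_departing: "departing H (vop (e, s)) (fop (e, \<not> s))"
  unfolding vop_def fop_def using edge_op_departing[OF departing_lreg_gneg] edge_op_departing[OF departing_fneg_lact] by (cases s) simp_all

lemma vop_ge_comm: "fst d \<noteq> fst d' \<Longrightarrow> vop d a * fop d' b = fop d' b * vop d a"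
  by (simp add: vop_def fop_def edge_op_comm)

text \<open>On one edge the two letters are left and right multiplications, which commute by
  associativity; in \<open>fop_comm\<close> the reason is coassociativity.\<close>

lemma vop_comm:
  assumes "d \<noteq> d'"
  shows "vop d a * vop d' b = vop d' b * vop d a"
proof (cases "fst d = fst d'")
  case True
  with assms have "snd d' = (\<not> snd d)" by (auto simp: prod_eq_iff)
  then show ?thesis
    using True lreg_fneg_comm by (auto simp: vop_def edge_op_mult[symmetric])
qed (simp add: vop_def edge_op_comm)

lemma fop_comm:
  assumes "d \<noteq> d'"
  shows "fop d a * fop d' b = fop d' b * fop d a"
proof (cases "fst d = fst d'")
  case True
  with assms have "snd d' = (\<not> snd d)" by (auto simp: prod_eq_iff)
  then show ?thesis
    using True lact_gneg_comm by (auto simp: fop_def edge_op_mult[symmetric])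
qed (simp add: fop_def edge_op_comm)

abbreviation "vP v \<equiv> vfam tgt v (ord v)"
abbreviation "vQ v \<equiv> ffam (rev (face v))"
abbreviation "vp v \<equiv> \<lambda>a. Rm ME (vP v a)"
abbreviation "vq v \<equiv> \<lambda>a. Rm ME (vQ v a)"

lemma vp_eq: "vp v = cword H (map (\<lambda>e. vop (e, tgt e = v)) (ord v))"
proof -
  have "(\<lambda>e a. edge_op e (if tgt e = v then lreg H a else fneg H a)) = (\<lambda>e. vop (e, tgt e = v))"
    by (auto simp: vop_def fun_eq_iff)
  then show ?thesis by (simp only: Rm_vfam)
qed

lemma vq_eq: "vq v = cword (dual H) (map fop (rev (face v)))"
proof -
  have "(\<lambda>d a. edge_op (fst d) (if snd d then lact H a else gneg H a)) = fop"
    by (auto simp: fop_def fun_eq_iff)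
  then show ?thesis by (simp only: Rm_ffam)
qed

lemma vp_at: "Rm ME (vP v a) = cword H (map (\<lambda>e. vop (e, tgt e = v)) (ord v)) a"
  by (rule fun_cong[OF vp_eq])

lemma vq_at: "Rm ME (vQ v a) = cword (dual H) (map fop (rev (face v))) a"
  by (rule fun_cong[OF vq_eq])

lemma vp_hom: "alg_hom H (vp v)"
  unfolding vp_eq by (rule cword_alg_hom[OF H vop_hom vop_comm dist_ord]) simp

lemma face_distinct: "distinct (face v)"
  using face_dist[of v] by (simp add: distinct_map)

lemma vq_hom: "alg_hom (dual H) (vq v)"
  unfolding vq_eq by (rule cword_alg_hom[OF dual_hopf[OF H] fop_hom fop_comm]) (simp_all add: face_distinct)

lemma cword_comm2:
  assumes "\<And>x y a b. x \<in> set xs \<Longrightarrow> y \<in> set ys \<Longrightarrow> g x a * h y b = h y b * g x a"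
  shows "cword K (map g xs) a * cword K' (map h ys) b = cword K' (map h ys) b * cword K (map g xs) a"
  using assms by (intro cword_comm cword_comm[symmetric]) (metis)

lemma vp_comm:
  assumes "v \<noteq> w"
  shows "vp v a * vp w b = vp w b * vp v a"
  unfolding vp_at
proof (intro cword_comm2 vop_comm)
  fix e e' assume "e \<in> set (ord v)" "e' \<in> set (ord w)"
  then show "(e, tgt e = v) \<noteq> (e', tgt e' = w)"
    using assms no_loop by (auto simp: set_ord)
qed

lemma vq_comm:
  assumes "v \<noteq> w"
  shows "vq v a * vq w b = vq w b * vq v a"
  unfolding vq_at
proof (intro cword_comm2 fop_comm)
  fix d d' assume "d \<in> set (rev (face v))" "d' \<in> set (rev (face w))"
  then show "d \<noteq> d'" using face_disjoint[OF assms, of d'] by auto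
qed

lemma flift_unit: "flift H (\<lambda>a. scl (hcounit (dual H) a) 1) =
    (\<lambda>c. scl (case c of (a, b) \<Rightarrow> hcounit H a * hcounit (dual H) b) 1)"
  by (auto simp: liftr_def fun_eq_iff)

text \<open>The word calculus applied in the convolution algebra: \<open>vlift\<close> and
  \<open>flift\<close> turn the iterated convolutions \<open>vp\<close> and \<open>vq\<close> into
  words in lifted letters.\<close>

lemma vertex_face_rel:
  "v \<noteq> w \<Longrightarrow> vp w a * vq v b = vq v b * vp w a"
  "straighten H (vp v) (vq v)"
proof -
  let ?one = "\<lambda>c. scl (case c of (a, b) \<Rightarrow> hcounit H a * hcounit (dual H) b) (1 :: ('e \<Rightarrow> 'i \<times> 'i, 'k) sqm)"
  interpret monoid "hconv H" ?one by (rule hconv_monoid[OF H])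
  interpret word_graph src tgt ord "hconv H" ?one "\<lambda>d. vlift H (vop d)" "\<lambda>d. flift H (fop d)" Wfam
  proof
    fix e e' :: 'e and s s'
    show "hconv H (flift H (fop (e, s))) (vlift H (vop (e, s))) = hconv H (vlift H (vop (e, s))) (hconv H Wfam (flift H (fop (e, s))))"
      using vop_ge_arriving by (simp only: arriving_iff[OF H])
    show "hconv H (vlift H (vop (e, s))) (flift H (fop (e, \<not> s))) = hconv H (flift H (fop (e, \<not> s))) (hconv H Wfam (vlift H (vop (e, s))))"
      using vop_ge_departing by (simp only: departing_iff[OF H])
    assume "e \<noteq> e'"
    then have "\<forall>y g. vop (e', s') y * fop (e, s) g = fop (e, s) g * vop (e', s') y"
      by (intro allI vop_ge_comm) simp
    then show "hconv H (flift H (fop (e, s))) (vlift H (vop (e', s'))) = hconv H (vlift H (vop (e', s'))) (flift H (fop (e, s)))"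
      unfolding comm_iff[OF H] by (rule sym)
  qed
  have P: "vlift H (cword H (map g xs)) = wrd (\<lambda>x. vlift H (g x)) xs" for g :: "'x \<Rightarrow> 'i \<Rightarrow> ('e \<Rightarrow> 'i \<times> 'i, 'k) sqm" and xs
    by (induction xs) (simp_all only: list.map cword_simps wrd.simps vlift_unit[OF H] cnv_liftl_liftl[OF hopf_coalgebras[OF H], symmetric])
  have Q: "flift H (cword (dual H) (map g xs)) = wrd (\<lambda>x. flift H (g x)) xs" for g :: "'x \<Rightarrow> 'i \<Rightarrow> ('e \<Rightarrow> 'i \<times> 'i, 'k) sqm" and xs
    by (induction xs) (simp_all only: list.map cword_simps wrd.simps flift_unit cnv_liftr_liftr[OF hopf_coalgebras[OF H], symmetric])
  show "vp w a * vq v b = vq v b * vp w a" if "v \<noteq> w"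
  proof -
    have "hconv H (vlift H (vp w)) (flift H (vq v)) = hconv H (flift H (vq v)) (vlift H (vp w))"
      unfolding vp_eq vq_eq P Q using face_vertex_comm[OF that] by (rule sym)
    then show ?thesis unfolding comm_iff[OF H, symmetric] by blast
  qed
  show "straighten H (vp v) (vq v)"
    unfolding straighten_iff[OF H] unfolding vp_eq vq_eq P Q by (rule face_vertex_straighten)
qed

abbreviation "lvp v \<equiv> \<lambda>a. Lm ME (vP v a)"
abbreviation "lvq v \<equiv> \<lambda>a. Lm ME (vQ v a)"

lemma Lm_antihom:
  assumes "alg_hom K (\<lambda>a. Rm ME (P a))"
  shows "Lm ME (P a) * Lm ME (P b) = (\<Sum>c. scl (hmul K b a c) (Lm ME (P c)))"
    "(\<Sum>c. scl (hunit K c) (Lm ME (P c))) = 1"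
proof -
  have "bil ME (P b) (P a) = (\<lambda>F. \<Sum>c. hmul K b a c * P c F)"
    by (rule Rm_inject[OF ME_algebra]) (simp add: lincomb_sum lincomb_scale Rm_bil[OF ME_algebra] alg_hom_mult[OF assms])
  from arg_cong[OF this, of "Lm ME"] show "Lm ME (P a) * Lm ME (P b) = (\<Sum>c. scl (hmul K b a c) (Lm ME (P c)))"
    by (simp add: lincomb_sum lincomb_scale Lm_bil[OF ME_algebra])
  have "(\<lambda>F. \<Sum>c. hunit K c * P c F) = tpow1 (DDunit H)"
    by (rule Rm_inject[OF ME_algebra]) (simp add: lincomb_sum lincomb_scale alg_hom_unit[OF assms] lincomb_unit[OF rmul_fam[OF ME_algebra]])
  from arg_cong[OF this, of "Lm ME"] show "(\<Sum>c. scl (hunit K c) (Lm ME (P c))) = 1"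
    by (simp add: lincomb_sum lincomb_scale lincomb_unit[OF lmul_fam[OF ME_algebra]])
qed

text \<open>Left multiplication by the vertex holonomy of S(z), the left half of the
  conjugation.\<close>

abbreviation "ptv v \<equiv> antip H (lvp v)"
abbreviation "qtv v \<equiv> antip (dual H) (lvq v)"

lemma ptv_hom: "alg_hom H (ptv v)"
  by (rule antip_antihom[OF Lm_antihom[OF vp_hom]])

lemma qtv_hom: "alg_hom (dual H) (qtv v)"
  by (rule inv_hopf.antip_antihom[OF dual_inv Lm_antihom[OF vq_hom]])

lemma pq_straighten: "straighten H (ptv v) (qtv v)"
proof (rule antip_straighten)
  fix y g
  have "(\<Sum>j. case j of (a, x, b) \<Rightarrow> scl (hcomul H y a x * hmul H x b g) (vp v a * vq v b))
     = (\<Sum>j. case j of (a, x, b) \<Rightarrow> scl (hmul H a x g * hcomul H y x b) (vq v a * vp v b))"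
    using vertex_face_rel(2)[of v] by (simp add: straighten_def sum_pair)
  then have "(\<Sum>j. scl (case j of (a, x, b) \<Rightarrow> hcomul H y a x * hmul H x b g) (Rm ME (vP v (fst j)) * Rm ME (vQ v (snd (snd j)))))
     = (\<Sum>j. scl (case j of (a, x, b) \<Rightarrow> hmul H a x g * hcomul H y x b) (Rm ME (vQ v (fst j)) * Rm ME (vP v (snd (snd j)))))"
    by (simp add: case_prod_unfold)
  from Rm_rel_Lm[OF ME_algebra this]
  show "(\<Sum>a x b. scl (hcomul H y a x * hmul H x b g) (lvq v b * lvp v a))
     = (\<Sum>a x b. scl (hmul H a x g * hcomul H y x b) (lvp v b * lvq v a))"
    by (simp add: sum_pair)
qed

lemma Rm_rel_comm:
  assumes "Rm ME X * Rm ME Y = Rm ME Y * Rm ME X"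
  shows "Lm ME X * Lm ME Y = Lm ME Y * Lm ME X"
  using Rm_rel_Lm[OF ME_algebra, where S = "{()}" and c = "\<lambda>_. 1" and X = "\<lambda>_. X" and Y = "\<lambda>_. Y"
      and T = "{()}" and d = "\<lambda>_. 1" and X' = "\<lambda>_. Y" and Y' = "\<lambda>_. X"] assms by simp

lemma antip_comm:
  assumes "\<And>b. T * r b = r b * T"
  shows "T * antip K r a = antip K r a * T"
  using assms by (simp add: antip_def sum_distribs)

text \<open>\<open>pp v\<close> and \<open>qq v\<close> are the conjugations by vertex and face
  holonomies. Operators act from the right, so \<open>rho v\<close> at delta (x) z conjugates with
  delta first, as the formula of the action prescribes.\<close>

definition pp :: "'v \<Rightarrow> 'i \<Rightarrow> ('e \<Rightarrow> 'i \<times> 'i, 'k) sqm" where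
  "pp v = cnv (hcomul H) (vp v) (ptv v)"
definition qq :: "'v \<Rightarrow> 'i \<Rightarrow> ('e \<Rightarrow> 'i \<times> 'i, 'k) sqm" where
  "qq v = cnv (hcomul (dual H)) (qtv v) (vq v)"
definition rho :: "'v \<Rightarrow> 'i \<times> 'i \<Rightarrow> ('e \<Rightarrow> 'i \<times> 'i, 'k) sqm" where
  "rho v = dbl (qq v) (pp v)"

lemma Rm_pant_comm: "Rm ME X * antip K (\<lambda>a. Lm ME (Y a)) b = antip K (\<lambda>a. Lm ME (Y a)) b * Rm ME X"
  by (intro antip_comm Rm_Lm_comm[OF ME_algebra])

lemma pp_hom: "alg_hom H (pp v)"
  unfolding pp_def by (intro cnv_alg_hom[OF H vp_hom ptv_hom] Rm_pant_comm)

lemma qq_hom: "alg_hom (dual H) (qq v)"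
  unfolding qq_def by (intro cnv_alg_hom[OF dual_hopf[OF H] qtv_hom vq_hom] Rm_pant_comm[symmetric])

lemma pp_qq_straighten: "straighten H (pp v) (qq v)"
  unfolding pp_def qq_def by (intro straighten_prod vertex_face_rel(2) pq_straighten Rm_pant_comm Rm_pant_comm[symmetric])

lemma rho_mult: "rho v x * rho v y = (\<Sum>z. scl (Dmul H x y z) (rho v z))"
  unfolding rho_def by (rule dbl_mult[OF pp_hom qq_hom pp_qq_straighten])

lemma rho_unit: "(\<Sum>z. scl (Dunit H z) (rho v z)) = 1"
  unfolding rho_def by (rule dbl_unit[OF pp_hom qq_hom])

lemma vertex_comm:
  assumes "v \<noteq> w"
  shows "vp v a * pp w b = pp w b * vp v a" "vp v a * qq w b = qq w b * vp v a"
    "vq v a * pp w b = pp w b * vq v a" "vq v a * qq w b = qq w b * vq v a"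
    "ptv v a * pp w b = pp w b * ptv v a" "ptv v a * qq w b = qq w b * ptv v a"
    "qtv v a * pp w b = pp w b * qtv v a" "qtv v a * qq w b = qq w b * qtv v a"
proof -
  note c = vp_comm[OF assms] vq_comm[OF assms] vertex_face_rel(1)[OF assms] vertex_face_rel(1)[OF assms[symmetric]]
    vertex_face_rel(1)[OF assms, symmetric] vertex_face_rel(1)[OF assms[symmetric], symmetric]
  note l = c[THEN Rm_rel_comm]
  show "vp v a * pp w b = pp w b * vp v a" "vp v a * qq w b = qq w b * vp v a"
    "vq v a * pp w b = pp w b * vq v a" "vq v a * qq w b = qq w b * vq v a"
    unfolding pp_def qq_def by (intro cnv_comm c Rm_pant_comm)+
  have "ptv v a * lvp w b = lvp w b * ptv v a" "ptv v a * lvq w b = lvq w b * ptv v a"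
    "qtv v a * lvp w b = lvp w b * qtv v a" "qtv v a * lvq w b = lvq w b * qtv v a" for a b
    by (rule antip_comm[symmetric], rule l[symmetric])+
  then show "ptv v a * pp w b = pp w b * ptv v a" "ptv v a * qq w b = qq w b * ptv v a"
    "qtv v a * pp w b = pp w b * qtv v a" "qtv v a * qq w b = qq w b * qtv v a"
    unfolding pp_def qq_def by (intro cnv_comm antip_comm Rm_pant_comm[symmetric]; simp)+
qed

lemma rho_comm:
  assumes "v \<noteq> w"
  shows "rho v x * rho w y = rho w y * rho v x"
proof -
  note c = vertex_comm[OF assms]
  have "pp v a * pp w b = pp w b * pp v a" "pp v a * qq w b = qq w b * pp v a"
    "qq v a * pp w b = pp w b * qq v a" "qq v a * qq w b = qq w b * qq v a" for a b
    unfolding pp_def[of v] qq_def[of v]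
    by (rule cnv_comm[symmetric], rule c[symmetric], rule c[symmetric])+
  note d = this this[symmetric]
  show ?thesis
    by (cases x; cases y) (simp add: rho_def dbl_def, intro comm_mult_right comm_mult_right[symmetric] d)
qed

abbreviation "AdP v \<equiv> Ad (hcomul H) (vp v) (antip H (vp v))"
abbreviation "AdQ v \<equiv> Ad (\<lambda>c a b. hmul H b a c) (vq v) (antip (dual H) (vq v))"

lemma Rm_pp: "Rm ME (rv X (pp v z)) = AdP v z (Rm ME X)"
  by (simp add: pp_def cnv_def Ad_def antip_def sum_distribs scl_sum Rm_rv_sum Rm_rv_scl rv_Rm_Lm[OF ME_algebra])

lemma Rm_qq: "Rm ME (rv X (qq v c)) = AdQ v c (Rm ME X)"
  by (simp add: qq_def cnv_def Ad_def antip_def sum_distribs scl_sum Rm_rv_sum Rm_rv_scl rv_Lm_Rm[OF ME_algebra])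
    (rule sum.swap)

lemma Rm_rho: "Rm ME (rv X (rho v x)) = AdP v (snd x) (AdQ v (fst x) (Rm ME X))"
  by (cases x) (simp add: rho_def dbl_def rv_mult Rm_pp Rm_qq)

lemma AdP_mult: "AdP v c (Y * X) = (\<Sum>a b. scl (hcomul H c a b) (AdP v b Y * AdP v a X))"
  by (rule Ad_mult[OF hopf_coalgebra[OF H] antip_cop(2)[OF vp_hom]])

lemma AdQ_mult: "AdQ v c (Y * X) = (\<Sum>a b. scl (hmul H b a c) (AdQ v b Y * AdQ v a X))"
proof (rule Ad_mult)
  show "coalgebra (\<lambda>c a b. hmul H b a c) (hcounit (dual H))"
    using coalgebra_flip[OF hopf_coalgebra[OF dual_hopf[OF H]]] by simp
  fix c
  show "(\<Sum>a b. scl (hmul H b a c) (vq v b * antip (dual H) (vq v) a)) = scl (hcounit (dual H) c) 1"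
    unfolding dual_simps
    unfolding fun_cong[OF antip_cnv(2)[OF dual_hopf[OF H] vq_hom], of v c, unfolded dual_simps, symmetric] cnv_def dual_simps
    by (rule sum.swap)
qed

lemma AdP_one: "AdP v c 1 = scl (hcounit H c) 1"
  by (rule Ad_one[OF antip_cop(1)[OF vp_hom]])

lemma AdQ_one: "AdQ v c 1 = scl (hunit H c) 1"
proof (rule Ad_one)
  fix c
  show "(\<Sum>a b. scl (hmul H b a c) (antip (dual H) (vq v) b * vq v a)) = scl (hunit H c) 1"
    unfolding fun_cong[OF antip_cnv(1)[OF dual_hopf[OF H] vq_hom], of v c, unfolded dual_simps, symmetric] cnv_def dual_simps
    by (rule sum.swap)
qed

text \<open>In \<open>AdP_mult\<close> and \<open>AdQ_mult\<close> the left factor of a product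
  receives the inner legs, that is z_(2) and delta_(1). These form the second leg of the coproduct
  of D(H), so it is the opposite product that is respected.\<close>

lemma rho_module_algebra:
  "rv (bil ME Y X) (rho v x) = (\<lambda>F. \<Sum>x1 x2. Dcomul H x x1 x2 * bil ME (rv Y (rho v x2)) (rv X (rho v x1)) F)"
proof (rule Rm_inject[OF ME_algebra])
  obtain a b where x: "x = (a, b)" by (cases x)
  have "AdP v b (AdQ v a (Rm ME Y * Rm ME X)) = (\<Sum>c1 d1 c2 d2. scl (hmul H d1 c1 a * hcomul H b c2 d2)
      (AdP v d2 (AdQ v d1 (Rm ME Y)) * AdP v c2 (AdQ v c1 (Rm ME X))))"
    by (simp add: AdQ_mult AdP_mult Ad_sum Ad_scl scl_sum)
  also have "\<dots> = (\<Sum>c1 c2 d1 d2. scl (hmul H d1 c1 a * hcomul H b c2 d2)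
      (AdP v d2 (AdQ v d1 (Rm ME Y)) * AdP v c2 (AdQ v c1 (Rm ME X))))"
    by (intro sum.cong refl sum.swap)
  finally show "Rm ME (rv (bil ME Y X) (rho v x)) = Rm ME (\<lambda>F. \<Sum>x1 x2. Dcomul H x x1 x2 * bil ME (rv Y (rho v x2)) (rv X (rho v x1)) F)"
    by (simp add: Rm_rho x Rm_bil[OF ME_algebra] lincomb_sum lincomb_scale sum_pair Dcomul_def)
qed

lemma rho_counit: "rv (tpow1 (DDunit H)) (rho v x) = (\<lambda>F. Dcounit H x * tpow1 (DDunit H) F)"
  by (rule Rm_inject[OF ME_algebra], cases x)
    (simp add: Rm_rho lincomb_scale lincomb_unit[OF rmul_fam[OF ME_algebra]] AdQ_one AdP_one Ad_scl Dcounit_def)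

lemma vertex_action_eq:
  "vertex_action H src tgt ord v \<delta> z X F = (\<Sum>a b. \<delta> a * z b * rv X (rho v (a, b)) F)"
proof -
  have HP: "lin (hol_vertex H src tgt ord v) (\<lambda>(c, d). y c * hcounit H d) = (\<lambda>F. \<Sum>c. y c * vP v c F)" for y
  proof
    fix F
    \<comment> \<open>The argument is y (x) 1 with 1 = eps in the dual, so its second factor
      contributes eps(1) = 1.\<close>
    have "lin (hol_vertex H src tgt ord v) (\<lambda>(c, d). y c * hcounit H d) F = (\<Sum>c. y c * vP v c F * (\<Sum>d. hunit H d * hcounit H d))"
      by (simp add: lin_def hol_vertex_eq[where ord = ord and v = v, OF dist_ord] sum_pair sum_distrib_left ac_simps)
    then show "lin (hol_vertex H src tgt ord v) (\<lambda>(c, d). y c * hcounit H d) F = (\<Sum>c. y c * vP v c F)"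
      by (simp add: hopf_counit_unit[OF H])
  qed
  have HF: "lin (hol_face H src tgt ord v) (\<lambda>(c, d). hunit H c * y d) = (\<lambda>F. \<Sum>d. y d * vQ v d F)" for y
  proof
    fix F
    have "lin (hol_face H src tgt ord v) (\<lambda>(c, d). hunit H c * y d) F = (\<Sum>d. y d * vQ v d F * (\<Sum>c. hunit H c * hcounit H c))"
      by (simp add: lin_def hol_face_eq[OF face_dist] sum_pair sum_distrib_left, subst sum.swap, simp add: ac_simps)
    then show "lin (hol_face H src tgt ord v) (\<lambda>(c, d). hunit H c * y d) F = (\<Sum>d. y d * vQ v d F)"
      by (simp add: hopf_counit_unit[OF H])
  qed
  have b: "(\<lambda>F. \<Sum>c. bas s c * Y c F) = Y s" for s and Y :: "'i \<Rightarrow> ('e \<Rightarrow> 'i \<times> 'i) \<Rightarrow> 'k"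
    by (simp add: fun_eq_iff)
  have va: "vertex_action H src tgt ord v \<delta> z X = (\<lambda>F. \<Sum>a b p q s t. \<delta> a * z b * hmul H p q a * hcomul H b s t *
      bil ME (\<lambda>F. \<Sum>c. hanti H t c * vP v c F)
       (bil ME (\<lambda>F. \<Sum>d. hanti H d p * vQ v d F) (bil ME X (bil ME (vQ v q) (vP v s)))) F)"
    unfolding vertex_action_def Let_def HHmulE_def HP HF b ..
  have "vertex_action H src tgt ord v \<delta> z X = (\<lambda>F. \<Sum>a b. (\<delta> a * z b) * rv X (rho v (a, b)) F)"
  proof (rule Rm_inject[OF ME_algebra])
    have ad: "AdP v b (AdQ v a Z) = (\<Sum>p q s t. scl (hmul H p q a * hcomul H b s t)
       (antip H (vp v) t * (antip (dual H) (vq v) p * (Z * (vq v q * vp v s)))))" for a b Z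
      by (simp add: Ad_def sum_distribs scl_sum mult.assoc, simp only: sum_nested,
      rule sum_permute[of "\<lambda>(s,t,q,p). (p,q,s,t)"]) (auto simp: ac_simps)
    show "Rm ME (vertex_action H src tgt ord v \<delta> z X) = Rm ME (\<lambda>F. \<Sum>a b. (\<delta> a * z b) * rv X (rho v (a, b)) F)"
      unfolding va by (simp add: lincomb_sum lincomb_scale Rm_rho ad Rm_bil[OF ME_algebra] antip_def scl_sum ac_simps)
  qed
  then show ?thesis by simp
qed

end

section \<open>Products of commuting actions\<close>

lemma sum_PiE_insert:
  fixes h :: "('v \<Rightarrow> 'd::finite) \<Rightarrow> 'm::comm_monoid_add"
  assumes "v \<notin> S"
  shows "(\<Sum>K\<in>PiE (insert v S) (\<lambda>_. UNIV). h K) = (\<Sum>c. \<Sum>K\<in>PiE S (\<lambda>_. UNIV). h (K(v := c)))"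
proof -
  have "(\<Sum>K\<in>PiE (insert v S) (\<lambda>_. UNIV). h K) = (\<Sum>(c, K)\<in>UNIV \<times> PiE S (\<lambda>_. UNIV). h (K(v := c)))"
    unfolding PiE_insert_eq
    by (subst sum.reindex) (use assms inj_combinator[of v S "\<lambda>_. UNIV :: 'd set"] in \<open>auto simp: case_prod_unfold inj_on_def\<close>)
  then show ?thesis by (simp add: sum.cartesian_product)
qed

text \<open>The ring of matrices is not commutative, so a product over vertices needs a list to fix
  an order; the operators of different vertices commute by \<open>rho_comm\<close>.\<close>

definition mprod :: "('v \<Rightarrow> ('n::finite, 'k::comm_ring_1) sqm) \<Rightarrow> 'v list \<Rightarrow> ('n, 'k) sqm" where
  "mprod f vs = prod_list (map f vs)"

lemma mprod_simps [simp]: "mprod f [] = 1" "mprod f (v # vs) = f v * mprod f vs"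
  by (simp_all add: mprod_def)

lemma mprod_cong: "(\<And>v. v \<in> set vs \<Longrightarrow> f v = g v) \<Longrightarrow> mprod f vs = mprod g vs"
  unfolding mprod_def by (metis map_cong)

lemma mprod_one: "(\<And>v. v \<in> set vs \<Longrightarrow> f v = 1) \<Longrightarrow> mprod f vs = 1"
  by (induction vs) auto

lemma mprod_single: "distinct vs \<Longrightarrow> v \<in> set vs \<Longrightarrow> (\<And>w. w \<noteq> v \<Longrightarrow> f w = 1) \<Longrightarrow> mprod f vs = f v"
proof (induction vs)
  case (Cons w vs)
  show ?case
  proof (cases "w = v")
    case True
    have "mprod f vs = 1"
    proof (rule mprod_one)
      fix u assume "u \<in> set vs"
      then have "u \<noteq> v" using Cons.prems(1) True by auto
      then show "f u = 1" by (rule Cons.prems(3))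
    qed
    then show ?thesis using True by simp
  qed (use Cons in auto)
qed simp

lemma mprod_sum:
  fixes r :: "'v \<Rightarrow> 'd::finite \<Rightarrow> ('n::finite, 'k::comm_ring_1) sqm"
  shows "distinct vs \<Longrightarrow> mprod (\<lambda>v. \<Sum>c. scl (w v c) (r v c)) vs =
    (\<Sum>K\<in>PiE (set vs) (\<lambda>_. UNIV). scl (\<Prod>v\<in>set vs. w v (K v)) (mprod (\<lambda>v. r v (K v)) vs))"
proof (induction vs)
  case (Cons v vs)
  then have v: "v \<notin> set vs" by simp
  have 1: "(\<Prod>u\<in>insert v (set vs). w u ((K(v := c)) u)) = w v c * (\<Prod>u\<in>set vs. w u (K u))" for K c
  proof -
    have "(\<Prod>u\<in>set vs. w u ((K(v := c)) u)) = (\<Prod>u\<in>set vs. w u (K u))"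
      using v by (intro prod.cong) auto
    then show ?thesis using v by (subst prod.insert) simp_all
  qed
  have 2: "mprod (\<lambda>u. r u ((K(v := c)) u)) vs = mprod (\<lambda>u. r u (K u)) vs" for K c
    using v by (intro mprod_cong) auto
  have "mprod (\<lambda>v. \<Sum>c. scl (w v c) (r v c)) (v # vs) =
     (\<Sum>c. scl (w v c) (r v c)) * (\<Sum>K\<in>PiE (set vs) (\<lambda>_. UNIV). scl (\<Prod>v\<in>set vs. w v (K v)) (mprod (\<lambda>v. r v (K v)) vs))"
    using Cons by simp
  also have "\<dots> = (\<Sum>c. \<Sum>K\<in>PiE (set vs) (\<lambda>_. UNIV). scl (w v c * (\<Prod>v\<in>set vs. w v (K v))) (r v c * mprod (\<lambda>v. r v (K v)) vs))"
    by (simp only: sum_distrib_right) (simp add: sum_distrib_left mult.commute)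
  also have "\<dots> = (\<Sum>K\<in>PiE (insert v (set vs)) (\<lambda>_. UNIV). scl (\<Prod>u\<in>insert v (set vs). w u (K u)) (mprod (\<lambda>u. r u (K u)) (v # vs)))"
    unfolding sum_PiE_insert[OF v] mprod_simps 1 2 by simp
  finally show ?case by simp
qed simp

lemma mprod_sum_UNIV:
  fixes r :: "'v::finite \<Rightarrow> 'd::finite \<Rightarrow> ('n::finite, 'k::comm_ring_1) sqm"
  assumes "distinct vs" "set vs = UNIV"
  shows "(\<Sum>K. scl (\<Prod>v\<in>UNIV. w v (K v)) (mprod (\<lambda>v. r v (K v)) vs)) = mprod (\<lambda>v. \<Sum>c. scl (w v c) (r v c)) vs"
  using mprod_sum[OF assms(1), of w r] by (simp add: assms(2) PiE_UNIV_domain)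

lemma mprod_mult:
  assumes "\<And>v w. v \<noteq> w \<Longrightarrow> f v * g w = g w * f v" "distinct vs"
  shows "mprod f vs * mprod g vs = mprod (\<lambda>v. f v * g v) vs"
  using assms(2)
proof (induction vs)
  case (Cons v vs)
  have "mprod f us * g v = g v * mprod f us" if "v \<notin> set us" for us
    using that
  proof (induction us)
    case (Cons u us)
    then have "f u * g v = g v * f u" "mprod f us * g v = g v * mprod f us" using assms(1) by auto
    then show ?case using comm_mult_right[of "g v" "f u" "mprod f us"] by simp
  qed simp
  then have "mprod f (v # vs) * mprod g (v # vs) = f v * (g v * mprod f vs) * mprod g vs"
    using Cons.prems by (simp add: mult.assoc) (simp add: mult.assoc[symmetric])
  then show ?case using Cons by (simp add: mult.assoc)
qed simp

lemma rv_linear: "rv (\<lambda>F. c * X F + Y F) T = (\<lambda>F. c * rv X T F + rv Y T F)"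
  by (simp add: lin_def fun_eq_iff algebra_simps sum.distrib sum_distrib_left)

lemma rv_sum_left: "rv (\<lambda>F. \<Sum>i\<in>S. a i * X i F) T = (\<lambda>F. \<Sum>i\<in>S. a i * rv (X i) T F)"
  by (rule ext) (simp add: lin_def sum_distribs mult.assoc, rule sum.swap)

lemma rv_lc: "rv X (lincomb T d) F = (\<Sum>G. d G * rv X (T G) F)"
  by (simp add: lincomb_def rv_sum rv_scl)

context kitaev
begin

text \<open>The operator by which the pure tensor with entries \<open>G v\<close> acts on the whole
  tensor power. It is not the map tau_v of the statement, which takes values in the algebra
  itself.\<close>

definition tau :: "'v list \<Rightarrow> ('v \<Rightarrow> 'i \<times> 'i) \<Rightarrow> ('e \<Rightarrow> 'i \<times> 'i, 'k) sqm" where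
  "tau vs G = mprod (\<lambda>v. rho v (G v)) vs"

lemma tau_fam:
  assumes vs: "distinct vs" "set vs = UNIV"
  shows "alg_fam (tpow3 (Dmul H)) (tpow1 (Dunit H)) (tau vs)"
  unfolding alg_fam_def
proof (intro conjI allI)
  fix G G'
  show "tau vs G * tau vs G' = (\<Sum>K. scl (tpow3 (Dmul H) G G' K) (tau vs K))"
    unfolding tau_def tpow3_def mprod_sum_UNIV[OF vs, of "\<lambda>v c. Dmul H (G v) (G' v) c" rho] rho_mult[symmetric]
    by (rule mprod_mult[OF rho_comm vs(1)])
  have "mprod (\<lambda>v. \<Sum>c. scl (Dunit H c) (rho v c)) vs = 1"
    by (rule mprod_one) (rule rho_unit)
  then show "(\<Sum>c. scl (tpow1 (Dunit H) c) (tau vs c)) = 1"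
    unfolding tau_def tpow1_def mprod_sum_UNIV[OF vs, of "\<lambda>v. Dunit H" rho] .
qed

lemma tau_emb:
  assumes vs: "distinct vs" "set vs = UNIV"
  shows "lincomb (tau vs) (emb (Dunit H) v x) = lincomb (rho v) x"
proof -
  have "lincomb (tau vs) (emb (Dunit H) v x) = mprod (\<lambda>w. \<Sum>c. scl (((\<lambda>_. Dunit H)(v := x)) w c) (rho w c)) vs"
    unfolding lincomb_def tau_def emb_prod by (rule mprod_sum_UNIV[OF vs])
  also have "\<dots> = (\<Sum>c. scl (((\<lambda>_. Dunit H)(v := x)) v c) (rho v c))"
    by (rule mprod_single) (use vs rho_unit in auto)
  finally show ?thesis by (simp add: lincomb_def)
qed

text \<open>The action is applied one vertex at a time. Extensional functions on
  \<open>set vs\<close> index the coproduct of the vertices treated so far; once the list exhausts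
  the type they are all functions.\<close>

lemma tau_module_algebra:
  "distinct vs \<Longrightarrow> rv (bil ME Y X) (tau vs G) = (\<lambda>F. \<Sum>G1\<in>PiE (set vs) (\<lambda>_. UNIV). \<Sum>G2\<in>PiE (set vs) (\<lambda>_. UNIV).
     (\<Prod>v\<in>set vs. Dcomul H (G v) (G1 v) (G2 v)) * bil ME (rv Y (tau vs G2)) (rv X (tau vs G1)) F)"
proof (induction vs arbitrary: X Y)
  case Nil
  show ?case by (simp add: tau_def rv_one)
next
  case (Cons v vs)
  then have v: "v \<notin> set vs" by simp
  let ?S = "PiE (set vs) (\<lambda>_. UNIV :: ('i \<times> 'i) set)"
  have t: "tau (v # vs) K = rho v (K v) * tau vs K" for K
    by (simp add: tau_def)
  have t2: "tau vs (K(v := c)) = tau vs K" for K c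
    unfolding tau_def using v by (intro mprod_cong) auto
  have p: "(\<Prod>u\<in>insert v (set vs). Dcomul H (G u) ((G1(v := c1)) u) ((G2(v := c2)) u))
     = Dcomul H (G v) c1 c2 * (\<Prod>u\<in>set vs. Dcomul H (G u) (G1 u) (G2 u))" for G1 G2 c1 c2
  proof -
    have "(\<Prod>u\<in>set vs. Dcomul H (G u) ((G1(v := c1)) u) ((G2(v := c2)) u)) = (\<Prod>u\<in>set vs. Dcomul H (G u) (G1 u) (G2 u))"
      using v by (intro prod.cong) auto
    then show ?thesis using v by (simp add: prod.insert)
  qed
  have "rv (bil ME Y X) (tau (v # vs) G) F = (\<Sum>c1 c2. \<Sum>G1\<in>?S. \<Sum>G2\<in>?S. Dcomul H (G v) c1 c2 * (\<Prod>u\<in>set vs. Dcomul H (G u) (G1 u) (G2 u))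
      * bil ME (rv (rv Y (rho v c2)) (tau vs G2)) (rv (rv X (rho v c1)) (tau vs G1)) F)" for F
  proof -
    have "rv (bil ME Y X) (tau (v # vs) G) = rv (\<lambda>F. \<Sum>x. (case x of (c1, c2) \<Rightarrow> Dcomul H (G v) c1 c2) *
         (case x of (c1, c2) \<Rightarrow> bil ME (rv Y (rho v c2)) (rv X (rho v c1))) F) (tau vs G)"
      unfolding t rv_mult rho_module_algebra by (simp add: sum_pair[where f = "\<lambda>x. case x of (a, b) \<Rightarrow> f a b * g a b F" for f g F] sum.cartesian_product case_prod_unfold)
    also have "\<dots> = (\<lambda>F. \<Sum>x. (case x of (c1, c2) \<Rightarrow> Dcomul H (G v) c1 c2) *
         rv (case x of (c1, c2) \<Rightarrow> bil ME (rv Y (rho v c2)) (rv X (rho v c1))) (tau vs G) F)"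
      by (rule rv_sum_left)
    also have "\<dots> = (\<lambda>F. \<Sum>c1 c2. Dcomul H (G v) c1 c2 * rv (bil ME (rv Y (rho v c2)) (rv X (rho v c1))) (tau vs G) F)"
      by (simp only: UNIV_Times_UNIV[symmetric] sum.cartesian_product case_prod_unfold fst_conv snd_conv)
    finally show ?thesis using Cons by (simp add: sum_distrib_left mult.assoc)
  qed
  also have "(\<Sum>c1 c2. \<Sum>G1\<in>?S. \<Sum>G2\<in>?S. Dcomul H (G v) c1 c2 * (\<Prod>u\<in>set vs. Dcomul H (G u) (G1 u) (G2 u))
      * bil ME (rv (rv Y (rho v c2)) (tau vs G2)) (rv (rv X (rho v c1)) (tau vs G1)) F)
    = (\<Sum>c1. \<Sum>G1\<in>?S. \<Sum>c2. \<Sum>G2\<in>?S. Dcomul H (G v) c1 c2 * (\<Prod>u\<in>set vs. Dcomul H (G u) (G1 u) (G2 u))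
      * bil ME (rv (rv Y (rho v c2)) (tau vs G2)) (rv (rv X (rho v c1)) (tau vs G1)) F)" for F
    by (intro sum.cong refl sum.swap)
  finally show ?case
    by (simp add: sum_PiE_insert[OF v] t t2 rv_mult p[simplified])
qed

lemma tau_counit:
  "rv (tpow1 (DDunit H)) (tau vs G) = (\<lambda>F. (\<Prod>v\<leftarrow>vs. Dcounit H (G v)) * tpow1 (DDunit H) F)"
proof (induction vs)
  case Nil
  show ?case by (simp add: tau_def rv_one)
next
  case (Cons v vs)
  have "rv (tpow1 (DDunit H)) (tau (v # vs) G) = rv (\<lambda>F. Dcounit H (G v) * tpow1 (DDunit H) F) (tau vs G)"
    by (simp add: tau_def rv_mult rho_counit)
  also have "\<dots> = (\<lambda>F. Dcounit H (G v) * rv (tpow1 (DDunit H)) (tau vs G) F)"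
    using rv_linear[where c = "Dcounit H (G v)" and X = "tpow1 (DDunit H)" and Y = "\<lambda>_. 0" and T = "tau vs G"] by (simp add: lin_def)
  finally show ?case by (simp add: Cons mult.assoc)
qed

end

theorem mainTheorem10:
  fixes H :: "('i::finite, 'k::field_char_0) hopf"
    and src tgt :: "'e::finite \<Rightarrow> 'v::finite"
    and ord :: "'v \<Rightarrow> 'e list"
  assumes "hopf_algebra H"
    and "semisimple H"
    and "antipode_involutive H"
    and "regular_ciliated_ribbon_graph src tgt ord"
  shows "\<exists>act :: (('e \<Rightarrow> 'i \<times> 'i) \<Rightarrow> 'k) \<Rightarrow> (('v \<Rightarrow> 'i \<times> 'i) \<Rightarrow> 'k) \<Rightarrow> (('e \<Rightarrow> 'i \<times> 'i) \<Rightarrow> 'k).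
     \<comment> \<open>bilinearity\<close>
     (\<forall>X Y d c. act (\<lambda>F. c * X F + Y F) d = (\<lambda>F. c * act X d F + act Y d F)) \<and>
     (\<forall>X d d' c. act X (\<lambda>G. c * d G + d' G) = (\<lambda>F. c * act X d F + act X d' F)) \<and>
     \<comment> \<open>right module over D(H)^{\<otimes>V}\<close>
     (\<forall>X. act X (unitV H) = X) \<and>
     (\<forall>X d d'. act X (DmulV H d d') = act (act X d) d') \<and>
     \<comment> \<open>the defining formula on (\<delta> \<otimes> z)_v\<close>
     (\<forall>X v \<delta> z. act X (emb (Dunit H) v (\<lambda>(a,b). \<delta> a * z b))
                   = vertex_action H src tgt ord v \<delta> z X) \<and>
     \<comment> \<open>H(H)^{op\<otimes>E} is a right module algebra\<close>
     (\<forall>X Y d. act (HHopE H X Y) d =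
        (\<lambda>F. \<Sum>G\<in>UNIV. \<Sum>K\<in>UNIV. DcomulV H d G K * HHopE H (act X (bas G)) (act Y (bas K)) F)) \<and>
     (\<forall>d. act (unitE H) d = (\<lambda>F. DcounitV H d * unitE H F))"
proof -
  interpret kitaev H src tgt ord
    using assms by unfold_locales
  obtain vs :: "'v list" where vs: "set vs = UNIV" "distinct vs"
    using finite_distinct_list[of "UNIV :: 'v set"] by auto
  note fam = tau_fam[OF vs(2,1)]
  show ?thesis
  \<comment> \<open>The witness multiplies the row vector X by the linear extension of
    \<open>tau vs\<close>, so the module axioms are \<open>tau_fam\<close> read through
    \<open>rv_mult\<close> and \<open>rv_one\<close>.\<close>
  proof (intro exI[of _ "\<lambda>X d. rv X (lincomb (tau vs) d)"] conjI allI)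
    fix X Y :: "('e \<Rightarrow> 'i \<times> 'i) \<Rightarrow> 'k" and d d' :: "('v \<Rightarrow> 'i \<times> 'i) \<Rightarrow> 'k" and c :: 'k and v and \<delta> z :: "'i \<Rightarrow> 'k"
    show "rv (\<lambda>F. c * X F + Y F) (lincomb (tau vs) d) = (\<lambda>F. c * rv X (lincomb (tau vs) d) F + rv Y (lincomb (tau vs) d) F)"
      by (rule rv_linear)
    show "rv X (lincomb (tau vs) (\<lambda>G. c * d G + d' G)) = (\<lambda>F. c * rv X (lincomb (tau vs) d) F + rv X (lincomb (tau vs) d') F)"
      by (simp add: fun_eq_iff rv_lc algebra_simps sum.distrib sum_distrib_left)
    show "rv X (lincomb (tau vs) (unitV H)) = X"
      by (simp add: unitV_def lincomb_unit[OF fam] rv_one)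
    show "rv X (lincomb (tau vs) (DmulV H d d')) = rv (rv X (lincomb (tau vs) d)) (lincomb (tau vs) d')"
      by (simp add: DmulV_def lincomb_bil[OF fam] rv_mult)
    show "rv X (lincomb (tau vs) (emb (Dunit H) v (\<lambda>(a,b). \<delta> a * z b))) = vertex_action H src tgt ord v \<delta> z X"
      by (rule ext) (simp add: tau_emb[OF vs(2,1)] rv_lc sum_pair vertex_action_eq)
    show "rv (HHopE H X Y) (lincomb (tau vs) d) =
        (\<lambda>F. \<Sum>G K. DcomulV H d G K * HHopE H (rv X (lincomb (tau vs) (bas G))) (rv Y (lincomb (tau vs) (bas K))) F)"
    proof
      fix F
      have "rv (HHopE H X Y) (lincomb (tau vs) d) F = (\<Sum>L G K. d L * tpow3 (Dcomul H) L G K *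
          bil ME (rv Y (tau vs K)) (rv X (tau vs G)) F)"
        using tau_module_algebra[where vs = vs and Y = Y and X = X, OF vs(2)]
        by (simp add: HHopE_def HHmulE_def rv_lc vs(1) PiE_UNIV_domain tpow3_def sum_distrib_left mult.assoc)
      also have "\<dots> = (\<Sum>G K L. d L * tpow3 (Dcomul H) L G K *
          bil ME (rv Y (tau vs K)) (rv X (tau vs G)) F)"
        by (subst sum.swap, rule sum.cong[OF refl], rule sum.swap)
      finally show "rv (HHopE H X Y) (lincomb (tau vs) d) F =
        (\<Sum>G K. DcomulV H d G K * HHopE H (rv X (lincomb (tau vs) (bas G))) (rv Y (lincomb (tau vs) (bas K))) F)"
        by (simp add: HHopE_def HHmulE_def DcomulV_def sum_distrib_right)
    qed
    show "rv (unitE H) (lincomb (tau vs) d) = (\<lambda>F. DcounitV H d * unitE H F)"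
      using vs by (simp add: fun_eq_iff unitE_def rv_lc tau_counit DcounitV_def tpow1_def[of "Dcounit H"] sum_distrib_right
          prod.distinct_set_conv_list mult.assoc flip: vs(1))
  qed
qed

end
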